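(* Let $f:\mathbb{R}_+\to\mathbb{R}_+$ be a function such that $$f(2R)\le f(R)^2\le f(2R/\eta_0)\qquad\text{for all } R,$$ where $\eta_0$ is the real root of $X^3+X^2+X-2$. Then there exists a string $\omega\in\{\mathbf{201},\mathbf{211}\}^\infty$ (an infinite concatenation of the words $\mathbf{201}$ and $\mathbf{211}$) such that the volume growth of $G_\omega$, with generating set $S=\{a,b_\omega,c_\omega,d_\omega\}$, satisfies that for any $\epsilon>0$ and all $n\ge1$, $$\exp\left(\frac{c_\epsilon}{n^{\epsilon}}\log f(n)\right)\le v_{G_\omega,S}(n)\le f(Cn),$$ where $C>0$ is a constant independent of $\epsilon$ and $c_\epsilon>0$ is a constant depending on $\epsilon$.
   Context: $\mathbb{R}_+$ denotes the positive real numbers. Grigorchuk groups: the rooted binary tree has the finite words over $\{0,1\}$ as vertices. Its automorphism group acts from the right. An automorphism is written $g=(g_0,g_1)\tau$ with $\tau$ a permutation of $\{0,1\}$, meaning $(iw)\cdot g=(i\cdot\tau)(w\cdot g_i)$. Let $\varepsilon$ be the transposition of $0,1$ and $a=(id,id)\varepsilon$. Let $\{id,b,c,d\}$ be the Klein four-group. The letters $\mathbf{0},\mathbf{1},\mathbf{2}$ denote the three non-trivial homomorphisms $\{id,b,c,d\}\to\{id,a\}\cong\mathbb{Z}/2\mathbb{Z}$, with $\mathbf{0},\mathbf{1},\mathbf{2}$ vanishing on $d,c,b$ respectively. For $\omega=\omega_0\omega_1\ldots\in\{\mathbf 0,\mathbf 1,\mathbf 2\}^\infty$ let $\mathfrak{s}\omega=\omega_1\omega_2\ldots$.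 The automorphisms $b_\omega,c_\omega,d_\omega$ are defined recursively by $x_\omega=(\omega_0(x),x_{\mathfrak{s}\omega})$ for $x\in\{b,c,d\}$. The Grigorchuk group $G_\omega$ is generated by $S=\{a,b_\omega,c_\omega,d_\omega\}$. $v_{G_\omega,S}(n)$ is the number of elements of $G_\omega$ of word length at most $n$ with respect to $S$.
   Formalization: The function f is additionally assumed nondecreasing and non-constant on the positive reals; without this the claim fails (f = 1 satisfies the inequalities but the ball of radius 1 has more than one element, and there are wild non-monotone counterexamples). *)

theory Defs
  imports "HOL-Analysis.Analysis" "HOL-Algebra.Generated_Groups" "HOL-Library.Stream"
begin

section \<open>Volume growth of a finitely generated group\<close>

definition word_length :: "('a, 'b) monoid_scheme \<Rightarrow> 'a set \<Rightarrow> 'a \<Rightarrow> nat" where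
  "word_length G S g =
     (LEAST n. \<exists>xs. length xs = n \<and> set xs \<subseteq> S \<union> m_inv G ` S
                   \<and> foldr (mult G) xs (one G) = g)"

definition volume_growth :: "('a, 'b) monoid_scheme \<Rightarrow> 'a set \<Rightarrow> nat \<Rightarrow> nat" where
  "volume_growth G S n = card {g \<in> generate G S. word_length G S g \<le> n}"


section \<open>Automorphisms of the rooted binary tree\<close>

text \<open>The vertices are the finite words over a two-letter alphabet; \<^const>\<open>False\<close>
  stands for the letter 0 and \<^const>\<open>True\<close> for the letter 1.\<close>

type_synonym vertex = "bool list"

definition is_tree_aut :: "(vertex \<Rightarrow> vertex) \<Rightarrow> bool" where
  "is_tree_aut g \<longleftrightarrow> bij g \<and> g [] = [] \<and> (\<forall>w i. \<exists>j. g (w @ [i]) = g w @ [j])"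

text \<open>The group acts from the right, so the product of \<open>g\<close> and \<open>h\<close> applies \<open>g\<close> first.\<close>

definition tree_aut :: "(vertex \<Rightarrow> vertex) monoid" where
  "tree_aut = \<lparr>carrier = {g. is_tree_aut g}, mult = (\<lambda>g h. h \<circ> g), one = id\<rparr>"

text \<open>\<open>tree_pair g0 g1 t\<close> is the automorphism written \<open>(g0, g1) t\<close>, where \<open>t\<close> permutes
  the alphabet.\<close>

fun tree_pair ::
  "(vertex \<Rightarrow> vertex) \<Rightarrow> (vertex \<Rightarrow> vertex) \<Rightarrow> (bool \<Rightarrow> bool) \<Rightarrow> vertex \<Rightarrow> vertex" where
  "tree_pair g0 g1 t [] = []"
| "tree_pair g0 g1 t (i # w) = t i # (if i then g1 else g0) w"

lemma is_tree_aut_id: "is_tree_aut id"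
  by (simp add: is_tree_aut_def)

lemma is_tree_aut_comp:
  assumes "is_tree_aut g" "is_tree_aut h"
  shows "is_tree_aut (h \<circ> g)"
  unfolding is_tree_aut_def
proof (intro conjI allI)
  show "bij (h \<circ> g)"
    using assms by (simp add: is_tree_aut_def bij_comp)
  show "(h \<circ> g) [] = []"
    using assms by (simp add: is_tree_aut_def)
  fix w i
  obtain j where "g (w @ [i]) = g w @ [j]"
    using assms(1) is_tree_aut_def by blast
  moreover obtain k where "h (g w @ [j]) = h (g w) @ [k]"
    using assms(2) is_tree_aut_def by blast
  ultimately show "\<exists>j. (h \<circ> g) (w @ [i]) = (h \<circ> g) w @ [j]"
    by simp
qed

lemma is_tree_aut_inv:
  assumes "is_tree_aut g"
  shows "is_tree_aut (inv_into UNIV g)"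
  unfolding is_tree_aut_def
proof (intro conjI allI)
  have b: "bij g" and g0: "g [] = []"
    using assms by (simp_all add: is_tree_aut_def)
  show "bij (inv_into UNIV g)"
    using b by (rule bij_imp_bij_inv)
  show "inv_into UNIV g [] = []"
    using b g0 by (metis bij_inv_eq_iff)
  fix w i
  define u where "u = inv_into UNIV g (w @ [i])"
  have gu: "g u = w @ [i]"
    using b by (simp add: u_def bij_is_surj surj_f_inv_f)
  have "u \<noteq> []"
    using gu g0 by auto
  then obtain v k where u: "u = v @ [k]"
    by (metis rev_exhaust)
  obtain j where "g (v @ [k]) = g v @ [j]"
    using assms is_tree_aut_def by blast
  then have "g v = w"
    using gu u by simp
  then have "v = inv_into UNIV g w"
    using b by (metis bij_inv_eq_iff)
  then show "\<exists>j. inv_into UNIV g (w @ [i]) = inv_into UNIV g w @ [j]"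
    using u u_def by auto
qed

lemma group_tree_aut: "group tree_aut"
proof (rule groupI)
  fix g assume "g \<in> carrier tree_aut"
  then have "is_tree_aut g"
    by (simp add: tree_aut_def)
  then have "inv_into UNIV g \<in> carrier tree_aut" "inv_into UNIV g \<otimes>\<^bsub>tree_aut\<^esub> g = \<one>\<^bsub>tree_aut\<^esub>"
    using is_tree_aut_inv[of g]
    by (simp_all add: tree_aut_def is_tree_aut_def bij_is_surj surj_iff[symmetric])
  then show "\<exists>h\<in>carrier tree_aut. h \<otimes>\<^bsub>tree_aut\<^esub> g = \<one>\<^bsub>tree_aut\<^esub>"
    by blast
qed (auto simp: tree_aut_def is_tree_aut_id is_tree_aut_comp comp_assoc)

lemma is_tree_aut_tree_pair:
  assumes "is_tree_aut g0" "is_tree_aut g1" "bij t"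
  shows "is_tree_aut (tree_pair g0 g1 t)"
proof -
  have b: "bij g0" "bij g1"
    using assms by (simp_all add: is_tree_aut_def)
  have "inj (tree_pair g0 g1 t)"
  proof (rule injI)
    fix v w assume "tree_pair g0 g1 t v = tree_pair g0 g1 t w"
    then show "v = w"
      by (cases v; cases w)
        (auto simp: inj_eq[OF bij_is_inj[OF assms(3)]] inj_eq[OF bij_is_inj[OF b(1)]]
           inj_eq[OF bij_is_inj[OF b(2)]] split: if_splits)
  qed
  moreover have "surj (tree_pair g0 g1 t)"
  proof (rule surjI)
    fix v
    show "tree_pair g0 g1 t
        (tree_pair (inv_into UNIV (if inv_into UNIV t False then g1 else g0))
           (inv_into UNIV (if inv_into UNIV t True then g1 else g0))
           (inv_into UNIV t) v) = v"
    proof (cases v)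
      case (Cons i w)
      have "t (inv_into UNIV t i) = i"
        using assms(3) by (simp add: bij_is_surj surj_f_inv_f)
      then show ?thesis
        using b by (cases i) (simp_all add: Cons bij_is_surj surj_f_inv_f)
    qed simp
  qed
  moreover have "\<exists>j. tree_pair g0 g1 t (w @ [i]) = tree_pair g0 g1 t w @ [j]" for w i
    using assms(1,2) by (cases w) (auto simp: is_tree_aut_def)
  ultimately show ?thesis
    by (simp add: is_tree_aut_def bij_def)
qed


section \<open>Grigorchuk groups\<close>

definition aut_a :: "vertex \<Rightarrow> vertex" where
  "aut_a = tree_pair id id Not"

datatype klein = KId | KB | KC | KD

datatype letter = L0 | L1 | L2

fun vanishing :: "letter \<Rightarrow> klein" where
  "vanishing L0 = KD"
| "vanishing L1 = KC"
| "vanishing L2 = KB"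

text \<open>A non-trivial homomorphism from the Klein four-group to \<open>{id, a}\<close> is determined by the
  unique non-trivial element of its kernel.\<close>

definition letter_hom :: "letter \<Rightarrow> klein \<Rightarrow> vertex \<Rightarrow> vertex" where
  "letter_hom l x = (if x = KId \<or> x = vanishing l then id else aut_a)"

text \<open>\<open>grig x \<omega>\<close> is the automorphism \<open>x\<^sub>\<omega>\<close>. The defining equation
  \<open>x\<^sub>\<omega> = (\<omega>\<^sub>0(x), x\<^sub>\<s>\<^sub>\<omega>)\<close> is stated in \<open>grig_eq\<close> below; the definition evaluates it on vertices.\<close>

fun grig :: "klein \<Rightarrow> letter stream \<Rightarrow> vertex \<Rightarrow> vertex" where
  "grig x \<omega> [] = []"
| "grig x \<omega> (False # w) = False # letter_hom (shd \<omega>) x w"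
| "grig x \<omega> (True # w) = True # grig x (stl \<omega>) w"

lemma grig_eq: "grig x \<omega> = tree_pair (letter_hom (shd \<omega>) x) (grig x (stl \<omega>)) id"
proof
  fix w
  show "grig x \<omega> w = tree_pair (letter_hom (shd \<omega>) x) (grig x (stl \<omega>)) id w"
    by (cases "(x, \<omega>, w)" rule: grig.cases) auto
qed

definition grig_gens :: "letter stream \<Rightarrow> (vertex \<Rightarrow> vertex) set" where
  "grig_gens \<omega> = {aut_a, grig KB \<omega>, grig KC \<omega>, grig KD \<omega>}"

definition grigorchuk_group :: "letter stream \<Rightarrow> (vertex \<Rightarrow> vertex) monoid" where
  "grigorchuk_group \<omega> = tree_aut\<lparr>carrier := generate tree_aut (grig_gens \<omega>)\<rparr>"

lemma is_tree_aut_aut_a: "is_tree_aut aut_a"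
proof -
  have "bij Not"
    by (rule involuntory_imp_bij) simp
  then show ?thesis
    by (simp add: aut_a_def is_tree_aut_tree_pair is_tree_aut_id)
qed

lemma letter_hom_invol: "letter_hom l x (letter_hom l x w) = w"
  by (cases w) (simp_all add: letter_hom_def aut_a_def)

lemma grig_invol: "grig x \<omega> (grig x \<omega> w) = w"
  by (induction x \<omega> w rule: grig.induct) (simp_all add: letter_hom_invol)

lemma is_tree_aut_grig: "is_tree_aut (grig x \<omega>)"
proof -
  have l: "is_tree_aut (letter_hom l x)" for l
    by (simp add: letter_hom_def is_tree_aut_id is_tree_aut_aut_a)
  have "\<exists>j. grig x \<omega> (w @ [i]) = grig x \<omega> w @ [j]" for w i
  proof (induction x \<omega> w rule: grig.induct)
    case (1 x \<omega>)
    show ?case by (cases i) (auto simp: letter_hom_def aut_a_def)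
  next
    case (2 x \<omega> w)
    have "letter_hom (shd \<omega>) x = id \<or> letter_hom (shd \<omega>) x = aut_a"
      by (simp add: letter_hom_def)
    then show ?case
      using is_tree_aut_aut_a by (auto simp: is_tree_aut_def)
  next
    case (3 x \<omega> w)
    then show ?case by simp
  qed
  moreover have "bij (grig x \<omega>)"
    by (rule involuntory_imp_bij) (rule grig_invol)
  ultimately show ?thesis
    by (simp add: is_tree_aut_def)
qed

lemma grig_gens_subset: "grig_gens \<omega> \<subseteq> carrier tree_aut"
  by (auto simp: grig_gens_def tree_aut_def is_tree_aut_aut_a is_tree_aut_grig)

lemma group_grigorchuk_group: "group (grigorchuk_group \<omega>)"
  unfolding grigorchuk_group_def
  by (rule subgroup.subgroup_is_group
      [OF group.generate_is_subgroup[OF group_tree_aut grig_gens_subset] group_tree_aut])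

end

theory Submission
  imports Defs "HOL-Real_Asymp.Real_Asymp" "HOL-Library.Discrete_Functions"
begin

text \<open>Write \<open>F = ln f\<close>. The hypotheses say that \<open>F\<close> is nondecreasing with \<open>F (2 R) \<le> 2 F R \<le> F (2 R / \<eta>)\<close>. Attach to the first \<open>k\<close>
  blocks of the string the length scale \<open>L\<^sub>k\<close>, the product of a factor \<open>(2 / \<eta>)\<^sup>3\<close> for each block 201 and a factor 8 for each
  block 211. Then \<open>F L\<^sub>k / 8 ^ k\<close> does not decrease along a block 201 and does not increase along a block 211. So the blocks can be
  chosen by feedback such that \<open>F L\<^sub>k\<close> stays close to \<open>8 ^ k\<close>, the number of vertices at the level \<open>3 k\<close> reached by the
  first \<open>k\<close> blocks (\<open>F_len_scale_bounds\<close>). It remains to see that the ball of radius \<open>L\<^sub>k\<close> has about \<open>exp (8 ^ k)\<close> elements.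

  The upper bound is the contraction of word weights. With suitable weights of the generators, the weights of the
  two sections of an element add up to at most \<open>\<eta>\<close> times its weight, for each letter of a block 201, and to at most its weight
  for the letters of 211, up to an additive constant (\<open>growth_series_le_eta_step\<close>, \<open>growth_series_le_one_step\<close>). Hence the
  series of all \<open>exp (- \<theta> |g|)\<close> is at most a constant times the square of the series of the next group at \<open>\<theta> / \<eta>\<close>,
  and after \<open>k\<close> blocks it is the \<open>8 ^ k\<close>-th power of a constant (\<open>volume_growth_le\<close>).

  The lower bound exhibits many elements by means of a random product. The germ of an element at the ray \<open>111...\<close>, taken modulo
  \<open>b\<close>, is one bit. Toss a coin for each of \<open>N\<close> letters \<open>c\<close>, with random group elements, the jumps, in between. A letter \<open>c\<close> adds
  to the germ at the ray, and its toss can be recovered from the product with some reliability unless the rest of the product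
  brings the ray back to itself or adds to the germ. If this is unlikely for each letter, the entropy of the product is at
  least a constant times \<open>N\<close> (\<open>entropy_law_ge\<close>), and so the product has at least \<open>exp (const * N)\<close> values.

  The jumps are subproducts of elements which, for one level \<open>m\<close>, fix all vertices of level \<open>m\<close> and flip the next digit
  everywhere (\<open>flip_word_flips\<close>). These come from a substitution that copies a word into both sections, and their lengths
  grow as \<open>L\<^sub>k\<close> because the weights above are an eigenvector of the substitution. Random flips of all levels move a point to a
  uniformly distributed vertex. Most of the flips have no germ modulo \<open>b\<close>; the exceptional ones, at the levels that follow a letter
  2, have germs only at points whose further digits are all 1, where a random point rarely is
  (\<open>walk_germ_probability_le\<close>). To keep the product short, a jump of scale \<open>q\<close>, which mixes about \<open>3 b q\<close> levels, is made
  only every \<open>8 ^ (b (q - 1))\<close> steps, for \<open>q = 1, ..., Q\<close>. The point is then recurrent at no scale, and with \<open>N = 8 ^ (b Q)\<close> bits the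
  length exceeds \<open>L\<close> at \<open>b Q\<close> by a power with exponent \<open>O (1 / Q)\<close> only (\<open>eventually_volume_growth_ge\<close>); this is the
  loss \<open>n powr \<epsilon>\<close>. The substitution loses a factor when the type of the blocks changes, so the types are kept constant on the runs
  from \<open>p\<^sup>2\<close> to \<open>(p + 1)\<^sup>2\<close>, which makes this loss subexponential in \<open>k\<close>.\<close>

section \<open>Words in the generators and their sections\<close>

datatype gen = GA | GX klein

fun gen_act :: "letter stream \<Rightarrow> gen \<Rightarrow> vertex \<Rightarrow> vertex" where
  "gen_act \<omega> GA = aut_a"
| "gen_act \<omega> (GX x) = grig x \<omega>"

fun act :: "letter stream \<Rightarrow> gen list \<Rightarrow> vertex \<Rightarrow> vertex" where
  "act \<omega> [] v = v"
| "act \<omega> (s # w) v = act \<omega> w (gen_act \<omega> s v)"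

text \<open>Read letter by letter, a word acts on the subtree below the letter \<open>i\<close> as a word in the generators of the
  next group; \<open>end_letter i w\<close> is the letter to which \<open>i\<close> itself is moved.\<close>

fun sect :: "letter \<Rightarrow> bool \<Rightarrow> gen list \<Rightarrow> gen list" where
  "sect l i [] = []"
| "sect l i (GA # w) = sect l (\<not> i) w"
| "sect l i (GX x # w) =
     (if i then GX x # sect l i w
      else if x = KId \<or> x = vanishing l then sect l i w else GA # sect l i w)"

fun end_letter :: "bool \<Rightarrow> gen list \<Rightarrow> bool" where
  "end_letter i [] = i"
| "end_letter i (GA # w) = end_letter (\<not> i) w"
| "end_letter i (GX x # w) = end_letter i w"

fun klein_mult :: "klein \<Rightarrow> klein \<Rightarrow> klein" where
  "klein_mult KId y = y"
| "klein_mult x KId = x"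
| "klein_mult KB KB = KId" | "klein_mult KB KC = KD" | "klein_mult KB KD = KC"
| "klein_mult KC KB = KD" | "klein_mult KC KC = KId" | "klein_mult KC KD = KB"
| "klein_mult KD KB = KC" | "klein_mult KD KC = KB" | "klein_mult KD KD = KId"

lemma aut_a_Cons [simp]: "aut_a (i # v) = (\<not> i) # v" "aut_a [] = []"
  by (simp_all add: aut_a_def)

lemma aut_a_invol [simp]: "aut_a (aut_a v) = v"
  by (cases v) auto

lemma grig_KId [simp]: "grig KId \<omega> v = v"
proof -
  have "x = KId \<Longrightarrow> grig x \<omega> v = v" for x
    by (induction x \<omega> v rule: grig.induct) (auto simp: letter_hom_def)
  then show ?thesis by simp
qed

lemma letter_hom_klein_mult:
  "letter_hom l (klein_mult x y) v = letter_hom l y (letter_hom l x v)"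
  by (cases l; cases x; cases y) (auto simp: letter_hom_def)

lemma grig_klein_mult: "grig (klein_mult x y) \<omega> v = grig y \<omega> (grig x \<omega> v)"
proof (induction v arbitrary: \<omega>)
  case (Cons i v)
  then show ?case
    by (cases i) (auto simp: letter_hom_klein_mult)
qed simp

lemma gen_act_invol [simp]: "gen_act \<omega> s (gen_act \<omega> s v) = v"
  by (cases s) (auto simp: grig_invol)

lemma act_append: "act \<omega> (u @ w) v = act \<omega> w (act \<omega> u v)"
  by (induction u arbitrary: v) auto

lemma act_rev_self [simp]: "act \<omega> (rev w) (act \<omega> w v) = v"
  by (induction w arbitrary: v) (auto simp: act_append)

lemma act_self_rev [simp]: "act \<omega> w (act \<omega> (rev w) v) = v"
  using act_rev_self[of \<omega> "rev w"] by simp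

lemma act_Nil_vertex [simp]: "act \<omega> w [] = []"
proof (induction w)
  case (Cons s w)
  then show ?case by (cases s) auto
qed simp

lemma act_Cons_vertex:
  "act \<omega> w (i # v) = end_letter i w # act (stl \<omega>) (sect (shd \<omega>) i w) v"
proof (induction w arbitrary: i v)
  case (Cons s w)
  then show ?case
    by (cases s; cases i) (auto simp: letter_hom_def)
qed simp

lemma length_act [simp]: "length (act \<omega> w v) = length v"
  by (induction v arbitrary: \<omega> w) (auto simp: act_Cons_vertex)

lemma act_append_vertex:
  "\<exists>\<omega>' w'. act \<omega> w (u @ v) = act \<omega> w u @ act \<omega>' w' v"
proof (induction u arbitrary: \<omega> w)
  case Nil
  then show ?case by (auto intro!: exI[of _ \<omega>] exI[of _ w])
next
  case (Cons i u)
  then show ?case by (simp add: act_Cons_vertex)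
qed

lemma take_act: "take j (act \<omega> w v) = act \<omega> w (take j v)"
proof (cases "j \<le> length v")
  case True
  obtain \<omega>' w' where "act \<omega> w (take j v @ drop j v) = act \<omega> w (take j v) @ act \<omega>' w' (drop j v)"
    using act_append_vertex by blast
  with True show ?thesis by simp
qed simp

text \<open>Cancelling \<open>aa\<close> and merging adjacent letters of the Klein group yields an alternating word. In an
  alternating word only half of the letters leave a trace in a given section, which is why sections are
  about half as long as the word itself.\<close>

fun red_cons :: "gen \<Rightarrow> gen list \<Rightarrow> gen list" where
  "red_cons GA (GA # r) = r"
| "red_cons GA r = GA # r"
| "red_cons (GX KId) r = r"
| "red_cons (GX x) (GX y # r) =
     (if klein_mult x y = KId then r else GX (klein_mult x y) # r)"
| "red_cons (GX x) r = GX x # r"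

definition red :: "gen list \<Rightarrow> gen list" where
  "red w = foldr red_cons w []"

fun alternating :: "gen list \<Rightarrow> bool" where
  "alternating [] = True"
| "alternating (GA # GA # w) = False"
| "alternating (GA # w) = alternating w"
| "alternating (GX x # GX y # w) = False"
| "alternating (GX x # w) = (x \<noteq> KId \<and> alternating w)"

lemma alternating_Cons_GX: "alternating (GX y # r) \<Longrightarrow> z \<noteq> KId \<Longrightarrow> alternating (GX z # r)"
  by (cases r rule: alternating.cases) auto

lemma alternating_tl: "alternating (s # r) \<Longrightarrow> alternating r"
  by (cases "s # r" rule: alternating.cases) auto

lemma alternating_red_cons: "alternating r \<Longrightarrow> alternating (red_cons s r)"
  by (induction s r rule: red_cons.induct) (auto intro: alternating_Cons_GX dest: alternating_tl)

lemma alternating_red: "alternating (red w)"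
  by (induction w) (auto simp: red_def alternating_red_cons)

lemma act_red_cons: "act \<omega> (red_cons s r) v = act \<omega> (s # r) v"
  by (induction s r rule: red_cons.induct)
     (auto simp: grig_klein_mult[symmetric])

lemma act_red: "act \<omega> (red w) v = act \<omega> w v"
  by (induction w arbitrary: v) (auto simp: red_def act_red_cons)

lemma length_red_cons: "length (red_cons s r) \<le> Suc (length r)"
  by (induction s r rule: red_cons.induct) auto

lemma length_red: "length (red w) \<le> length w"
proof (induction w)
  case (Cons s w)
  then show ?case using length_red_cons[of s "red w"] by (simp add: red_def)
qed (simp add: red_def)

lemma alternating_GX_count:
  "alternating w \<Longrightarrow> 2 * length (filter (\<lambda>s. s \<noteq> GA) w) \<le> Suc (length w)
    \<and> (w \<noteq> [] \<longrightarrow> hd w = GA \<longrightarrow> 2 * length (filter (\<lambda>s. s \<noteq> GA) w) \<le> length w)"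
  by (induction w rule: alternating.induct) auto

lemma length_sect_le: "length (sect l i w) \<le> length (filter (\<lambda>s. s \<noteq> GA) w)"
  by (induction l i w rule: sect.induct) (auto simp: le_SucI)

lemma length_sect_alternating: "alternating w \<Longrightarrow> 2 * length (sect l i w) \<le> Suc (length w)"
  using alternating_GX_count[of w] length_sect_le[of l i w] by linarith

section \<open>Growth series of weighted words\<close>

definition weight :: "real \<Rightarrow> (klein \<Rightarrow> real) \<Rightarrow> gen list \<Rightarrow> real" where
  "weight \<alpha> \<beta> w = sum_list (map (\<lambda>s. case s of GA \<Rightarrow> \<alpha> | GX x \<Rightarrow> \<beta> x) w)"

definition admissible :: "real \<Rightarrow> (klein \<Rightarrow> real) \<Rightarrow> bool" where
  "admissible \<alpha> \<beta> \<longleftrightarrow> \<alpha> \<ge> 0 \<and> \<beta> KId = 0 \<and> (\<forall>x. \<beta> x \<ge> 0)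
     \<and> (\<forall>x y. \<beta> (klein_mult x y) \<le> \<beta> x + \<beta> y)"

text \<open>The sum of \<open>exp (- \<theta> |g|)\<close> over the group is at most \<open>X\<close>. It is stated for finite sets of words that
  represent distinct elements, so that neither convergence nor the existence of minimal representatives has
  to be discussed.\<close>

definition growth_series_le ::
  "letter stream \<Rightarrow> real \<Rightarrow> (klein \<Rightarrow> real) \<Rightarrow> real \<Rightarrow> real \<Rightarrow> bool" where
  "growth_series_le \<omega> \<alpha> \<beta> \<theta> X \<longleftrightarrow>
     (\<forall>S. finite S \<longrightarrow> inj_on (act \<omega>) S \<longrightarrow> (\<Sum>w\<in>S. exp (- \<theta> * weight \<alpha> \<beta> w)) \<le> X)"

lemma weight_simps [simp]:
  "weight \<alpha> \<beta> [] = 0" "weight \<alpha> \<beta> (GA # w) = \<alpha> + weight \<alpha> \<beta> w"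
  "weight \<alpha> \<beta> (GX x # w) = \<beta> x + weight \<alpha> \<beta> w"
  by (simp_all add: weight_def)

lemma weight_red_cons:
  assumes "admissible \<alpha> \<beta>"
  shows "weight \<alpha> \<beta> (red_cons s r) \<le> weight \<alpha> \<beta> (s # r)"
proof -
  have a: "0 \<le> \<alpha>" "\<beta> KId = 0" "\<And>x. 0 \<le> \<beta> x" "\<And>x y. \<beta> (klein_mult x y) \<le> \<beta> x + \<beta> y"
    using assms by (auto simp: admissible_def)
  show ?thesis
    by (induction s r rule: red_cons.induct)
       (use a in \<open>auto intro: add_nonneg_nonneg\<close>)
qed

lemma weight_red:
  assumes "admissible \<alpha> \<beta>"
  shows "weight \<alpha> \<beta> (red w) \<le> weight \<alpha> \<beta> w"
proof (induction w)
  case (Cons s w)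
  then show ?case
    using weight_red_cons[OF assms, of s "red w"] by (cases s) (auto simp: red_def)
qed (simp add: red_def)

definition letter_weight :: "(klein \<Rightarrow> real) \<Rightarrow> gen list \<Rightarrow> real" where
  "letter_weight b w = sum_list (map (\<lambda>s. case s of GA \<Rightarrow> 0 | GX x \<Rightarrow> b x) w)"

lemma letter_weight_simps [simp]:
  "letter_weight b [] = 0" "letter_weight b (GA # w) = letter_weight b w"
  "letter_weight b (GX x # w) = b x + letter_weight b w"
  by (simp_all add: letter_weight_def)

text \<open>An alternating word has at most one letter of the Klein group more than it has letters \<open>a\<close>, so charging \<open>\<alpha>\<close> with
  every letter of the Klein group overcounts by at most one \<open>\<alpha>\<close>.\<close>

lemma letter_weight_alternating:
  assumes "alternating w" "0 \<le> \<alpha>"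
  shows "letter_weight (\<lambda>x. \<beta> x + \<alpha>) w \<le> weight \<alpha> \<beta> w + \<alpha>"
proof -
  have "letter_weight (\<lambda>x. \<beta> x + \<alpha>) w \<le> weight \<alpha> \<beta> w + \<alpha>
     \<and> (w = [] \<or> hd w = GA \<longrightarrow> letter_weight (\<lambda>x. \<beta> x + \<alpha>) w \<le> weight \<alpha> \<beta> w)"
    using assms by (induction w rule: alternating.induct) auto
  then show ?thesis by blast
qed

lemma letter_weight_mono:
  assumes "\<And>x. x \<noteq> KId \<Longrightarrow> b x \<le> c * b' x" "alternating w"
  shows "letter_weight b w \<le> c * letter_weight b' w"
  using assms(2) by (induction w rule: alternating.induct) (auto simp: algebra_simps intro: add_mono assms(1))

text \<open>At every moment the two sections follow opposite letters of the alphabet, so each letter \<open>x\<close> of the word is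
  kept in one section and replaced by its image (\<open>a\<close>, or nothing if it vanishes) in the other.\<close>

lemma weight_sects:
  "weight \<alpha> \<beta> (sect l i w) + weight \<alpha> \<beta> (sect l (\<not> i) w) =
   letter_weight (\<lambda>x. \<beta> x + (if x = KId \<or> x = vanishing l then 0 else \<alpha>)) w"
proof (induction w arbitrary: i)
  case (Cons s w)
  show ?case
  proof (cases s)
    case GA
    then show ?thesis using Cons[of "\<not> i"] by simp
  next
    case (GX x)
    then show ?thesis using Cons[of i] by (cases i) auto
  qed
qed simp

lemma end_letter_flip: "end_letter (\<not> i) w = (\<not> end_letter i w)"
proof (induction w arbitrary: i)
  case (Cons s w)
  show ?case
  proof (cases s)
    case GA
    then show ?thesis using Cons[of "\<not> i"] by simp
  qed (use Cons in auto)
qed simp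

lemma act_eqI_sections:
  assumes "end_letter True w = end_letter True w'"
    and "act (stl \<omega>) (sect (shd \<omega>) True w) = act (stl \<omega>) (sect (shd \<omega>) True w')"
    and "act (stl \<omega>) (sect (shd \<omega>) False w) = act (stl \<omega>) (sect (shd \<omega>) False w')"
  shows "act \<omega> w = act \<omega> w'"
proof
  fix v
  show "act \<omega> w v = act \<omega> w' v"
  proof (cases v)
    case (Cons i u)
    have "end_letter False w = end_letter False w'"
      using end_letter_flip[of True w] end_letter_flip[of True w'] assms(1) by simp
    then show ?thesis using assms Cons by (cases i) (simp_all add: act_Cons_vertex)
  qed simp
qed

lemma growth_series_leI:
  assumes adm: "admissible \<alpha> \<beta>" and th: "\<theta> \<ge> 0"
    and alt: "\<And>R. finite R \<Longrightarrow> inj_on (act \<omega>) R \<Longrightarrow> (\<And>w. w \<in> R \<Longrightarrow> alternating w) \<Longrightarrow>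
      (\<Sum>w\<in>R. exp (- \<theta> * weight \<alpha> \<beta> w)) \<le> X"
  shows "growth_series_le \<omega> \<alpha> \<beta> \<theta> X"
  unfolding growth_series_le_def
proof (intro allI impI)
  fix S :: "gen list set" assume fin: "finite S" and inj: "inj_on (act \<omega>) S"
  have act_red': "act \<omega> (red w) = act \<omega> w" for w by (rule ext) (rule act_red)
  have inj_red: "inj_on red S"
    using inj by (metis act_red' inj_on_def)
  have "(\<Sum>w\<in>S. exp (- \<theta> * weight \<alpha> \<beta> w)) \<le> (\<Sum>w\<in>S. exp (- \<theta> * weight \<alpha> \<beta> (red w)))"
    using weight_red[OF adm] th by (intro sum_mono) (auto intro: mult_left_mono)
  also have "\<dots> = (\<Sum>w\<in>red ` S. exp (- \<theta> * weight \<alpha> \<beta> w))"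
    by (simp add: sum.reindex[OF inj_red])
  also have "\<dots> \<le> X"
  proof (rule alt)
    show "inj_on (act \<omega>) (red ` S)" using inj by (auto simp: inj_on_def act_red')
  qed (use fin alternating_red in auto)
  finally show "(\<Sum>w\<in>S. exp (- \<theta> * weight \<alpha> \<beta> w)) \<le> X" .
qed

text \<open>An element is determined by its two sections and the permutation of the alphabet. When the weights contract
  by the factor \<open>\<eta>\<close> on passing to the sections, this turns a bound for the series of the next group at
  \<open>\<theta> / \<eta>\<close> into a bound by its square at \<open>\<theta>\<close>.\<close>

lemma growth_series_le_step:
  assumes adm: "admissible \<alpha> \<beta>" and adm': "admissible \<alpha>' \<beta>'"
    and contr: "\<And>x. x \<noteq> KId \<Longrightarrow>
        \<beta>' x + (if x = vanishing (shd \<omega>) then 0 else \<alpha>') \<le> \<eta> * (\<beta> x + \<alpha>)"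
    and eta: "\<eta> > 0" and th: "\<theta> \<ge> 0"
    and IH: "growth_series_le (stl \<omega>) \<alpha>' \<beta>' (\<theta> / \<eta>) X"
  shows "growth_series_le \<omega> \<alpha> \<beta> \<theta> (2 * exp (\<theta> * \<alpha>) * X\<^sup>2)"
proof (rule growth_series_leI[OF adm th])
  fix R :: "gen list set"
  assume finR: "finite R" and injR: "inj_on (act \<omega>) R" and altR: "\<And>w. w \<in> R \<Longrightarrow> alternating w"
  let ?l = "shd \<omega>"
  let ?e = "\<lambda>u. exp (- (\<theta> / \<eta>) * weight \<alpha>' \<beta>' u)"
  define U where "U = (\<lambda>(w, i). sect ?l i w) ` (R \<times> UNIV)"
  have finU: "finite U" using finR by (simp add: U_def)
  \<comment> \<open>Different section words may represent the same element: keep a lightest one of each.\<close>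
  define rep where "rep u = (SOME u'. u' \<in> U \<and> act (stl \<omega>) u' = act (stl \<omega>) u \<and>
      (\<forall>u''\<in>U. act (stl \<omega>) u'' = act (stl \<omega>) u \<longrightarrow> weight \<alpha>' \<beta>' u' \<le> weight \<alpha>' \<beta>' u''))" for u
  have rep: "rep u \<in> U \<and> act (stl \<omega>) (rep u) = act (stl \<omega>) u \<and> weight \<alpha>' \<beta>' (rep u) \<le> weight \<alpha>' \<beta>' u"
    if "u \<in> U" for u
  proof -
    let ?C = "{u' \<in> U. act (stl \<omega>) u' = act (stl \<omega>) u}"
    have "finite ?C" "?C \<noteq> {}" using finU that by auto
    then obtain u' where "u' \<in> ?C" "\<And>y. y \<in> ?C \<Longrightarrow> weight \<alpha>' \<beta>' u' \<le> weight \<alpha>' \<beta>' y"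
      using arg_min_if_finite[of ?C "weight \<alpha>' \<beta>'"] by (metis (no_types, lifting) not_le)
    then have "\<exists>u'. u' \<in> U \<and> act (stl \<omega>) u' = act (stl \<omega>) u \<and>
      (\<forall>u''\<in>U. act (stl \<omega>) u'' = act (stl \<omega>) u \<longrightarrow> weight \<alpha>' \<beta>' u' \<le> weight \<alpha>' \<beta>' u'')" by auto
    from someI_ex[OF this] that show ?thesis unfolding rep_def by blast
  qed
  define V where "V = rep ` U"
  have finV: "finite V" using finU by (simp add: V_def)
  have rep_cong: "act (stl \<omega>) u = act (stl \<omega>) u' \<Longrightarrow> rep u = rep u'" for u u'
    by (simp add: rep_def)
  have injV: "inj_on (act (stl \<omega>)) V"
  proof (rule inj_onI)
    fix x y assume "x \<in> V" "y \<in> V" and e: "act (stl \<omega>) x = act (stl \<omega>) y"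
    then obtain u u' where u: "u \<in> U" "x = rep u" "u' \<in> U" "y = rep u'" by (auto simp: V_def)
    then have "act (stl \<omega>) u = act (stl \<omega>) u'" using rep e by metis
    then show "x = y" using u rep_cong by blast
  qed
  have sumV: "(\<Sum>u\<in>V. ?e u) \<le> X"
    using IH finV injV by (simp add: growth_series_le_def)
  define \<Phi> where "\<Phi> w = (end_letter True w, rep (sect ?l True w), rep (sect ?l False w))" for w
  have secU: "w \<in> R \<Longrightarrow> sect ?l i w \<in> U" for w i by (force simp: U_def)
  have inj\<Phi>: "inj_on \<Phi> R"
  proof (rule inj_onI)
    fix w w' assume w: "w \<in> R" "w' \<in> R" and "\<Phi> w = \<Phi> w'"
    then have e: "end_letter True w = end_letter True w'"
      "rep (sect ?l True w) = rep (sect ?l True w')" "rep (sect ?l False w) = rep (sect ?l False w')"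
      by (auto simp: \<Phi>_def)
    have "act \<omega> w = act \<omega> w'"
      by (rule act_eqI_sections) (use e rep secU w in metis)+
    with injR w show "w = w'" by (auto dest: inj_onD)
  qed
  have \<Phi>_im: "\<Phi> ` R \<subseteq> UNIV \<times> V \<times> V"
    using secU by (auto simp: \<Phi>_def V_def)
  have summand: "exp (- \<theta> * weight \<alpha> \<beta> w)
      \<le> exp (\<theta> * \<alpha>) * (?e (rep (sect ?l True w)) * ?e (rep (sect ?l False w)))" if "w \<in> R" for w
  proof -
    have alt: "alternating w" using altR[OF that] .
    have "weight \<alpha>' \<beta>' (rep (sect ?l True w)) + weight \<alpha>' \<beta>' (rep (sect ?l False w))
       \<le> weight \<alpha>' \<beta>' (sect ?l True w) + weight \<alpha>' \<beta>' (sect ?l (\<not> True) w)"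
      using rep[OF secU[OF that, of True]] rep[OF secU[OF that, of False]] by simp
    also have "\<dots> = letter_weight (\<lambda>x. \<beta>' x + (if x = KId \<or> x = vanishing ?l then 0 else \<alpha>')) w"
      by (rule weight_sects)
    also have "\<dots> \<le> \<eta> * letter_weight (\<lambda>x. \<beta> x + \<alpha>) w"
      by (rule letter_weight_mono[OF _ alt]) (use contr in auto)
    also have "\<dots> \<le> \<eta> * (weight \<alpha> \<beta> w + \<alpha>)"
      using letter_weight_alternating[OF alt] adm eta by (simp add: admissible_def)
    finally have "(\<theta> / \<eta>) * (weight \<alpha>' \<beta>' (rep (sect ?l True w)) + weight \<alpha>' \<beta>' (rep (sect ?l False w)))
        \<le> (\<theta> / \<eta>) * (\<eta> * (weight \<alpha> \<beta> w + \<alpha>))"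
      using th eta by (intro mult_left_mono) auto
    also have "\<dots> = \<theta> * weight \<alpha> \<beta> w + \<theta> * \<alpha>"
      using eta by (simp add: algebra_simps)
    finally show ?thesis
      by (simp add: exp_add[symmetric] distrib_left)
  qed
  have "(\<Sum>w\<in>R. exp (- \<theta> * weight \<alpha> \<beta> w)) \<le> (\<Sum>w\<in>R. exp (\<theta> * \<alpha>) * (?e (rep (sect ?l True w)) * ?e (rep (sect ?l False w))))"
    by (intro sum_mono summand)
  also have "\<dots> = (\<Sum>p\<in>\<Phi> ` R. exp (\<theta> * \<alpha>) * (?e (fst (snd p)) * ?e (snd (snd p))))"
    unfolding sum.reindex[OF inj\<Phi>] by (simp add: \<Phi>_def)
  also have "\<dots> \<le> (\<Sum>p\<in>(UNIV :: bool set) \<times> V \<times> V. exp (\<theta> * \<alpha>) * (?e (fst (snd p)) * ?e (snd (snd p))))"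
    using finV \<Phi>_im by (intro sum_mono2) auto
  also have "\<dots> = exp (\<theta> * \<alpha>) * (2 * ((\<Sum>u\<in>V. ?e u) * (\<Sum>u\<in>V. ?e u)))"
  proof -
    have "(\<Sum>u\<in>V. ?e u) * (\<Sum>u\<in>V. ?e u) = (\<Sum>q\<in>V \<times> V. ?e (fst q) * ?e (snd q))"
      unfolding sum_product sum.cartesian_product by (simp add: case_prod_unfold)
    moreover have "(\<Sum>p\<in>(UNIV :: bool set) \<times> V \<times> V. exp (\<theta> * \<alpha>) * (?e (fst (snd p)) * ?e (snd (snd p))))
        = (\<Sum>i\<in>(UNIV :: bool set). \<Sum>q\<in>V \<times> V. exp (\<theta> * \<alpha>) * (?e (fst q) * ?e (snd q)))"
      unfolding sum.cartesian_product by (simp add: case_prod_unfold)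
    ultimately show ?thesis by (simp add: UNIV_bool sum_distrib_left[symmetric])
  qed
  also have "\<dots> \<le> exp (\<theta> * \<alpha>) * (2 * (X * X))"
  proof -
    have n: "0 \<le> (\<Sum>u\<in>V. ?e u)" by (rule sum_nonneg) simp
    with sumV have "(\<Sum>u\<in>V. ?e u) * (\<Sum>u\<in>V. ?e u) \<le> X * X" by (intro mult_mono) linarith+
    then show ?thesis by simp
  qed
  also have "\<dots> = 2 * exp (\<theta> * \<alpha>) * X\<^sup>2"
    by (simp add: power2_eq_square)
  finally show "(\<Sum>w\<in>R. exp (- \<theta> * weight \<alpha> \<beta> w)) \<le> 2 * exp (\<theta> * \<alpha>) * X\<^sup>2" .
qed

lemma growth_series_le_mono:
  "growth_series_le \<omega> \<alpha> \<beta> \<theta> X \<Longrightarrow> X \<le> Y \<Longrightarrow> growth_series_le \<omega> \<alpha> \<beta> \<theta> Y"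
  unfolding growth_series_le_def by force

lemma finite_gen [simp]: "finite (UNIV :: gen set)" and card_gen: "card (UNIV :: gen set) = 5"
proof -
  have "s \<in> {GA, GX KId, GX KB, GX KC, GX KD}" for s
  proof (cases s)
    case (GX x)
    then show ?thesis by (cases x) simp_all
  qed simp
  then have U: "(UNIV :: gen set) = {GA, GX KId, GX KB, GX KC, GX KD}"
    by blast
  show "finite (UNIV :: gen set)" by (subst U) simp
  show "card (UNIV :: gen set) = 5" by (subst U) simp
qed

text \<open>There are \<open>5 ^ k\<close> words of length \<open>k\<close>, and for large \<open>\<theta>\<close> each of them contributes at most \<open>10 ^ (- k)\<close>.\<close>

lemma growth_series_le_base:
  assumes adm: "admissible \<alpha> \<beta>" and m: "m \<le> \<alpha>" "\<And>x. x \<noteq> KId \<Longrightarrow> m \<le> \<beta> x" "m > 0"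
    and th: "\<theta> * m \<ge> ln 10"
  shows "growth_series_le \<omega> \<alpha> \<beta> \<theta> 2"
proof -
  have th0: "\<theta> > 0"
  proof -
    have "0 < ln (10::real)" by simp
    with th have "0 < \<theta> * m" by linarith
    with m(3) show ?thesis by (simp add: zero_less_mult_iff)
  qed
  show ?thesis
  proof (rule growth_series_leI[OF adm less_imp_le[OF th0]])
    fix R :: "gen list set"
    assume finR: "finite R" and altR: "\<And>w. w \<in> R \<Longrightarrow> alternating w"
    have long: "m * length w \<le> weight \<alpha> \<beta> w" if "alternating w" for w
      using that by (induction w rule: alternating.induct) (use m(1,3) in \<open>auto simp: algebra_simps dest!: m(2)\<close>)
    have finL: "finite {w :: gen list. length w = k}" for k
      using finite_lists_length_eq[OF finite_gen, of k] by simp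
    define n where "n = Max (length ` R)"
    have n: "\<And>w. w \<in> R \<Longrightarrow> length w \<le> n"
      using finR by (simp add: n_def)
    have "(\<Sum>w\<in>R. exp (- \<theta> * weight \<alpha> \<beta> w)) \<le> (\<Sum>w\<in>R. (1/10) ^ length w)"
    proof (rule sum_mono)
      fix w assume "w \<in> R"
      then have "m * length w \<le> weight \<alpha> \<beta> w" by (intro long altR)
      then have "\<theta> * (m * length w) \<le> \<theta> * weight \<alpha> \<beta> w" using th0 by simp
      moreover have "ln 10 * length w \<le> \<theta> * m * length w" using th by (intro mult_right_mono) auto
      ultimately have "ln 10 * length w \<le> \<theta> * weight \<alpha> \<beta> w" by (simp add: mult.assoc)
      then have "exp (- \<theta> * weight \<alpha> \<beta> w) \<le> exp (- (ln 10 * length w))" by simp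
      also have "\<dots> = (1/10) ^ length w"
        by (simp add: exp_minus exp_of_nat2_mult power_one_over inverse_eq_divide)
      finally show "exp (- \<theta> * weight \<alpha> \<beta> w) \<le> (1/10) ^ length w" .
    qed
    also have "\<dots> \<le> (\<Sum>w\<in>(\<Union>k\<le>n. {w :: gen list. length w = k}). (1/10) ^ length w)"
    proof (rule sum_mono2)
      show "finite (\<Union>k\<le>n. {w :: gen list. length w = k})" using finL by blast
      show "R \<subseteq> (\<Union>k\<le>n. {w :: gen list. length w = k})" using n by blast
    qed simp
    also have "\<dots> = (\<Sum>k\<le>n. \<Sum>w\<in>{w :: gen list. length w = k}. (1/10) ^ length w)"
      by (rule sum.UNION_disjoint) (simp, use finL in blast, blast)
    also have "\<dots> = (\<Sum>k\<le>n. (1/2) ^ k)"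
    proof (rule sum.cong)
      fix k
      have "card {w :: gen list. length w = k} = 5 ^ k"
        using card_lists_length_eq[OF finite_gen, of k] by (simp add: card_gen)
      then have "(\<Sum>w\<in>{w :: gen list. length w = k}. (1/10::real) ^ length w) = 5 ^ k * (1/10) ^ k"
        by simp
      also have "\<dots> = (1/2) ^ k" by (simp add: power_mult_distrib[symmetric])
      finally show "(\<Sum>w\<in>{w :: gen list. length w = k}. (1/10::real) ^ length w) = (1/2) ^ k" .
    qed simp
    also have "\<dots> \<le> 2"
    proof -
      have "(\<Sum>k\<le>n. (1/2::real) ^ k) = 2 - (1/2) ^ n"
        by (induction n) (simp_all add: field_simps)
      then show ?thesis by simp
    qed
    finally show "(\<Sum>w\<in>R. exp (- \<theta> * weight \<alpha> \<beta> w)) \<le> 2" .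
  qed
qed

section \<open>Balls in the Grigorchuk group\<close>

lemma grig_group_simps [simp]:
  "mult (grigorchuk_group \<omega>) g h = h \<circ> g" "one (grigorchuk_group \<omega>) = id"
  by (simp_all add: grigorchuk_group_def tree_aut_def)

definition proper_words :: "gen list set" where
  "proper_words = {w. GX KId \<notin> set w}"

lemma gens_eq: "grig_gens \<omega> = gen_act \<omega> ` {s. s \<noteq> GX KId}"
proof -
  have "{s. s \<noteq> GX KId} = {GA, GX KB, GX KC, GX KD}"
  proof (intro equalityI subsetI)
    fix s assume "s \<in> {s. s \<noteq> GX KId}"
    then show "s \<in> {GA, GX KB, GX KC, GX KD}"
    proof (cases s)
      case (GX x)
      with \<open>s \<in> _\<close> show ?thesis by (cases x) simp_all
    qed simp
  qed auto
  then show ?thesis by (simp add: grig_gens_def)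
qed

lemma grig_gens_carrier: "grig_gens \<omega> \<subseteq> carrier (grigorchuk_group \<omega>)"
  by (auto simp: grigorchuk_group_def intro: generate.incl)

lemma gens_inv:
  assumes "s \<in> grig_gens \<omega>"
  shows "m_inv (grigorchuk_group \<omega>) s = s"
proof (rule group.inv_equality[OF group_grigorchuk_group])
  obtain t where "s = gen_act \<omega> t" using assms by (auto simp: gens_eq)
  then show "s \<otimes>\<^bsub>grigorchuk_group \<omega>\<^esub> s = \<one>\<^bsub>grigorchuk_group \<omega>\<^esub>"
    by (auto simp: fun_eq_iff)
qed (use assms grig_gens_carrier in auto)

lemma foldr_gens: "foldr (mult (grigorchuk_group \<omega>)) (map (gen_act \<omega>) w) id = act \<omega> w"
  by (induction w) (auto simp: fun_eq_iff)

lemma generate_eq_act: "generate (grigorchuk_group \<omega>) (grig_gens \<omega>) = act \<omega> ` proper_words"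
proof (intro equalityI subsetI)
  fix g assume "g \<in> generate (grigorchuk_group \<omega>) (grig_gens \<omega>)"
  then show "g \<in> act \<omega> ` proper_words"
  proof (induction rule: generate.induct)
    case one
    show ?case by (rule image_eqI[of _ _ "[]"]) (auto simp: proper_words_def fun_eq_iff)
  next
    case (incl h)
    then obtain s where "h = gen_act \<omega> s" "s \<noteq> GX KId" by (auto simp: gens_eq)
    then show ?case
      by (intro image_eqI[of _ _ "[s]"]) (auto simp: proper_words_def fun_eq_iff)
  next
    case (inv h)
    then obtain s where "h = gen_act \<omega> s" "s \<noteq> GX KId" by (auto simp: gens_eq)
    then show ?case
      unfolding gens_inv[OF inv] by (intro image_eqI[of _ _ "[s]"]) (auto simp: proper_words_def fun_eq_iff)
  next
    case (eng g h)
    then obtain u w where "g = act \<omega> u" "h = act \<omega> w" "u \<in> proper_words" "w \<in> proper_words" by auto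
    then show ?case
      by (intro image_eqI[of _ _ "u @ w"]) (auto simp: proper_words_def fun_eq_iff act_append)
  qed
next
  fix g assume "g \<in> act \<omega> ` proper_words"
  then obtain w where w: "g = act \<omega> w" "w \<in> proper_words" by auto
  have "act \<omega> w \<in> generate (grigorchuk_group \<omega>) (grig_gens \<omega>)"
    using w(2)
  proof (induction w)
    case Nil
    have "act \<omega> [] = one (grigorchuk_group \<omega>)" by (auto simp: fun_eq_iff)
    then show ?case using generate.one by metis
  next
    case (Cons s w)
    then have "gen_act \<omega> s \<in> grig_gens \<omega>" by (auto simp: gens_eq proper_words_def)
    then have "gen_act \<omega> s \<otimes>\<^bsub>grigorchuk_group \<omega>\<^esub> act \<omega> w \<in> generate (grigorchuk_group \<omega>) (grig_gens \<omega>)"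
      using Cons by (intro generate.eng[OF generate.incl]) (auto simp: proper_words_def)
    moreover have "gen_act \<omega> s \<otimes>\<^bsub>grigorchuk_group \<omega>\<^esub> act \<omega> w = act \<omega> (s # w)"
      by (auto simp: fun_eq_iff)
    ultimately show ?case by (simp only:)
  qed
  with w show "g \<in> generate (grigorchuk_group \<omega>) (grig_gens \<omega>)" by simp
qed

lemma ball_eq_act:
  "{g \<in> generate (grigorchuk_group \<omega>) (grig_gens \<omega>).
      word_length (grigorchuk_group \<omega>) (grig_gens \<omega>) g \<le> n}
   = act \<omega> ` {w \<in> proper_words. length w \<le> n}" (is "?L = ?R")
proof -
  let ?P = "\<lambda>g n. \<exists>xs. length xs = n \<and>
      set xs \<subseteq> grig_gens \<omega> \<union> m_inv (grigorchuk_group \<omega>) ` grig_gens \<omega> \<and>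
      foldr (mult (grigorchuk_group \<omega>)) xs (one (grigorchuk_group \<omega>)) = g"
  have P: "?P g m \<longleftrightarrow> (\<exists>w\<in>proper_words. length w = m \<and> act \<omega> w = g)" for g m
  proof
    assume "?P g m"
    then obtain xs where xs: "length xs = m" "set xs \<subseteq> grig_gens \<omega>"
      "foldr (mult (grigorchuk_group \<omega>)) xs (one (grigorchuk_group \<omega>)) = g"
      using gens_inv by auto
    have "\<exists>w\<in>proper_words. xs = map (gen_act \<omega>) w"
      using xs(2)
    proof (induction xs)
      case Nil
      show ?case by (auto simp: proper_words_def)
    next
      case (Cons x xs)
      then obtain w s where "w \<in> proper_words" "xs = map (gen_act \<omega>) w" "x = gen_act \<omega> s" "s \<noteq> GX KId"
        by (auto simp: gens_eq)
      then show ?case by (intro bexI[of _ "s # w"]) (auto simp: proper_words_def)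
    qed
    then obtain w where "w \<in> proper_words" "xs = map (gen_act \<omega>) w" by blast
    with xs show "\<exists>w\<in>proper_words. length w = m \<and> act \<omega> w = g"
      using foldr_gens[of \<omega> w] by (intro bexI[of _ w]) auto
  next
    assume "\<exists>w\<in>proper_words. length w = m \<and> act \<omega> w = g"
    then obtain w where "w \<in> proper_words" "length w = m" "act \<omega> w = g" by blast
    then show "?P g m"
      by (intro exI[of _ "map (gen_act \<omega>) w"]) (auto simp: foldr_gens gens_eq proper_words_def)
  qed
  show ?thesis
  proof (intro equalityI subsetI)
    fix g assume g: "g \<in> ?L"
    then obtain w0 where "w0 \<in> proper_words" "act \<omega> w0 = g" by (auto simp: generate_eq_act)
    then have "?P g (length w0)" unfolding P by blast
    then have "?P g (word_length (grigorchuk_group \<omega>) (grig_gens \<omega>) g)"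
      unfolding word_length_def by (rule LeastI)
    with g show "g \<in> ?R" unfolding P by auto
  next
    fix g assume "g \<in> ?R"
    then obtain w where w: "w \<in> proper_words" "length w \<le> n" "act \<omega> w = g" by auto
    then have "?P g (length w)" unfolding P by blast
    then have "word_length (grigorchuk_group \<omega>) (grig_gens \<omega>) g \<le> length w"
      unfolding word_length_def by (rule Least_le)
    with w show "g \<in> ?L" by (auto simp: generate_eq_act)
  qed
qed

lemma volume_growth_eq:
  "volume_growth (grigorchuk_group \<omega>) (grig_gens \<omega>) n = card (act \<omega> ` {w \<in> proper_words. length w \<le> n})"
  unfolding volume_growth_def ball_eq_act ..

abbreviation ball_card :: "letter stream \<Rightarrow> nat \<Rightarrow> nat" where
  "ball_card \<omega> n \<equiv> volume_growth (grigorchuk_group \<omega>) (grig_gens \<omega>) n"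

lemma finite_short_words: "finite {w \<in> proper_words. length w \<le> n}"
  by (rule finite_subset[OF _ finite_lists_length_le[OF finite_gen, of n]]) auto

section \<open>Streams of blocks\<close>

text \<open>The stream that begins with the \<open>k\<close>-th block: 201 where \<open>t\<close> holds and 211 elsewhere.\<close>

definition block_stream :: "(nat \<Rightarrow> bool) \<Rightarrow> nat \<Rightarrow> letter stream" where
  "block_stream t k = flat (smap (\<lambda>i. if t i then [L2, L0, L1] else [L2, L1, L1]) (fromN k))"

lemma block_stream_unfold:
  "block_stream t k = L2 ## (if t k then L0 else L1) ## L1 ## block_stream t (Suc k)"
  unfolding block_stream_def by (subst flat_unfold) auto

lemma block_stream_mem: "block_stream t k \<in> flat ` streams {[L2, L0, L1], [L2, L1, L1]}"
  unfolding block_stream_def by (intro imageI) (auto simp: streams_iff_sset stream.set_map)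

lemma sdrop_block_stream: "sdrop (3 * k) (block_stream t 0) = block_stream t k"
proof (induction k)
  case (Suc k)
  have "sdrop (3 * Suc k) (block_stream t 0) = sdrop 3 (sdrop (3 * k) (block_stream t 0))"
    by (simp add: add.commute)
  also have "\<dots> = block_stream t (Suc k)"
    by (subst Suc, subst block_stream_unfold) (simp add: numeral_3_eq_3)
  finally show ?case .
qed simp

lemma snth_block_stream:
  "block_stream t 0 !! (3 * k) = L2"
  "block_stream t 0 !! (3 * k + 1) = (if t k then L0 else L1)"
  "block_stream t 0 !! (3 * k + 2) = L1"
proof -
  have "block_stream t 0 !! (3 * k + j) = block_stream t k !! j" for j
    by (metis sdrop_block_stream sdrop_snth add.commute)
  moreover have "block_stream t k !! 0 = L2" "block_stream t k !! 1 = (if t k then L0 else L1)"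
    "block_stream t k !! 2 = L1"
    by (subst block_stream_unfold, simp add: numeral_2_eq_2)+
  ultimately show "block_stream t 0 !! (3 * k) = L2"
    "block_stream t 0 !! (3 * k + 1) = (if t k then L0 else L1)"
    "block_stream t 0 !! (3 * k + 2) = L1"
    by (metis add.right_neutral)+
qed

section \<open>The upper bound\<close>

text \<open>Each letter \<open>x\<close> is charged together with one letter \<open>a\<close>, so the relevant quantities are \<open>\<beta> x + \<alpha>\<close>. On
  passing to the sections only the letter that vanishes saves \<open>\<alpha>\<close>. Along the letters of 201 the values
  \<open>\<eta>\<^sup>2\<close>, \<open>\<eta>\<close>, 1 of \<open>\<beta> x + \<alpha>\<close> on the letters that vanish now, next and thereafter (with \<open>\<alpha> = \<eta>\<^sup>2 + \<eta> - 1\<close>)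
  are permuted cyclically up to the factor \<open>\<eta>\<close>; this is where the cubic equation comes from. Along 211 the same
  weights are kept at all levels, and there is no contraction.\<close>

locale eta_root =
  fixes \<eta> :: real
  assumes eta: "\<eta> ^ 3 + \<eta> ^ 2 + \<eta> - 2 = 0"
begin

lemma eta_cube: "\<eta> ^ 3 = 2 - \<eta> - \<eta>\<^sup>2"
  using eta by simp

lemma eta_bounds: "4/5 < \<eta>" "\<eta> < 1"
proof -
  have pos: "\<eta> > 0"
  proof (rule ccontr)
    assume "\<not> \<eta> > 0"
    moreover have "\<eta> * (\<eta>\<^sup>2 + \<eta> + 1) = 2" using eta by (simp add: algebra_simps power2_eq_square power3_eq_cube)
    moreover have "\<eta>\<^sup>2 + \<eta> + 1 = (\<eta> + 1/2)\<^sup>2 + 3/4" by (simp add: power2_eq_square algebra_simps)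
    then have "\<eta>\<^sup>2 + \<eta> + 1 \<ge> 0" using zero_le_power2[of "\<eta> + 1/2"] by linarith
    ultimately show False using mult_nonpos_nonneg[of \<eta> "\<eta>\<^sup>2 + \<eta> + 1"] by linarith
  qed
  show "4/5 < \<eta>"
  proof (rule ccontr)
    assume "\<not> 4/5 < \<eta>"
    then have "\<eta> ^ 3 \<le> (4/5) ^ 3" "\<eta> ^ 2 \<le> (4/5) ^ 2" using pos by (intro power_mono; simp)+
    with eta \<open>\<not> 4/5 < \<eta>\<close> show False by (simp add: power_divide)
  qed
  show "\<eta> < 1"
  proof (rule ccontr)
    assume "\<not> \<eta> < 1"
    then have "\<eta> ^ 3 \<ge> 1" "\<eta> ^ 2 \<ge> 1" by (intro one_le_power; simp)+
    with eta \<open>\<not> \<eta> < 1\<close> show False by simp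
  qed
qed

definition alpha :: real where "alpha = \<eta>\<^sup>2 + \<eta> - 1"

text \<open>Among the nontrivial letters, \<open>p\<close> is the one that vanishes now and \<open>q\<close> the one that vanishes next.\<close>

definition beta :: "klein \<Rightarrow> klein \<Rightarrow> klein \<Rightarrow> real" where
  "beta p q x = (if x = KId then 0 else if x = p then 1 - \<eta> else if x = q then 1 - \<eta>\<^sup>2 else 2 - \<eta> - \<eta>\<^sup>2)"

lemma alpha_bounds: "0 < alpha" "alpha \<le> 1"
proof -
  have "\<eta> ^ 3 < 1" using eta_bounds by (simp add: power_less_one_iff)
  then show "0 < alpha" using eta_cube by (simp add: alpha_def)
  have "\<eta>\<^sup>2 \<le> 1" using eta_bounds by (simp add: power_le_one)
  then show "alpha \<le> 1" using eta_bounds by (simp add: alpha_def)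
qed

lemma eta_sq: "0 < \<eta>\<^sup>2" "\<eta>\<^sup>2 < 1"
  using eta_bounds by (auto simp: power_less_one_iff)

lemma admissible_beta: "p \<noteq> q \<Longrightarrow> p \<noteq> KId \<Longrightarrow> q \<noteq> KId \<Longrightarrow> admissible alpha (beta p q)"
  unfolding admissible_def
proof (intro conjI allI)
  fix x y assume pq: "p \<noteq> q" "p \<noteq> KId" "q \<noteq> KId"
  define u v where "u = 1 - \<eta>" and "v = 1 - \<eta>\<^sup>2"
  have uv: "0 \<le> u" "0 \<le> v" using eta_bounds eta_sq by (auto simp: u_def v_def)
  have b: "beta p q z = (if z = KId then 0 else if z = p then u else if z = q then v else u + v)" for z
    by (simp add: beta_def u_def v_def)
  show "beta p q (klein_mult x y) \<le> beta p q x + beta p q y"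
  proof (cases "x = KId \<or> y = KId \<or> x = y")
    case True
    then show ?thesis unfolding b using uv by (cases x; cases y) auto
  next
    case False
    then have "klein_mult x y \<noteq> x" "klein_mult x y \<noteq> y"
      by (cases x; cases y; simp)+
    moreover have "p = x \<or> p = y \<or> p = klein_mult x y" "q = x \<or> q = y \<or> q = klein_mult x y"
      using False pq by (cases p; cases q; cases x; cases y; simp)+
    ultimately show ?thesis unfolding b using uv False pq by auto
  qed
qed (use alpha_bounds eta_bounds eta_sq in \<open>auto simp: beta_def\<close>)

definition rho :: "bool \<Rightarrow> real" where "rho b = (if b then \<eta> ^ 3 else 1)"

lemma rho_bounds: "1/2 < rho b" "rho b \<le> 1"
proof -
  have "(4/5) ^ 3 < \<eta> ^ 3" using eta_bounds by (intro power_strict_mono) auto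
  then show "1/2 < rho b" by (simp add: rho_def power_divide)
  show "rho b \<le> 1" using eta_bounds by (simp add: rho_def power_le_one)
qed

lemma growth_series_le_eta_step:
  assumes "growth_series_le (stl \<omega>) alpha (beta p' q') (\<theta> / \<eta>) X"
    and "\<theta> \<ge> 0" "\<theta> \<le> \<Theta>"
    and cyc: "p = vanishing (shd \<omega>)" "p' = q" "q' \<noteq> p" "q' \<noteq> q" "p \<noteq> q" "q \<noteq> KId" "q' \<noteq> KId"
  shows "growth_series_le \<omega> alpha (beta p q) \<theta> (2 * exp \<Theta> * X\<^sup>2)"
proof -
  have p: "p \<noteq> KId" using cyc(1) by (cases "shd \<omega>") auto
  have "growth_series_le \<omega> alpha (beta p q) \<theta> (2 * exp (\<theta> * alpha) * X\<^sup>2)"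
  proof (rule growth_series_le_step[where \<eta> = \<eta> and \<alpha>' = alpha and \<beta>' = "beta p' q'"])
    fix x assume x: "x \<noteq> KId"
    then have "x = p \<or> x = q \<or> x = q'"
      using cyc p by (cases x; cases p; cases q; cases q') simp_all
    then show "beta p' q' x + (if x = vanishing (shd \<omega>) then 0 else alpha) \<le> \<eta> * (beta p q x + alpha)"
    proof (elim disjE)
      assume "x = p"
      then have "beta p' q' x = 2 - \<eta> - \<eta>\<^sup>2" "beta p q x = 1 - \<eta>"
        using cyc p by (auto simp: beta_def)
      moreover have "2 - \<eta> - \<eta>\<^sup>2 = \<eta> * (1 - \<eta> + alpha)"
        unfolding alpha_def eta_cube[symmetric] by algebra
      ultimately show ?thesis using \<open>x = p\<close> cyc(1) by (simp only: if_True) simp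
    next
      assume "x = q"
      then have "beta p' q' x = 1 - \<eta>" "beta p q x = 1 - \<eta>\<^sup>2"
        using cyc p by (auto simp: beta_def)
      moreover have "1 - \<eta> + alpha = \<eta> * (1 - \<eta>\<^sup>2 + alpha)"
        unfolding alpha_def by algebra
      ultimately show ?thesis using \<open>x = q\<close> cyc by simp
    next
      assume "x = q'"
      then have "beta p' q' x = 1 - \<eta>\<^sup>2" "beta p q x = 2 - \<eta> - \<eta>\<^sup>2"
        using cyc p by (auto simp: beta_def)
      moreover have "1 - \<eta>\<^sup>2 + alpha = \<eta> * (2 - \<eta> - \<eta>\<^sup>2 + alpha)"
        unfolding alpha_def by algebra
      ultimately show ?thesis using \<open>x = q'\<close> cyc by simp
    qed
  next
    show "admissible alpha (beta p q)" "admissible alpha (beta p' q')"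
      by (rule admissible_beta; use cyc p in simp)+
    show "0 < \<eta>" using eta_bounds by simp
  qed (fact assms)+
  moreover have "\<theta> * alpha \<le> \<Theta> * 1" using assms(2,3) alpha_bounds by (intro mult_mono) auto
  then have "2 * exp (\<theta> * alpha) * X\<^sup>2 \<le> 2 * exp \<Theta> * X\<^sup>2" by (intro mult_right_mono) auto
  ultimately show ?thesis by (rule growth_series_le_mono)
qed

lemma growth_series_le_one_step:
  assumes "growth_series_le (stl \<omega>) alpha (beta p q) \<theta> X"
    and "\<theta> \<ge> 0" "\<theta> \<le> \<Theta>" "p \<noteq> q" "p \<noteq> KId" "q \<noteq> KId"
  shows "growth_series_le \<omega> alpha (beta p q) \<theta> (2 * exp \<Theta> * X\<^sup>2)"
proof -
  have "growth_series_le \<omega> alpha (beta p q) \<theta> (2 * exp (\<theta> * alpha) * X\<^sup>2)"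
    by (rule growth_series_le_step[where \<eta> = 1 and \<alpha>' = alpha and \<beta>' = "beta p q"])
       (use assms(1,2) alpha_bounds in \<open>simp_all add: admissible_beta[OF assms(4-6)]\<close>)
  moreover have "\<theta> * alpha \<le> \<Theta> * 1" using assms(2,3) alpha_bounds by (intro mult_mono) auto
  then have "2 * exp (\<theta> * alpha) * X\<^sup>2 \<le> 2 * exp \<Theta> * X\<^sup>2" by (intro mult_right_mono) auto
  ultimately show ?thesis by (rule growth_series_le_mono)
qed

lemma growth_series_le_block:
  assumes IH: "growth_series_le (block_stream t (Suc k)) alpha (beta KB KD) (\<theta> / rho (t k)) X"
    and th: "\<theta> \<ge> 0" "\<theta> / rho (t k) \<le> \<Theta>"
  shows "growth_series_le (block_stream t k) alpha (beta KB KD) \<theta> ((2 * exp \<Theta>) ^ 7 * X ^ 8)"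
proof -
  let ?D = "2 * exp \<Theta>"
  have eq: "?D * (?D * (?D * X\<^sup>2)\<^sup>2)\<^sup>2 = ?D ^ 7 * X ^ 8"
  proof -
    have "D * (D * (D * X\<^sup>2)\<^sup>2)\<^sup>2 = D ^ 7 * X ^ 8" for D :: real
      by (simp add: eval_nat_numeral mult_ac)
    then show ?thesis .
  qed
  have "growth_series_le (block_stream t k) alpha (beta KB KD) \<theta> (?D * (?D * (?D * X\<^sup>2)\<^sup>2)\<^sup>2)"
  proof (cases "t k")
    case True
    have om: "block_stream t k = L2 ## L0 ## L1 ## block_stream t (Suc k)"
      using True by (subst block_stream_unfold) simp
    have th3: "\<theta> / \<eta> ^ 3 \<le> \<Theta>" using th True by (simp add: rho_def)
    have e: "0 < \<eta>" "\<eta> \<le> 1" using eta_bounds by auto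
    have "\<theta> / \<eta> / \<eta> \<le> \<theta> / \<eta> / \<eta> / \<eta>" "\<theta> / \<eta> \<le> \<theta> / \<eta> / \<eta>" "\<theta> \<le> \<theta> / \<eta>"
      using th(1) e by (simp_all add: le_divide_eq mult_left_le)
    moreover have e3: "\<theta> / \<eta> / \<eta> / \<eta> = \<theta> / \<eta> ^ 3" by (simp add: power3_eq_cube)
    ultimately have ths: "\<theta> \<le> \<Theta>" "\<theta> / \<eta> \<le> \<Theta>" "\<theta> / \<eta> / \<eta> \<le> \<Theta>" using th3 by linarith+
    have 3: "growth_series_le (block_stream t (Suc k)) alpha (beta KB KD) (\<theta> / \<eta> / \<eta> / \<eta>) X"
      unfolding e3 using IH True by (simp add: rho_def)
    have 2: "growth_series_le (L1 ## block_stream t (Suc k)) alpha (beta KC KB) (\<theta> / \<eta> / \<eta>) (?D * X\<^sup>2)"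
      by (rule growth_series_le_eta_step[where p' = KB and q' = KD])
         (use 3 ths th(1) e in auto)
    have 1: "growth_series_le (L0 ## L1 ## block_stream t (Suc k)) alpha (beta KD KC) (\<theta> / \<eta>) (?D * (?D * X\<^sup>2)\<^sup>2)"
      by (rule growth_series_le_eta_step[where p' = KC and q' = KB])
         (use 2 ths th(1) e in auto)
    show ?thesis
      unfolding om
      by (rule growth_series_le_eta_step[where p' = KD and q' = KC])
         (use 1 ths th(1) e in auto)
  next
    case False
    have om: "block_stream t k = L2 ## L1 ## L1 ## block_stream t (Suc k)"
      using False by (subst block_stream_unfold) simp
    have ths: "\<theta> \<le> \<Theta>" and 3: "growth_series_le (block_stream t (Suc k)) alpha (beta KB KD) \<theta> X"
      using IH th False by (simp_all add: rho_def)
    have 2: "growth_series_le (L1 ## block_stream t (Suc k)) alpha (beta KB KD) \<theta> (?D * X\<^sup>2)"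
      by (rule growth_series_le_one_step) (use 3 ths th(1) in auto)
    have 1: "growth_series_le (L1 ## L1 ## block_stream t (Suc k)) alpha (beta KB KD) \<theta> (?D * (?D * X\<^sup>2)\<^sup>2)"
      by (rule growth_series_le_one_step) (use 2 ths th(1) in auto)
    show ?thesis
      unfolding om
      by (rule growth_series_le_one_step) (use 1 ths th(1) in auto)
  qed
  then show ?thesis by (simp only: eq)
qed

text \<open>The square at each level makes the bound at the top the \<open>8 ^ k\<close>-th power of the bound \<open>k\<close> blocks below.\<close>

lemma growth_series_le_blocks:
  assumes "\<Theta> > 0" and base: "\<And>j. growth_series_le (block_stream t j) alpha (beta KB KD) \<Theta> 2"
  shows "growth_series_le (block_stream t j) alpha (beta KB KD) (\<Theta> * (\<Prod>i=j..<j + k. rho (t i)))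
     ((2 * exp \<Theta>) ^ (8 ^ k - 1) * 2 ^ (8 ^ k))"
proof (induction k arbitrary: j)
  case 0
  show ?case using base by simp
next
  case (Suc k)
  let ?D = "2 * exp \<Theta>"
  have r: "0 < rho b" for b using rho_bounds[of b] by linarith
  have P: "(\<Prod>i=j..<j + Suc k. rho (t i)) = rho (t j) * (\<Prod>i=Suc j..<Suc j + k. rho (t i))"
    by (simp add: prod.atLeast_Suc_lessThan)
  have le1: "(\<Prod>i=Suc j..<Suc j + k. rho (t i)) \<le> 1"
    by (rule prod_le_1) (use rho_bounds r in \<open>auto intro: less_imp_le\<close>)
  have th: "\<Theta> * (\<Prod>i=j..<j + Suc k. rho (t i)) / rho (t j) = \<Theta> * (\<Prod>i=Suc j..<Suc j + k. rho (t i))"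
  proof -
    have "\<Theta> * (c * Q) / c = \<Theta> * Q" if "c \<noteq> 0" for c Q :: real using that by simp
    moreover have "rho (t j) \<noteq> 0" using r[of "t j"] by simp
    ultimately show ?thesis unfolding P by blast
  qed
  have "growth_series_le (block_stream t j) alpha (beta KB KD) (\<Theta> * (\<Prod>i=j..<j + Suc k. rho (t i)))
      (?D ^ 7 * (?D ^ (8 ^ k - 1) * 2 ^ (8 ^ k)) ^ 8)"
  proof (rule growth_series_le_block)
    show "0 \<le> \<Theta> * (\<Prod>i=j..<j + Suc k. rho (t i))"
      using assms(1) r by (intro mult_nonneg_nonneg prod_nonneg) (auto intro: less_imp_le)
    show "\<Theta> * (\<Prod>i=j..<j + Suc k. rho (t i)) / rho (t j) \<le> \<Theta>"
      unfolding th using le1 assms(1) by (simp add: mult_left_le)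
  qed (unfold th, rule Suc)
  moreover have "?D ^ 7 * (?D ^ (8 ^ k - 1) * 2 ^ (8 ^ k)) ^ 8 = ?D ^ (8 ^ Suc k - 1) * 2 ^ (8 ^ Suc k)"
  proof -
    have "(8::nat) ^ Suc k - 1 = 7 + (8 ^ k - 1) * 8"
      using one_le_power[of "8::nat" k] by (simp add: diff_mult_distrib)
    then have "?D ^ (8 ^ Suc k - 1) = ?D ^ 7 * (?D ^ (8 ^ k - 1)) ^ 8"
      by (simp only: power_add power_mult)
    moreover have "(2::real) ^ (8 ^ Suc k) = (2 ^ (8 ^ k)) ^ 8"
      by (simp only: power_Suc mult.commute[of 8] power_mult)
    ultimately show ?thesis by (simp only: power_mult_distrib mult.assoc)
  qed
  ultimately show ?case by (simp only:)
qed

text \<open>The product of the contraction factors is \<open>8 ^ k / L\<close>, where \<open>L\<close> is the length scale of the first \<open>k\<close> blocks: a ball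
  of radius \<open>L\<close> has at most \<open>exp (O (8 ^ k))\<close> elements.\<close>

lemma volume_growth_le:
  "\<exists>\<Theta>>0. \<forall>t n k. real (ball_card (block_stream t 0) n)
     \<le> exp (\<Theta> * (\<Prod>i<k. rho (t i)) * n + \<Theta> * 8 ^ k)"
proof -
  define m where "m = Min {alpha, 1 - \<eta>, 1 - \<eta>\<^sup>2, 2 - \<eta> - \<eta>\<^sup>2}"
  have m0: "m > 0" using alpha_bounds eta_bounds eta_sq by (simp add: m_def)
  have m: "m \<le> alpha" "m \<le> 1 - \<eta>" "m \<le> 1 - \<eta>\<^sup>2" "m \<le> 2 - \<eta> - \<eta>\<^sup>2" by (simp_all add: m_def)
  define \<Theta>0 where "\<Theta>0 = ln 10 / m"
  have t0: "\<Theta>0 > 0" using m0 by (simp add: \<Theta>0_def)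
  have base: "growth_series_le (block_stream t j) alpha (beta KB KD) \<Theta>0 2" for t j
    by (rule growth_series_le_base[OF admissible_beta, where m = m])
       (use m m0 in \<open>auto simp: beta_def \<Theta>0_def\<close>)
  define \<Theta> where "\<Theta> = \<Theta>0 + ln 4"
  have b: "real (ball_card (block_stream t 0) n)
     \<le> exp (\<Theta> * (\<Prod>i<k. rho (t i)) * n + \<Theta> * 8 ^ k)" for t n k
  proof -
    let ?\<omega> = "block_stream t 0"
    let ?W = "{w \<in> proper_words. length w \<le> n}"
    let ?th = "\<Theta>0 * (\<Prod>i<k. rho (t i))"
    have r: "0 < rho b" for b using rho_bounds[of b] by linarith
    have th: "?th > 0" using t0 r by (intro mult_pos_pos prod_pos) auto
    obtain S where S: "S \<subseteq> ?W" "inj_on (act ?\<omega>) S" "act ?\<omega> ` S = act ?\<omega> ` ?W"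
      using subset_image_inj[of "act ?\<omega> ` ?W" "act ?\<omega>" ?W] by auto
    have finS: "finite S" using S(1) finite_short_words finite_subset by blast
    have b1: "beta KB KD x \<le> 1" for x
    proof -
      have 1: "1 - \<eta> \<le> 1" "1 - \<eta>\<^sup>2 \<le> 1" "2 - \<eta> - \<eta>\<^sup>2 \<le> 1"
        using eta_bounds eta_sq alpha_bounds(1) unfolding alpha_def by linarith+
      show ?thesis
        by (cases x) (simp_all only: 1 beta_def klein.distinct if_True if_False simp_thms zero_le_one)
    qed
    have wt: "weight alpha (beta KB KD) w \<le> length w" for w
    proof (induction w)
      case (Cons s w)
      show ?case
      proof (cases s)
        case (GX x)
        then show ?thesis using Cons b1[of x] by simp
      qed (use Cons alpha_bounds in simp)
    qed simp
    have "growth_series_le ?\<omega> alpha (beta KB KD) ?th ((2 * exp \<Theta>0) ^ (8 ^ k - 1) * 2 ^ (8 ^ k))"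
      using growth_series_le_blocks[OF t0 base, of t 0 k] by (simp add: atLeast0LessThan)
    then have sum: "(\<Sum>w\<in>S. exp (- ?th * weight alpha (beta KB KD) w)) \<le> (2 * exp \<Theta>0) ^ (8 ^ k - 1) * 2 ^ (8 ^ k)"
      using finS S(2) by (simp add: growth_series_le_def)
    have "real (card (act ?\<omega> ` ?W)) = real (card S)"
      using S by (metis card_image)
    also have "\<dots> = (\<Sum>w\<in>S. exp 0)" by simp
    also have "\<dots> \<le> (\<Sum>w\<in>S. exp (?th * n) * exp (- ?th * weight alpha (beta KB KD) w))"
    proof (rule sum_mono)
      fix w assume "w \<in> S"
      then have "weight alpha (beta KB KD) w \<le> n" using wt[of w] S(1) by fastforce
      then have "?th * weight alpha (beta KB KD) w \<le> ?th * n" using th by (intro mult_left_mono) auto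
      then show "exp (0::real) \<le> exp (?th * n) * exp (- ?th * weight alpha (beta KB KD) w)"
        unfolding exp_add[symmetric] by simp
    qed
    also have "\<dots> = exp (?th * n) * (\<Sum>w\<in>S. exp (- ?th * weight alpha (beta KB KD) w))"
      by (simp add: sum_distrib_left)
    also have "\<dots> \<le> exp (?th * n) * ((2 * exp \<Theta>0) ^ (8 ^ k - 1) * 2 ^ (8 ^ k))"
      using sum by simp
    also have "\<dots> \<le> exp (?th * n) * ((2 * exp \<Theta>0) ^ (8 ^ k) * 2 ^ (8 ^ k))"
    proof -
      have "1 \<le> 2 * exp \<Theta>0" using t0 one_le_exp_iff[of \<Theta>0] by linarith
      then have "(2 * exp \<Theta>0) ^ (8 ^ k - 1) \<le> (2 * exp \<Theta>0) ^ (8 ^ k)" by (intro power_increasing) auto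
      then show ?thesis by (intro mult_left_mono mult_right_mono) auto
    qed
    also have "(2 * exp \<Theta>0) ^ (8 ^ k) * 2 ^ (8 ^ k) = exp \<Theta> ^ (8 ^ k)"
    proof -
      have "exp \<Theta> = 2 * exp \<Theta>0 * 2" by (simp add: \<Theta>_def exp_add)
      then show ?thesis by (simp only: power_mult_distrib)
    qed
    also have "exp \<Theta> ^ (8 ^ k) = exp (\<Theta> * 8 ^ k)"
      using exp_of_nat2_mult[of \<Theta> "8 ^ k"] by simp
    also have "exp (?th * n) * exp (\<Theta> * 8 ^ k) \<le> exp (\<Theta> * (\<Prod>i<k. rho (t i)) * n + \<Theta> * 8 ^ k)"
    proof -
      have "0 \<le> (\<Prod>i<k. rho (t i)) * real n" using r by (intro mult_nonneg_nonneg prod_nonneg) (auto intro: less_imp_le)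
      then have "\<Theta>0 * ((\<Prod>i<k. rho (t i)) * n) \<le> \<Theta> * ((\<Prod>i<k. rho (t i)) * n)"
        by (intro mult_right_mono) (auto simp: \<Theta>_def)
      then show ?thesis by (simp add: exp_add[symmetric] mult.assoc)
    qed
    finally show ?thesis unfolding volume_growth_eq .
  qed
  have "\<Theta> > 0" using t0 by (simp add: \<Theta>_def add_pos_pos)
  with b show ?thesis by blast
qed

end

section \<open>Germs at the rightmost ray\<close>

text \<open>Follow the trajectory of a vertex and count, modulo 2, the letters \<open>c\<close> and \<open>d\<close> applied while it is at a vertex
  all of whose letters are 1. For deep vertices this is the germ of the element at the ray \<open>111...\<close>, an element of the
  Klein group, modulo the subgroup generated by \<open>b\<close>.\<close>

fun germ_parity :: "letter stream \<Rightarrow> gen list \<Rightarrow> vertex \<Rightarrow> bool" where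
  "germ_parity \<omega> [] v = False"
| "germ_parity \<omega> (s # w) v =
     ((s \<in> {GX KC, GX KD} \<and> False \<notin> set v) \<noteq> germ_parity \<omega> w (gen_act \<omega> s v))"

lemma germ_parity_append:
  "germ_parity \<omega> (u @ w) v = (germ_parity \<omega> u v \<noteq> germ_parity \<omega> w (act \<omega> u v))"
  by (induction u arbitrary: v) auto

lemma grig_all_True [simp]: "False \<notin> set v \<Longrightarrow> grig x \<omega> v = v"
proof (induction v arbitrary: \<omega>)
  case (Cons i v)
  then show ?case by (cases i) auto
qed simp

lemma all_True_grig [simp]: "False \<in> set (grig x \<omega> v) \<longleftrightarrow> False \<in> set v"
  by (metis grig_all_True grig_invol)

lemma germ_parity_sect:
  "germ_parity \<omega> w (i # v) = germ_parity (stl \<omega>) (sect (shd \<omega>) i w) v"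
proof (induction w arbitrary: i v)
  case (Cons s w)
  then show ?case
    by (cases s; cases i) (auto simp: letter_hom_def)
qed simp

lemma klein_mult_mod_b:
  "klein_mult x y \<in> {KC, KD} \<longleftrightarrow> (x \<in> {KC, KD}) \<noteq> (y \<in> {KC, KD})"
  by (cases x; cases y) auto

lemma germ_parity_red_cons: "germ_parity \<omega> (red_cons s r) v = germ_parity \<omega> (s # r) v"
proof (cases s)
  case GA
  then show ?thesis by (cases r rule: list.exhaust; cases "hd r") auto
next
  case (GX x)
  show ?thesis
  proof (cases "\<exists>y r'. r = GX y # r'")
    case True
    then obtain y r' where "r = GX y # r'" by blast
    then show ?thesis
      using GX by (cases x; cases y) (auto simp: grig_klein_mult[symmetric])
  next
    case False
    then have "x \<noteq> KId \<longrightarrow> red_cons s r = s # r"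
      using GX by (cases r; cases "hd r"; cases x) auto
    then show ?thesis using GX by (cases x) auto
  qed
qed

lemma germ_parity_red: "germ_parity \<omega> (red w) v = germ_parity \<omega> w v"
  by (induction w arbitrary: v) (auto simp: red_def germ_parity_red_cons)

lemma germ_parity_rev: "germ_parity \<omega> (rev w) (act \<omega> w v) = germ_parity \<omega> w v"
proof (induction w arbitrary: v)
  case (Cons s w)
  then show ?case by (cases s) (auto simp: germ_parity_append)
qed simp

lemma grig_nontrivial:
  assumes "x \<in> {KC, KD}" "\<omega> !! m = L2"
  shows "grig x \<omega> (replicate m True @ [False, False]) = replicate m True @ [False, True]"
  using assms(2) by (induction m arbitrary: \<omega>) (use assms(1) in \<open>auto simp: letter_hom_def\<close>)

text \<open>Merging letters and passing to the section below 1 do not change the parity, but halve the word.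
  What remains in the end is a single letter that represents the identity, and \<open>c\<close>, \<open>d\<close> do not.\<close>

lemma germ_parity_trivial:
  assumes "\<And>n. \<exists>m\<ge>n. \<omega> !! m = L2" and "\<And>v. act \<omega> w v = v" and "length w \<le> K"
  shows "\<not> germ_parity \<omega> w (replicate K True)"
  using assms
proof (induction K arbitrary: \<omega> w)
  case 0
  then show ?case by simp
next
  case (Suc K)
  define r where "r = red w"
  have id: "act \<omega> r v = v" for v using Suc.prems(2) by (simp add: r_def act_red)
  have len: "length r \<le> Suc K" using length_red[of w] Suc.prems(3) by (simp add: r_def)
  have "\<not> germ_parity \<omega> r (replicate (Suc K) True)"
  proof (cases "length r \<le> 1")
    case True
    then consider "r = []" | s where "r = [s]" by (cases r) auto
    then show ?thesis
    proof cases
      case (2 s)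
      show ?thesis
      proof (cases s)
        case GA
        then show ?thesis using id[of "[True]"] 2 by simp
      next
        case (GX x)
        have "x \<notin> {KC, KD}"
        proof
          assume x: "x \<in> {KC, KD}"
          obtain m where "\<omega> !! m = L2" using Suc.prems(1) by blast
          from grig_nontrivial[OF x this] id[of "replicate m True @ [False, False]"] 2 GX
          show False by simp
        qed
        then show ?thesis using 2 GX by auto
      qed
    qed simp
  next
    case False
    let ?s = "sect (shd \<omega>) True r"
    have "2 * length ?s \<le> Suc (length r)"
      by (rule length_sect_alternating) (simp add: r_def alternating_red)
    then have "length ?s \<le> K" using False len by linarith
    moreover have "act (stl \<omega>) ?s v = v" for v
      using id[of "True # v"] by (simp add: act_Cons_vertex)
    moreover have "\<exists>m\<ge>n. stl \<omega> !! m = L2" for n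
    proof -
      obtain m where "m \<ge> Suc n" "\<omega> !! m = L2" using Suc.prems(1) by blast
      then show ?thesis by (intro exI[of _ "m - 1"]) (cases m; simp)
    qed
    ultimately have "\<not> germ_parity (stl \<omega>) ?s (replicate K True)" by (intro Suc.IH)
    then show ?thesis by (simp add: germ_parity_sect)
  qed
  then show ?case by (simp add: r_def germ_parity_red)
qed

text \<open>So the parity at a sufficiently deep vertex is a function of the group element.\<close>

lemma germ_parity_cong:
  assumes "\<And>n. \<exists>m\<ge>n. \<omega> !! m = L2" and eq: "act \<omega> w = act \<omega> w'" and "length w + length w' \<le> K"
  shows "germ_parity \<omega> w (replicate K True) = germ_parity \<omega> w' (replicate K True)"
proof -
  let ?o = "replicate K True"
  have "\<not> germ_parity \<omega> (w @ rev w') ?o"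
    by (rule germ_parity_trivial) (use assms in \<open>auto simp: act_append\<close>)
  then show ?thesis
    using germ_parity_rev[of \<omega> w' ?o] eq by (simp add: germ_parity_append)
qed

section \<open>A substitution that copies a word into both sections\<close>

text \<open>The list \<open>x\<^sub>1, ..., x\<^sub>n\<close> stands for the word \<open>x\<^sub>1 a ... x\<^sub>n a\<close>.\<close>

fun word_of :: "klein list \<Rightarrow> gen list" where
  "word_of [] = []"
| "word_of (x # w) = GX x # GA # word_of w"

text \<open>If \<open>x\<close> does not vanish, then \<open>x a x a\<close> has the sections \<open>a x\<close> and \<open>x a\<close>. The letter \<open>z\<close> that vanishes is invisible
  in one of the sections, but with the two other letters \<open>p\<close>, \<open>q\<close> the word \<open>p a z a q\<close> has the sections
  \<open>a z a\<close> and \<open>p q = z\<close>: three letters suffice to produce \<open>z\<close> in both.\<close>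

fun sub :: "letter \<Rightarrow> klein \<Rightarrow> klein list" where
  "sub L0 x = (if x = KD then [KB, KD, KC] else [x, x])"
| "sub L1 x = (if x = KC then [KB, KC, KD] else [x, x])"
| "sub L2 x = (if x = KB then [KC, KB, KD] else [x, x])"

definition subs :: "letter \<Rightarrow> klein list \<Rightarrow> klein list" where
  "subs l w = concat (map (sub l) w)"

lemma subs_simps [simp]: "subs l [] = []" "subs l (x # w) = sub l x @ subs l w"
  by (simp_all add: subs_def)

lemma word_of_append [simp]: "word_of (u @ w) = word_of u @ word_of w"
  by (induction u) auto

text \<open>The section at \<open>i\<close> of the word obtained by the substitution. Each vanishing letter exchanges the roles of
  the two sections, whence the parity.\<close>

definition copy :: "bool \<Rightarrow> letter \<Rightarrow> klein list \<Rightarrow> gen list" where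
  "copy i l w = (if i then word_of w else GA # word_of w @ [GA])
      @ (if even (count_list w (vanishing l)) then [] else [GA])"

lemma sub_nonvanishing: "x \<noteq> vanishing l \<Longrightarrow> sub l x = [x, x]"
  by (cases l) auto

lemma sub_vanishing:
  obtains p q where "sub l (vanishing l) = [p, vanishing l, q]" "klein_mult p q = vanishing l"
    "p \<noteq> KId" "p \<noteq> vanishing l" "q \<noteq> KId" "q \<noteq> vanishing l"
  by (cases l) (auto intro: that)

lemma act_subs:
  assumes "KId \<notin> set w"
  shows "act \<omega> (word_of (subs (shd \<omega>) w)) (i # v) =
      (i = even (count_list w (vanishing (shd \<omega>)))) # act (stl \<omega>) (copy i (shd \<omega>) w) v
    \<and> germ_parity \<omega> (word_of (subs (shd \<omega>) w)) (i # v) =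
      germ_parity (stl \<omega>) (copy i (shd \<omega>) w) v"
  using assms
proof (induction w arbitrary: i v)
  case Nil
  show ?case by (simp add: copy_def)
next
  case (Cons x w)
  let ?l = "shd \<omega>"
  have IH: "act \<omega> (word_of (subs ?l w)) (i # v) =
      (i = even (count_list w (vanishing ?l))) # act (stl \<omega>) (copy i ?l w) v"
    "germ_parity \<omega> (word_of (subs ?l w)) (i # v) = germ_parity (stl \<omega>) (copy i ?l w) v" for i v
    using Cons by auto
  have x: "x \<noteq> KId" using Cons.prems by auto
  show ?case
  proof (cases "x = vanishing ?l")
    case False
    then show ?thesis
      using x by (cases i)
        (auto simp: sub_nonvanishing IH copy_def letter_hom_def act_append germ_parity_append)
  next
    case True
    obtain p q where pq: "sub ?l x = [p, x, q]" "klein_mult p q = x"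
      "p \<noteq> KId" "p \<noteq> vanishing ?l" "q \<noteq> KId" "q \<noteq> vanishing ?l"
      using sub_vanishing[of ?l] True by metis
    have g: "grig q (stl \<omega>) (grig p (stl \<omega>) v) = grig x (stl \<omega>) v" for v
      by (simp add: grig_klein_mult[symmetric] pq(2))
    have m: "(p = KC \<or> p = KD) \<noteq> (q = KC \<or> q = KD) \<longleftrightarrow> (x = KC \<or> x = KD)"
      using klein_mult_mod_b[of p q] pq(2) by auto
    show ?thesis
    proof (cases i)
      case i: True
      show ?thesis
        using x pq True m unfolding i
        by (auto simp: pq(1) IH copy_def letter_hom_def act_append germ_parity_append g)
    next
      case i: False
      have "i = False" using i by simp
      then show ?thesis
        using x pq True
        by (auto simp: pq(1) IH copy_def letter_hom_def act_append germ_parity_append)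
    qed
  qed
qed

lemma count_subs:
  assumes "KId \<notin> set w" "x \<noteq> KId"
  shows "count_list (subs l w) x =
    (if x = vanishing l then count_list w x else 2 * count_list w x + count_list w (vanishing l))"
  using assms(1)
proof (induction w)
  case (Cons y w)
  then show ?case
    using assms(2) by (cases l; cases x; cases y) auto
qed simp

lemma KId_notin_subs: "KId \<notin> set w \<Longrightarrow> KId \<notin> set (subs l w)"
proof (induction w)
  case (Cons y w)
  then show ?case by (cases l) auto
qed simp

section \<open>Elements that flip one digit everywhere\<close>

fun lift :: "letter stream \<Rightarrow> nat \<Rightarrow> klein list \<Rightarrow> klein list" where
  "lift \<omega> 0 w = w"
| "lift \<omega> (Suc m) w = subs (shd \<omega>) (lift (stl \<omega>) m w)"

lemma KId_notin_lift: "KId \<notin> set w \<Longrightarrow> KId \<notin> set (lift \<omega> m w)"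
  by (induction m arbitrary: \<omega>) (auto simp: KId_notin_subs)

text \<open>All counts become even with the first substitution and stay so. Hence no substitution but the
  first has to be checked for the parity in the definition of the copies.\<close>

lemma even_count_lift:
  assumes "y \<noteq> KId" "y \<noteq> vanishing (\<omega> !! m)" "x \<noteq> KId"
  shows "even (count_list (lift \<omega> (Suc m) [y]) x)"
  using assms(2,3)
proof (induction m arbitrary: \<omega> x)
  case 0
  then show ?case using assms(1) by (simp add: sub_nonvanishing)
next
  case (Suc m)
  have van: "vanishing l \<noteq> KId" for l by (cases l) auto
  have "KId \<notin> set (lift (stl \<omega>) (Suc m) [y])" by (rule KId_notin_lift) (use assms(1) in auto)
  moreover have "even (count_list (lift (stl \<omega>) (Suc m) [y]) z)" if "z \<noteq> KId" for z
    using Suc.IH[of "stl \<omega>"] Suc.prems that by simp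
  ultimately show ?case
    using Suc.prems van by (subst lift.simps(2)) (simp add: count_subs del: lift.simps)
qed

text \<open>After \<open>m\<close> substitutions all sections at level \<open>m\<close> are \<open>y a\<close> or \<open>a y\<close>. They flip the next
  digit, and their only nontrivial germ is that of \<open>y\<close>, at a ray all of whose later digits are 1.\<close>

lemma lift_flips:
  assumes "y \<noteq> KId" "m > 0 \<longrightarrow> y \<noteq> vanishing (\<omega> !! (m - 1))" "length u = m"
  shows "(\<exists>t'. act \<omega> (word_of (lift \<omega> m [y])) (u @ d # t) = u @ (\<not> d) # t')
    \<and> (germ_parity \<omega> (word_of (lift \<omega> m [y])) (u @ d # t) \<longrightarrow> y \<in> {KC, KD} \<and> False \<notin> set t)"
  using assms(2,3)
proof (induction m arbitrary: \<omega> u d t)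
  case 0
  then show ?case by (cases d) auto
next
  case (Suc m)
  obtain i u' where u: "u = i # u'" "length u' = m" using Suc.prems by (cases u) auto
  let ?w = "lift (stl \<omega>) m [y]"
  have van: "vanishing l \<noteq> KId" for l by (cases l) auto
  have n: "KId \<notin> set ?w" by (rule KId_notin_lift) (use assms(1) in auto)
  have ev: "even (count_list ?w (vanishing (shd \<omega>)))"
  proof (cases m)
    case 0
    then show ?thesis using Suc.prems by simp
  next
    case (Suc m')
    then show ?thesis using even_count_lift[of y "stl \<omega>" m'] assms(1) Suc.prems van by simp
  qed
  have IH: "(\<exists>t'. act (stl \<omega>) (word_of ?w) (u' @ d # t) = u' @ (\<not> d) # t')
    \<and> (germ_parity (stl \<omega>) (word_of ?w) (u' @ d # t) \<longrightarrow> y \<in> {KC, KD} \<and> False \<notin> set t)"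
    if "length u' = m" for u' d
    by (rule Suc.IH) (use Suc.prems that in \<open>auto split: nat.splits simp: gr0_conv_Suc\<close>)
  have A: "act \<omega> (word_of (lift \<omega> (Suc m) [y])) (u @ d # t) =
      i # act (stl \<omega>) (copy i (shd \<omega>) ?w) (u' @ d # t)"
    "germ_parity \<omega> (word_of (lift \<omega> (Suc m) [y])) (u @ d # t) =
      germ_parity (stl \<omega>) (copy i (shd \<omega>) ?w) (u' @ d # t)"
    using act_subs[OF n, of \<omega> i "u' @ d # t"] ev u by auto
  show ?case
  proof (cases i)
    case True
    then show ?thesis using IH[OF u(2), of d] u unfolding A by (auto simp: copy_def ev)
  next
    case False
    have c: "act (stl \<omega>) (copy i (shd \<omega>) ?w) x = aut_a (act (stl \<omega>) (word_of ?w) (aut_a x))"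
       "germ_parity (stl \<omega>) (copy i (shd \<omega>) ?w) x = germ_parity (stl \<omega>) (word_of ?w) (aut_a x)" for x
      using False by (simp_all add: copy_def ev act_append germ_parity_append)
    show ?thesis
    proof (cases u')
      case Nil
      then have "m = 0" using u by simp
      then show ?thesis using Nil u False unfolding A c by (cases d) auto
    next
      case (Cons i' u'')
      then show ?thesis using IH[of "(\<not> i') # u''" d] u False unfolding A c by auto
    qed
  qed
qed

text \<open>The letter \<open>b\<close> leaves no trace in the parity of germs. It cannot be used where it vanishes in the last substitution,
  and then \<open>c\<close> takes its place.\<close>

definition flip_word :: "letter stream \<Rightarrow> nat \<Rightarrow> klein list" where
  "flip_word \<omega> m = lift \<omega> m [if m > 0 \<and> \<omega> !! (m - 1) = L2 then KC else KB]"

lemma flip_word_flips: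
  assumes "length u = m"
  shows "\<exists>t'. act \<omega> (word_of (flip_word \<omega> m)) (u @ d # t) = u @ (\<not> d) # t'"
    and "germ_parity \<omega> (word_of (flip_word \<omega> m)) (u @ d # t) \<Longrightarrow>
      m > 0 \<and> \<omega> !! (m - 1) = L2 \<and> False \<notin> set t"
proof -
  let ?y = "if m > 0 \<and> \<omega> !! (m - 1) = L2 then KC else KB"
  have "?y \<noteq> KId" "m > 0 \<longrightarrow> ?y \<noteq> vanishing (\<omega> !! (m - 1))"
    by (cases "\<omega> !! (m - 1)"; auto)+
  note F = lift_flips[OF this assms, of d t, folded flip_word_def]
  from F show "\<exists>t'. act \<omega> (word_of (flip_word \<omega> m)) (u @ d # t) = u @ (\<not> d) # t'" by blast
  assume "germ_parity \<omega> (word_of (flip_word \<omega> m)) (u @ d # t)"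
  with F have "?y \<in> {KC, KD}" "False \<notin> set t" by blast+
  then show "m > 0 \<and> \<omega> !! (m - 1) = L2 \<and> False \<notin> set t" by (auto split: if_splits)
qed

section \<open>Entropy of finitely supported distributions\<close>

lemma gibbs_inequality:
  fixes p s :: "'a \<Rightarrow> real"
  assumes fin: "finite U" and p: "\<And>x. x \<in> U \<Longrightarrow> 0 \<le> p x" and s: "\<And>x. x \<in> U \<Longrightarrow> 0 \<le> s x"
    and ac: "\<And>x. x \<in> U \<Longrightarrow> 0 < p x \<Longrightarrow> 0 < s x" and le: "sum s U \<le> sum p U"
  shows "(\<Sum>x\<in>U. p x * ln (s x)) \<le> (\<Sum>x\<in>U. p x * ln (p x))"
proof -
  have "p x * ln (s x) - p x * ln (p x) \<le> s x - p x" if "x \<in> U" for x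
  proof (cases "p x = 0")
    case False
    then have pos: "0 < p x" "0 < s x" using p ac that by (auto simp: less_le)
    then have "ln (s x) - ln (p x) = ln (s x / p x)" by (simp add: ln_div)
    also have "\<dots> \<le> s x / p x - 1" using pos by (intro ln_le_minus_one) simp
    finally have "p x * (ln (s x) - ln (p x)) \<le> p x * (s x / p x - 1)"
      using pos by (intro mult_left_mono) auto
    also have "\<dots> = s x - p x" using pos by (simp add: right_diff_distrib)
    finally show ?thesis by (simp add: right_diff_distrib)
  qed (use s that in simp)
  then have "(\<Sum>x\<in>U. p x * ln (s x) - p x * ln (p x)) \<le> (\<Sum>x\<in>U. s x - p x)"
    by (rule sum_mono)
  with le show ?thesis by (simp add: sum_subtractf)
qed

definition distribution :: "'a set \<Rightarrow> ('a \<Rightarrow> real) \<Rightarrow> bool" where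
  "distribution U p \<longleftrightarrow> finite U \<and> (\<forall>x. 0 \<le> p x) \<and> (\<forall>x. x \<notin> U \<longrightarrow> p x = 0) \<and> sum p U = 1"

definition entropy :: "('a \<Rightarrow> real) \<Rightarrow> real" where
  "entropy p = - (\<Sum>x | p x \<noteq> 0. p x * ln (p x))"

lemma entropy_eq:
  assumes "distribution U p"
  shows "entropy p = - (\<Sum>x\<in>U. p x * ln (p x))"
proof -
  have "(\<Sum>x | p x \<noteq> 0. p x * ln (p x)) = (\<Sum>x\<in>U. p x * ln (p x))"
    by (rule sum.mono_neutral_left) (use assms in \<open>auto simp: distribution_def\<close>)
  then show ?thesis by (simp add: entropy_def)
qed

lemma distribution_superset:
  assumes "distribution U p" "finite V" "U \<subseteq> V"
  shows "distribution V p"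
proof -
  have "sum p V = sum p U"
    by (rule sum.mono_neutral_right) (use assms in \<open>auto simp: distribution_def\<close>)
  with assms show ?thesis by (auto simp: distribution_def)
qed

lemma distribution_mix:
  "distribution U p \<Longrightarrow> distribution U q \<Longrightarrow> distribution U (\<lambda>x. (p x + q x) / 2)"
  by (auto simp: distribution_def sum.distrib simp flip: sum_divide_distrib)

lemma entropy_mix:
  assumes p: "distribution U p" and q: "distribution U q"
  shows "(entropy p + entropy q) / 2 \<le> entropy (\<lambda>x. (p x + q x) / 2)"
proof -
  let ?r = "\<lambda>x. (p x + q x) / 2"
  have r: "distribution U ?r" by (rule distribution_mix[OF p q])
  have pos: "0 \<le> p x" "0 \<le> q x" for x using p q by (auto simp: distribution_def)
  have "(\<Sum>x\<in>U. p x * ln (?r x)) \<le> (\<Sum>x\<in>U. p x * ln (p x))"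
    by (rule gibbs_inequality) (use p q r pos in \<open>auto simp: distribution_def add_pos_nonneg\<close>)
  moreover have "(\<Sum>x\<in>U. q x * ln (?r x)) \<le> (\<Sum>x\<in>U. q x * ln (q x))"
    by (rule gibbs_inequality) (use p q r pos in \<open>auto simp: distribution_def add_nonneg_pos\<close>)
  moreover have "(\<Sum>x\<in>U. ?r x * ln (?r x)) = ((\<Sum>x\<in>U. p x * ln (?r x)) + (\<Sum>x\<in>U. q x * ln (?r x))) / 2"
    by (simp add: sum.distrib[symmetric] sum_divide_distrib ring_distribs add_divide_distrib)
  ultimately show ?thesis
    unfolding entropy_eq[OF p] entropy_eq[OF q] entropy_eq[OF r] by simp
qed

lemma entropy_bij:
  assumes "bij f"
  shows "entropy (\<lambda>x. p (f x)) = entropy p"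
proof -
  have "(\<Sum>x | p (f x) \<noteq> 0. p (f x) * ln (p (f x))) = (\<Sum>x | p x \<noteq> 0. p x * ln (p x))"
  proof (rule sum.reindex_bij_betw)
    have "f ` {x. p (f x) \<noteq> 0} = {x. p x \<noteq> 0}"
      using assms by (auto simp: bij_def image_iff)
    then show "bij_betw f {x. p (f x) \<noteq> 0} {x. p x \<noteq> 0}"
      using assms by (auto simp: bij_betw_def bij_def intro: inj_on_subset)
  qed
  then show ?thesis by (simp add: entropy_def)
qed

lemma entropy_le_ln_card:
  assumes "distribution U p"
  shows "entropy p \<le> ln (real (card U))"
proof -
  have U: "finite U" "U \<noteq> {}" using assms by (auto simp: distribution_def)
  then have c: "0 < real (card U)" by (simp add: card_gt_0_iff)
  have "(\<Sum>x\<in>U. p x * ln (1 / real (card U))) \<le> (\<Sum>x\<in>U. p x * ln (p x))"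
    by (rule gibbs_inequality) (use assms c U in \<open>auto simp: distribution_def\<close>)
  also have "(\<Sum>x\<in>U. p x * ln (1 / real (card U))) = - ln (real (card U))"
    using assms c by (simp add: distribution_def ln_div flip: sum_distrib_right)
  finally show ?thesis unfolding entropy_eq[OF assms] by simp
qed

text \<open>The entropy of a fair bit minus that of a bit with probabilities 1/4 and 3/4.\<close>

definition bit_gain :: real where "bit_gain = ln (3/2) - ln 3 / 4"

lemma bit_gain_pos: "0 < bit_gain"
proof -
  have "ln (3::real) < ln ((3/2) ^ 4)" by (subst ln_less_cancel_iff) (auto simp: power_divide)
  also have "\<dots> = 4 * ln (3/2)" by (subst ln_realpow) auto
  finally show ?thesis by (simp add: bit_gain_def)
qed

text \<open>Multiplying by a fair coin toss \<open>\<tau>\<close> makes the observable \<open>\<pi>\<close> uniform, while it was biased before. The gain is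
  the relative entropy of \<open>p\<close> with respect to its symmetrization, which is estimated by Gibbs' inequality
  against the symmetrization reweighted by 3/4 and 1/4 according to \<open>\<pi>\<close>.\<close>

lemma entropy_gain:
  assumes p: "distribution U p"
    and inv: "\<And>x. \<tau> (\<tau> x) = x" and U: "\<tau> ` U = U"
    and \<pi>: "\<And>x. x \<in> U \<Longrightarrow> \<pi> (\<tau> x) = (\<not> \<pi> x)"
    and small: "(\<Sum>x\<in>U. p x * of_bool (\<pi> x)) \<le> 1/4"
  shows "entropy p + bit_gain \<le> entropy (\<lambda>x. (p x + p (\<tau> x)) / 2)"
proof -
  let ?r = "\<lambda>x. (p x + p (\<tau> x)) / 2"
  have fin: "finite U" and pos: "0 \<le> p x" for x using p by (auto simp: distribution_def)
  have "inj \<tau>" by (metis inv injI)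
  then have re: "sum (\<lambda>x. g (\<tau> x)) U = sum g U" for g :: "'a \<Rightarrow> real"
    using U by (metis (no_types, lifting) inj_on_subset subset_UNIV sum.reindex_cong)
  have q: "distribution U (\<lambda>x. p (\<tau> x))"
    using p re[of p] U inv by (auto simp: distribution_def) (metis image_eqI)
  have r: "distribution U ?r" by (rule distribution_mix[OF p q])
  define w where "w x = (if \<pi> x then 1/4 else 3/4 :: real)" for x
  have w: "w x > 0" "x \<in> U \<Longrightarrow> w (\<tau> x) = 1 - w x" for x using \<pi> by (auto simp: w_def)
  have "(\<Sum>x\<in>U. p x * ln (?r x * (2 * w x))) \<le> (\<Sum>x\<in>U. p x * ln (p x))"
  proof (rule gibbs_inequality[OF fin])
    have "(\<Sum>x\<in>U. ?r x * (2 * w x)) = (\<Sum>x\<in>U. p x * w x) + (\<Sum>x\<in>U. p (\<tau> x) * w x)"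
      unfolding sum.distrib[symmetric] by (rule sum.cong) (simp_all add: field_simps)
    also have "(\<Sum>x\<in>U. p (\<tau> x) * w x) = (\<Sum>x\<in>U. p x * w (\<tau> x))"
      using re[of "\<lambda>x. p x * w (\<tau> x)"] by (simp add: inv)
    also have "\<dots> = (\<Sum>x\<in>U. p x * (1 - w x))" by (intro sum.cong) (auto simp: w)
    also have "(\<Sum>x\<in>U. p x * w x) + \<dots> = sum p U"
      by (simp add: sum.distrib[symmetric] algebra_simps)
    finally show "(\<Sum>x\<in>U. ?r x * (2 * w x)) \<le> sum p U" by simp
  next
    fix x assume "0 < p x"
    then have "0 < ?r x" using pos[of "\<tau> x"] by simp
    then show "0 < ?r x * (2 * w x)" using w by (intro mult_pos_pos) auto
  next
    fix x show "0 \<le> ?r x * (2 * w x)" using pos[of x] pos[of "\<tau> x"] w(1)[of x] by simp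
  qed (rule pos)
  also have "(\<Sum>x\<in>U. p x * ln (?r x * (2 * w x))) =
     (\<Sum>x\<in>U. p x * ln (?r x) + p x * ln (3/2) - ln 3 * (p x * of_bool (\<pi> x)))"
  proof (rule sum.cong[OF refl])
    fix x assume "x \<in> U"
    show "p x * ln (?r x * (2 * w x)) = p x * ln (?r x) + p x * ln (3/2) - ln 3 * (p x * of_bool (\<pi> x))"
    proof (cases "p x = 0")
      case False
      then have rx: "0 < ?r x" using pos[of x] pos[of "\<tau> x"] by simp
      have "ln (?r x * (2 * w x)) = ln (?r x) + ln (2 * w x)"
        using rx w(1)[of x] by (intro ln_mult_pos) auto
      moreover have "ln (2 * w x) = ln (3/2) - ln 3 * of_bool (\<pi> x)"
        by (simp add: w_def ln_div)
      ultimately show ?thesis by (simp only: ring_distribs mult_ac)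
    qed simp
  qed
  also have "\<dots> = (\<Sum>x\<in>U. p x * ln (?r x)) + ln (3/2) - ln 3 * (\<Sum>x\<in>U. p x * of_bool (\<pi> x))"
    using p by (simp only: sum.distrib sum_subtractf sum_distrib_left[symmetric] sum_distrib_right[symmetric])
      (simp add: distribution_def)
  finally have "(\<Sum>x\<in>U. p x * ln (?r x)) + ln (3/2) - ln 3 * (\<Sum>x\<in>U. p x * of_bool (\<pi> x)) \<le> - entropy p"
    unfolding entropy_eq[OF p] by simp
  moreover have "ln 3 * (\<Sum>x\<in>U. p x * of_bool (\<pi> x)) \<le> ln 3 * (1/4)"
    using small by (intro mult_left_mono) auto
  moreover have "(\<Sum>x\<in>U. p x * ln (?r x)) = (\<Sum>x\<in>U. ?r x * ln (?r x))"
  proof -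
    have "(\<Sum>x\<in>U. p (\<tau> x) * ln (?r x)) = (\<Sum>x\<in>U. p x * ln (?r x))"
      using re[of "\<lambda>x. p x * ln (?r x)"] by (simp add: inv add.commute)
    then have "(\<Sum>x\<in>U. p x * ln (?r x)) = ((\<Sum>x\<in>U. p x * ln (?r x)) + (\<Sum>x\<in>U. p (\<tau> x) * ln (?r x))) / 2"
      by simp
    also have "\<dots> = (\<Sum>x\<in>U. ?r x * ln (?r x))"
      by (simp add: sum.distrib[symmetric] sum_divide_distrib ring_distribs add_divide_distrib)
    finally show ?thesis .
  qed
  ultimately show ?thesis unfolding entropy_eq[OF r] bit_gain_def by linarith
qed

section \<open>Random subproducts\<close>

text \<open>Each word of a list is kept or dropped by an independent fair coin toss, and the kept words are concatenated
  in order. Everything random below is such a subproduct, so expectations are finite averages defined by recursion.\<close>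

fun average :: "'a list list \<Rightarrow> ('a list \<Rightarrow> real) \<Rightarrow> real" where
  "average [] f = f []"
| "average (v # vs) f = (average vs f + average vs (\<lambda>w. f (v @ w))) / 2"

fun subproducts :: "'a list list \<Rightarrow> 'a list set" where
  "subproducts [] = {[]}"
| "subproducts (v # vs) = subproducts vs \<union> (@) v ` subproducts vs"

lemma finite_subproducts [simp]: "finite (subproducts vs)"
  by (induction vs) auto

lemma length_subproducts: "w \<in> subproducts vs \<Longrightarrow> length w \<le> sum_list (map length vs)"
  by (induction vs arbitrary: w) fastforce+

lemma set_subproducts: "w \<in> subproducts vs \<Longrightarrow> set w \<subseteq> (\<Union>v\<in>set vs. set v)"
  by (induction vs arbitrary: w) fastforce+

lemma average_mono_on: "(\<And>w. w \<in> subproducts vs \<Longrightarrow> f w \<le> g w) \<Longrightarrow> average vs f \<le> average vs g"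
proof (induction vs arbitrary: f g)
  case (Cons v vs)
  have "average vs f \<le> average vs g" "average vs (\<lambda>w. f (v @ w)) \<le> average vs (\<lambda>w. g (v @ w))"
    by (rule Cons.IH; use Cons.prems in auto)+
  then show ?case by simp
qed simp

lemma average_mono: "(\<And>w. f w \<le> g w) \<Longrightarrow> average vs f \<le> average vs g"
  by (rule average_mono_on)

lemma average_cong_on: "(\<And>w. w \<in> subproducts vs \<Longrightarrow> f w = g w) \<Longrightarrow> average vs f = average vs g"
  by (intro antisym average_mono_on) auto

lemma average_const [simp]: "average vs (\<lambda>_. c) = c"
  by (induction vs) auto

lemma average_add: "average vs (\<lambda>w. f w + g w) = average vs f + average vs g"
  by (induction vs arbitrary: f g) (auto simp: field_simps)

lemma average_cmult: "average vs (\<lambda>w. c * f w) = c * average vs f"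
  by (induction vs arbitrary: f) (auto simp: field_simps)

lemma average_sum: "average vs (\<lambda>w. \<Sum>x\<in>A. f x w) = (\<Sum>x\<in>A. average vs (f x))"
proof (induction A rule: infinite_finite_induct)
  case (insert x F)
  then show ?case by (simp add: average_add)
qed auto

lemma average_append: "average (us @ vs) f = average us (\<lambda>u. average vs (\<lambda>w. f (u @ w)))"
proof (induction us arbitrary: f)
  case (Cons u us)
  have "average (us @ vs) f = average us (\<lambda>x. average vs (\<lambda>w. f (x @ w)))"
    "average (us @ vs) (\<lambda>w. f (u @ w)) = average us (\<lambda>x. average vs (\<lambda>w. f (u @ x @ w)))"
    by (rule Cons.IH)+
  then show ?case by simp
qed simp

lemma average_swap:
  "average us (\<lambda>u. average vs (\<lambda>w. f u w)) = average vs (\<lambda>w. average us (\<lambda>u. f u w))"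
proof (induction us arbitrary: f)
  case (Cons u us)
  have "average us (\<lambda>x. average vs (\<lambda>w. f x w)) = average vs (\<lambda>w. average us (\<lambda>x. f x w))"
    "average us (\<lambda>x. average vs (\<lambda>w. f (u @ x) w)) = average vs (\<lambda>w. average us (\<lambda>x. f (u @ x) w))"
    by (rule Cons.IH)+
  then have "average (u # us) (\<lambda>x. average vs (\<lambda>w. f x w)) =
    average vs (\<lambda>w. average us (\<lambda>x. f x w)) / 2 + average vs (\<lambda>w. average us (\<lambda>x. f (u @ x) w)) / 2"
    by (simp add: add_divide_distrib)
  also have "\<dots> = average vs (\<lambda>w. (1/2) * average us (\<lambda>x. f x w) + (1/2) * average us (\<lambda>x. f (u @ x) w))"
    by (simp only: average_add average_cmult)
  also have "\<dots> = average vs (\<lambda>w. average (u # us) (\<lambda>x. f x w))"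
    by (simp add: add_divide_distrib)
  finally show ?case .
qed simp

abbreviation probability :: "'a list list \<Rightarrow> ('a list \<Rightarrow> bool) \<Rightarrow> real" where
  "probability vs P \<equiv> average vs (\<lambda>w. of_bool (P w))"

text \<open>The parity of a product is the sum of the parities of its factors along the trajectory, so it can be odd only if
  one of them is.\<close>

lemma probability_germ_parity_le:
  "probability vs (\<lambda>w. germ_parity \<omega> w x)
    \<le> (\<Sum>i<length vs. probability (take i vs) (\<lambda>u. germ_parity \<omega> (vs ! i) (act \<omega> u x)))"
proof (induction vs rule: rev_induct)
  case (snoc v vs)
  let ?B = "\<lambda>u. germ_parity \<omega> v (act \<omega> u x)"
  have "probability (vs @ [v]) (\<lambda>w. germ_parity \<omega> w x)
    = average vs (\<lambda>u. (of_bool (germ_parity \<omega> u x) + of_bool (germ_parity \<omega> u x \<noteq> ?B u)) / 2)"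
    by (simp add: average_append germ_parity_append)
  also have "\<dots> \<le> average vs (\<lambda>u. of_bool (germ_parity \<omega> u x) + of_bool (?B u))"
    by (rule average_mono) auto
  also have "\<dots> = probability vs (\<lambda>u. germ_parity \<omega> u x) + probability vs ?B"
    by (rule average_add)
  also have "\<dots> \<le> (\<Sum>i<length vs. probability (take i vs) (\<lambda>u. germ_parity \<omega> (vs ! i) (act \<omega> u x))) + probability vs ?B"
    using snoc by simp
  also have "\<dots> = (\<Sum>i<length (vs @ [v]). probability (take i (vs @ [v])) (\<lambda>u. germ_parity \<omega> ((vs @ [v]) ! i) (act \<omega> u x)))"
    by (simp add: nth_append)
  finally show ?case .
qed simp

definition law :: "letter stream \<Rightarrow> gen list list \<Rightarrow> (vertex \<Rightarrow> vertex) \<Rightarrow> real" where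
  "law \<omega> vs g = probability vs (\<lambda>w. act \<omega> w = g)"

lemma law_expectation:
  assumes "act \<omega> ` subproducts vs \<subseteq> U" "finite U"
  shows "(\<Sum>g\<in>U. law \<omega> vs g * h g) = average vs (\<lambda>w. h (act \<omega> w))"
proof -
  have "(\<Sum>g\<in>U. law \<omega> vs g * h g) = average vs (\<lambda>w. \<Sum>g\<in>U. h g * of_bool (act \<omega> w = g))"
    by (simp only: average_sum average_cmult law_def mult.commute)
  also have "\<dots> = average vs (\<lambda>w. h (act \<omega> w))"
    by (rule average_cong_on) (use assms in \<open>auto simp: of_bool_def if_distrib sum.delta cong: if_cong\<close>)
  finally show ?thesis .
qed

lemma law_distribution: "distribution (act \<omega> ` subproducts vs) (law \<omega> vs)"
  unfolding distribution_def
proof (intro conjI allI impI)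
  show "finite (act \<omega> ` subproducts vs)" by simp
  show "0 \<le> law \<omega> vs x" for x
    using average_mono[of "\<lambda>_. 0" "\<lambda>w. of_bool (act \<omega> w = x)" vs] by (simp add: law_def)
  show "law \<omega> vs x = 0" if "x \<notin> act \<omega> ` subproducts vs" for x
  proof -
    have "law \<omega> vs x = average vs (\<lambda>_. 0)"
      unfolding law_def by (rule average_cong_on) (use that in auto)
    then show ?thesis by simp
  qed
  show "sum (law \<omega> vs) (act \<omega> ` subproducts vs) = 1"
    using law_expectation[of \<omega> vs "act \<omega> ` subproducts vs" "\<lambda>_. 1"] by simp
qed

lemma act_append_eq_iff: "act \<omega> (v @ w) = g \<longleftrightarrow> act \<omega> w = g \<circ> act \<omega> (rev v)"
  by (auto simp: fun_eq_iff act_append) (metis act_rev_self)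

lemma law_Cons: "law \<omega> (v # vs) g = (law \<omega> vs g + law \<omega> vs (g \<circ> act \<omega> (rev v))) / 2"
  by (simp add: law_def act_append_eq_iff)

lemma bij_translate: "bij (\<lambda>g. g \<circ> act \<omega> v)"
  by (rule bij_betw_byWitness[where f' = "\<lambda>g. g \<circ> act \<omega> (rev v)"]) (auto simp: fun_eq_iff)

lemma entropy_law_Cons: "entropy (law \<omega> vs) \<le> entropy (law \<omega> (v # vs))"
proof -
  let ?q = "\<lambda>g. law \<omega> vs (g \<circ> act \<omega> (rev v))"
  let ?U = "act \<omega> ` subproducts (v # vs)"
  have p: "distribution ?U (law \<omega> vs)"
    by (rule distribution_superset[OF law_distribution]) auto
  have q: "distribution ?U ?q"
  proof -
    have "law \<omega> (v # vs) = (\<lambda>g. (law \<omega> vs g + ?q g) / 2)" by (rule ext) (rule law_Cons)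
    moreover have r: "distribution ?U (law \<omega> (v # vs))" by (rule law_distribution)
    ultimately have e: "(\<lambda>g. (law \<omega> vs g + ?q g) / 2) = law \<omega> (v # vs)" by simp
    have pos: "0 \<le> law \<omega> vs g" for g using p by (simp add: distribution_def)
    have z: "?q g = 0" if "g \<notin> ?U" for g
      using fun_cong[OF e, of g] r p that by (auto simp: distribution_def)
    have "2 * sum (law \<omega> (v # vs)) ?U = sum (law \<omega> vs) ?U + sum ?q ?U"
      unfolding e[symmetric] by (simp add: sum.distrib flip: sum_divide_distrib)
    then have "sum ?q ?U = 1" using p r by (simp add: distribution_def)
    with z pos show ?thesis by (auto simp: distribution_def)
  qed
  have "entropy ?q = entropy (law \<omega> vs)"
    using entropy_bij[OF bij_translate] .
  with entropy_mix[OF p q] show ?thesis by (simp add: law_Cons[abs_def])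
qed

text \<open>The letter \<open>c\<close> fixes the vertex \<open>11...1\<close> and contributes to its germ. If the remaining product rarely does, the
  toss can be read off from the whole product with some reliability.\<close>

lemma entropy_law_Cons_bit:
  assumes om: "\<And>n. \<exists>m\<ge>n. \<omega> !! m = L2"
    and K: "2 * Suc (sum_list (map length vs)) \<le> K"
    and small: "probability vs (\<lambda>w. germ_parity \<omega> w (replicate K True)) \<le> 1/4"
  shows "entropy (law \<omega> vs) + bit_gain \<le> entropy (law \<omega> ([GX KC] # vs))"
proof -
  let ?S = "subproducts ([GX KC] # vs)"
  let ?U = "act \<omega> ` ?S"
  let ?o = "replicate K True"
  let ?\<tau> = "\<lambda>g :: vertex \<Rightarrow> vertex. g \<circ> act \<omega> [GX KC]"
  define \<pi> where "\<pi> g = germ_parity \<omega> (SOME w. w \<in> ?S \<and> act \<omega> w = g) ?o" for g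
  have \<pi>: "\<pi> (act \<omega> w) = germ_parity \<omega> w ?o" if "w \<in> ?S" for w
  proof -
    let ?w = "SOME w'. w' \<in> ?S \<and> act \<omega> w' = act \<omega> w"
    have w: "?w \<in> ?S \<and> act \<omega> ?w = act \<omega> w" by (rule someI[of _ w]) (use that in auto)
    then have "length ?w \<le> Suc (sum_list (map length vs))" "length w \<le> Suc (sum_list (map length vs))"
      using length_subproducts[of ?w "[GX KC] # vs"] length_subproducts[of w "[GX KC] # vs"] that by auto
    then have "germ_parity \<omega> ?w ?o = germ_parity \<omega> w ?o"
      by (intro germ_parity_cong[OF om]) (use w K in auto)
    then show ?thesis by (simp add: \<pi>_def)
  qed
  have c: "act \<omega> [GX KC] (act \<omega> [GX KC] v) = v" for v by (simp add: grig_invol)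
  have \<tau>c: "?\<tau> (act \<omega> w) = act \<omega> ([GX KC] @ w)" "?\<tau> (act \<omega> ([GX KC] @ w)) = act \<omega> w" for w
    by (auto simp: fun_eq_iff grig_invol)
  have sub: "?\<tau> ` ?U \<subseteq> ?U"
  proof
    fix g assume "g \<in> ?\<tau> ` ?U"
    then obtain w where "w \<in> subproducts vs" "g = ?\<tau> (act \<omega> w) \<or> g = ?\<tau> (act \<omega> ([GX KC] @ w))"
      by auto
    then have "g = act \<omega> ([GX KC] @ w) \<or> g = act \<omega> w"
      using \<tau>c by metis
    then show "g \<in> ?U" using \<open>w \<in> _\<close> by auto
  qed
  have inv: "?\<tau> (?\<tau> g) = g" for g :: "vertex \<Rightarrow> vertex" by (auto simp: fun_eq_iff grig_invol)
  have "?\<tau> ` ?U = ?U"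
  proof (rule equalityI[OF sub], rule subsetI)
    fix g assume "g \<in> ?U"
    then have "?\<tau> g \<in> ?U" using sub by (meson image_eqI subsetD)
    then show "g \<in> ?\<tau> ` ?U"
      by (rule image_eqI[where f = ?\<tau> and x = "?\<tau> g", rotated]) (rule inv[symmetric])
  qed
  moreover have "\<pi> (?\<tau> g) = (\<not> \<pi> g)" if g: "g \<in> ?U" for g
  proof -
    obtain w where w: "w \<in> subproducts vs" "g = act \<omega> w \<or> g = act \<omega> ([GX KC] @ w)"
      using g by auto
    then have S: "w \<in> ?S" "[GX KC] @ w \<in> ?S" by auto
    have "germ_parity \<omega> ([GX KC] @ w) ?o = (\<not> germ_parity \<omega> w ?o)" by simp
    then have "\<pi> (act \<omega> ([GX KC] @ w)) = (\<not> \<pi> (act \<omega> w))" using \<pi>[OF S(1)] \<pi>[OF S(2)] by simp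
    then show ?thesis using w(2) \<tau>c by metis
  qed
  moreover have p: "distribution ?U (law \<omega> vs)"
    by (rule distribution_superset[OF law_distribution]) auto
  moreover have "(\<Sum>g\<in>?U. law \<omega> vs g * of_bool (\<pi> g)) \<le> 1/4"
  proof -
    have "(\<Sum>g\<in>?U. law \<omega> vs g * of_bool (\<pi> g)) = probability vs (\<lambda>w. \<pi> (act \<omega> w))"
      by (rule law_expectation) auto
    also have "\<dots> = probability vs (\<lambda>w. germ_parity \<omega> w ?o)"
      by (rule average_cong_on) (use \<pi> in auto)
    finally show ?thesis using small by simp
  qed
  ultimately have "entropy (law \<omega> vs) + bit_gain \<le> entropy (\<lambda>g. (law \<omega> vs g + law \<omega> vs (?\<tau> g)) / 2)"
    using inv by (intro entropy_gain[where \<pi> = \<pi>]) auto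
  then show ?thesis by (simp add: law_Cons[abs_def])
qed

lemma entropy_law_ge:
  assumes om: "\<And>n. \<exists>m\<ge>n. \<omega> !! m = L2"
    and K: "2 * sum_list (map length vs) \<le> K"
    and small: "\<And>us ws. vs = us @ [GX KC] # ws \<Longrightarrow>
        probability ws (\<lambda>w. germ_parity \<omega> w (replicate K True)) \<le> 1/4"
  shows "bit_gain * count_list vs [GX KC] \<le> entropy (law \<omega> vs)"
  using K small
proof (induction vs)
  case Nil
  have "law \<omega> [] = (\<lambda>g. if g = act \<omega> [] then 1 else 0)" by (auto simp: law_def)
  then show ?case by (simp add: entropy_def)
next
  case (Cons v vs)
  have IH: "bit_gain * count_list vs [GX KC] \<le> entropy (law \<omega> vs)"
  proof (rule Cons.IH)
    show "2 * sum_list (map length vs) \<le> K" using Cons.prems(1) by simp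
    fix us ws assume "vs = us @ [GX KC] # ws"
    then show "probability ws (\<lambda>w. germ_parity \<omega> w (replicate K True)) \<le> 1/4"
      using Cons.prems(2)[of "v # us" ws] by simp
  qed
  show ?case
  proof (cases "v = [GX KC]")
    case True
    have "entropy (law \<omega> vs) + bit_gain \<le> entropy (law \<omega> ([GX KC] # vs))"
      by (rule entropy_law_Cons_bit[OF om])
        (use Cons.prems(1) Cons.prems(2)[of "[]" vs] True in auto)
    with IH True show ?thesis by (simp add: algebra_simps)
  next
    case False
    then show ?thesis using IH entropy_law_Cons[of \<omega> vs v] by simp
  qed
qed

section \<open>Random flips spread a point uniformly\<close>

abbreviation flip :: "letter stream \<Rightarrow> nat \<Rightarrow> gen list" where
  "flip \<omega> m \<equiv> word_of (flip_word \<omega> m)"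

lemma act_flip:
  assumes "m < length x"
  shows "take m (act \<omega> (flip \<omega> m) x) = take m x" "act \<omega> (flip \<omega> m) x ! m = (\<not> x ! m)"
proof -
  have x: "x = take m x @ x ! m # drop (Suc m) x" using assms by (simp add: id_take_nth_drop)
  obtain t where t: "act \<omega> (flip \<omega> m) x = take m x @ (\<not> x ! m) # t"
    using flip_word_flips(1)[of "take m x" m \<omega> "x ! m" "drop (Suc m) x"] assms x by auto
  show "take m (act \<omega> (flip \<omega> m) x) = take m x" "act \<omega> (flip \<omega> m) x ! m = (\<not> x ! m)"
    unfolding t using assms by (simp_all add: nth_append)
qed

lemma germ_parity_flip:
  assumes "m < length x" "germ_parity \<omega> (flip \<omega> m) x"
  shows "m > 0 \<and> \<omega> !! (m - 1) = L2 \<and> (\<forall>n. m < n \<longrightarrow> n < length x \<longrightarrow> x ! n)"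
proof -
  have x: "x = take m x @ x ! m # drop (Suc m) x" using assms by (simp add: id_take_nth_drop)
  have "m > 0 \<and> \<omega> !! (m - 1) = L2 \<and> False \<notin> set (drop (Suc m) x)"
    using flip_word_flips(2)[of "take m x" m \<omega> "x ! m" "drop (Suc m) x"] assms x by simp
  moreover have "x ! n" if "False \<notin> set (drop (Suc m) x)" "m < n" "n < length x" for n
  proof -
    have "drop (Suc m) x ! (n - Suc m) = x ! n" "n - Suc m < length (drop (Suc m) x)" using that by auto
    then show ?thesis using that(1) by (metis nth_mem)
  qed
  ultimately show ?thesis by blast
qed

lemma take_act_subproducts:
  assumes "w \<in> subproducts (map (flip \<omega>) ls)" "\<And>l. l \<in> set ls \<Longrightarrow> j \<le> l \<and> l < length x"
  shows "take j (act \<omega> w x) = take j x"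
  using assms
proof (induction ls arbitrary: w x)
  case (Cons l ls)
  have l: "j \<le> l" "l < length x" using Cons.prems(2) by auto
  have "take j (act \<omega> (flip \<omega> l) x) = take j (take l (act \<omega> (flip \<omega> l) x))" using l by (simp add: min_absorb1)
  also have "\<dots> = take j x" using l by (simp add: act_flip(1) min_absorb1)
  finally have e: "take j (act \<omega> (flip \<omega> l) x) = take j x" .
  from Cons.prems(1) consider "w \<in> subproducts (map (flip \<omega>) ls)"
    | w' where "w = flip \<omega> l @ w'" "w' \<in> subproducts (map (flip \<omega>) ls)" by auto
  then show ?case
  proof cases
    case 1
    then show ?thesis using Cons.IH[of w x] Cons.prems(2) by auto
  next
    case 2
    then show ?thesis using Cons.IH[of w' "act \<omega> (flip \<omega> l) x"] Cons.prems(2) e by (auto simp: act_append)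
  qed
qed simp

lemma probability_mono_on: "(\<And>w. w \<in> subproducts vs \<Longrightarrow> P w \<Longrightarrow> R w) \<Longrightarrow> probability vs P \<le> probability vs R"
  by (rule average_mono_on) auto

lemma probability_eq_0: "(\<And>w. w \<in> subproducts vs \<Longrightarrow> \<not> P w) \<Longrightarrow> probability vs P = 0"
proof -
  assume "\<And>w. w \<in> subproducts vs \<Longrightarrow> \<not> P w"
  then have "probability vs P = average vs (\<lambda>_. 0)" by (intro average_cong_on) auto
  then show ?thesis by simp
qed

text \<open>Later flips do not touch the digits that were decided earlier. So each toss has to take the one value that produces
  the prescribed digit.\<close>

lemma probability_flips_le:
  assumes "sorted_wrt (<) ls" "\<And>l. l \<in> set ls \<Longrightarrow> l < j" "j \<le> length x"
  shows "probability (map (flip \<omega>) ls) (\<lambda>w. take j (act \<omega> w x) = t) \<le> (1/2) ^ length ls"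
  using assms
proof (induction ls arbitrary: x)
  case Nil
  then show ?case by simp
next
  case (Cons l ls)
  let ?vs = "map (flip \<omega>) ls"
  let ?x = "act \<omega> (flip \<omega> l) x"
  have l: "l < j" "j \<le> length x" and ls: "\<And>l'. l' \<in> set ls \<Longrightarrow> l < l' \<and> l' < length x"
    using Cons.prems by fastforce+
  have IH: "probability ?vs (\<lambda>w. take j (act \<omega> w y) = t) \<le> (1/2) ^ length ls" if "length y = length x" for y
    by (rule Cons.IH) (use Cons.prems that in auto)
  have digit: "t ! l = y ! l" if "w \<in> subproducts ?vs" "take j (act \<omega> w y) = t" "length y = length x" for w y
  proof -
    have "take (Suc l) (act \<omega> w y) = take (Suc l) y"
      by (rule take_act_subproducts[OF that(1)]) (use ls that in \<open>auto simp: Suc_le_eq\<close>)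
    then have "act \<omega> w y ! l = y ! l" by (metis lessI nth_take)
    then show ?thesis using that(2) l(1) by auto
  qed
  have "probability ?vs (\<lambda>w. take j (act \<omega> w x) = t) + probability ?vs (\<lambda>w. take j (act \<omega> w ?x) = t)
      \<le> (1/2) ^ length ls"
  proof (cases "t ! l = x ! l")
    case True
    then have "probability ?vs (\<lambda>w. take j (act \<omega> w ?x) = t) = 0"
      using digit[of _ ?x] act_flip(2)[of l x \<omega>] l by (intro probability_eq_0) auto
    then show ?thesis using IH[of x] by simp
  next
    case False
    then have "probability ?vs (\<lambda>w. take j (act \<omega> w x) = t) = 0"
      using digit[of _ x] by (intro probability_eq_0) auto
    then show ?thesis using IH[of ?x] by simp
  qed
  then show ?case by (simp add: act_append)
qed

lemma take_act_eq_iff: "take j (act \<omega> w y) = t \<longleftrightarrow> take j y = act \<omega> (rev w) t"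
  by (metis take_act act_rev_self act_self_rev)

text \<open>Flipping the high digits first does no harm: the high flips fix the first \<open>k\<close> digits, which therefore determine
  the low tosses, and these determine the high ones.\<close>

lemma probability_two_flips_le:
  assumes hs: "sorted_wrt (<) hs" "\<And>l. l \<in> set hs \<Longrightarrow> k \<le> l \<and> l < j"
    and ls: "sorted_wrt (<) ls" "\<And>l. l \<in> set ls \<Longrightarrow> l < k" and j: "k \<le> j" "j \<le> length x"
  shows "probability (map (flip \<omega>) (hs @ ls)) (\<lambda>w. take j (act \<omega> w x) = t)
      \<le> (1/2) ^ (length hs + length ls)"
proof -
  let ?H = "map (flip \<omega>) hs" and ?L = "map (flip \<omega>) ls"
  have inner: "probability ?H (\<lambda>h. take j (act \<omega> h x) = act \<omega> (rev m) t)
     \<le> (1/2) ^ length hs * of_bool (take k (act \<omega> m x) = take k t)" for m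
  proof (cases "take k (act \<omega> m x) = take k t")
    case True
    then show ?thesis using probability_flips_le[OF hs(1), of j x \<omega> "act \<omega> (rev m) t"] hs(2) j by auto
  next
    case False
    have "take j (act \<omega> h x) \<noteq> act \<omega> (rev m) t" if "h \<in> subproducts ?H" for h
    proof
      assume "take j (act \<omega> h x) = act \<omega> (rev m) t"
      then have "take k (act \<omega> h x) = take k (act \<omega> (rev m) t)"
        using j(1) by (metis min.absorb1 take_take)
      moreover have "take k (act \<omega> h x) = take k x"
        by (rule take_act_subproducts[OF that]) (use hs(2) j in fastforce)
      ultimately have "take k x = act \<omega> (rev m) (take k t)" by (simp add: take_act)
      then show False using False by (simp add: take_act_eq_iff)
    qed
    then have "probability ?H (\<lambda>h. take j (act \<omega> h x) = act \<omega> (rev m) t) = 0"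
      by (intro probability_eq_0)
    then show ?thesis by simp
  qed
  have "probability (map (flip \<omega>) (hs @ ls)) (\<lambda>w. take j (act \<omega> w x) = t)
    = average ?L (\<lambda>m. probability ?H (\<lambda>h. take j (act \<omega> h x) = act \<omega> (rev m) t))"
    unfolding map_append average_append
    by (subst average_swap) (simp only: act_append take_act_eq_iff)
  also have "\<dots> \<le> average ?L (\<lambda>m. (1/2) ^ length hs * of_bool (take k (act \<omega> m x) = take k t))"
    by (rule average_mono) (rule inner)
  also have "\<dots> = (1/2) ^ length hs * probability ?L (\<lambda>m. take k (act \<omega> m x) = take k t)"
    by (rule average_cmult)
  also have "\<dots> \<le> (1/2) ^ length hs * (1/2) ^ length ls"
    by (intro mult_left_mono probability_flips_le) (use ls j in auto)
  finally show ?thesis by (simp add: power_add)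
qed

lemma probability_middle_le:
  assumes "\<And>u w. probability vs (\<lambda>m. P (u @ m @ w)) \<le> c"
  shows "probability (us @ vs @ ws) P \<le> c"
proof -
  have "probability (us @ vs @ ws) P = average us (\<lambda>u. average ws (\<lambda>w. probability vs (\<lambda>m. P (u @ m @ w))))"
    unfolding average_append by (subst (2) average_swap) (rule refl)
  also have "\<dots> \<le> average us (\<lambda>u. average ws (\<lambda>w. c))"
    by (intro average_mono assms)
  finally show ?thesis by simp
qed

text \<open>Tree automorphisms permute the vertices of a level, so a uniform position remains uniform whatever is done before and
  after. Here and below the estimate is made for fixed values of all other tosses.\<close>

lemma probability_surround_le:
  assumes c: "\<And>y t. length y = length x \<Longrightarrow> probability vs (\<lambda>w. take j (act \<omega> w y) = t) \<le> c"
    and T: "finite T"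
  shows "probability (us @ vs @ ws) (\<lambda>w. take j (act \<omega> w x) \<in> T) \<le> real (card T) * c"
proof (rule probability_middle_le)
  fix u w
  have "of_bool (take j (act \<omega> (u @ m @ w) x) \<in> T) \<le>
      (\<Sum>t\<in>T. of_bool (take j (act \<omega> m (act \<omega> u x)) = act \<omega> (rev w) t) :: real)" for m
  proof (cases "take j (act \<omega> (u @ m @ w) x) \<in> T")
    case True
    define t where "t = take j (act \<omega> (u @ m @ w) x)"
    have "take j (act \<omega> m (act \<omega> u x)) = act \<omega> (rev w) t"
      unfolding t_def by (simp add: act_append take_act)
    then have "(1::real) \<le> of_bool (take j (act \<omega> m (act \<omega> u x)) = act \<omega> (rev w) t)" by simp
    also have "\<dots> \<le> (\<Sum>t\<in>T. of_bool (take j (act \<omega> m (act \<omega> u x)) = act \<omega> (rev w) t))"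
      using T True by (intro member_le_sum) (auto simp: t_def)
    finally show ?thesis using True by simp
  qed (auto intro: sum_nonneg)
  then have "probability vs (\<lambda>m. take j (act \<omega> (u @ m @ w) x) \<in> T) \<le>
    average vs (\<lambda>m. \<Sum>t\<in>T. of_bool (take j (act \<omega> m (act \<omega> u x)) = act \<omega> (rev w) t))"
    by (rule average_mono)
  also have "\<dots> = (\<Sum>t\<in>T. probability vs (\<lambda>m. take j (act \<omega> m (act \<omega> u x)) = act \<omega> (rev w) t))"
    by (rule average_sum)
  also have "\<dots> \<le> (\<Sum>t\<in>T. c)" by (intro sum_mono c) simp
  finally show "probability vs (\<lambda>m. take j (act \<omega> (u @ m @ w) x) \<in> T) \<le> real (card T) * c" by simp
qed

text \<open>The high flips leave the first \<open>k\<close> digits alone, so once everything else is fixed, only one vertex of level \<open>j\<close> can be hit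
  after them.\<close>

lemma probability_surround_high_le:
  assumes hs: "sorted_wrt (<) hs" "\<And>l. l \<in> set hs \<Longrightarrow> k \<le> l \<and> l < j" and j: "l < k" "k \<le> j" "j \<le> length x"
  shows "probability (us @ map (flip \<omega>) hs @ ws) (\<lambda>w. \<forall>n. l < n \<longrightarrow> n < j \<longrightarrow> act \<omega> w x ! n) \<le> (1/2) ^ length hs"
proof (rule probability_middle_le)
  fix u w
  let ?H = "map (flip \<omega>) hs"
  define t where "t = act \<omega> w (take k (act \<omega> u x)) @ replicate (j - k) True"
  have "probability ?H (\<lambda>h. \<forall>n. l < n \<longrightarrow> n < j \<longrightarrow> act \<omega> (u @ h @ w) x ! n)
    \<le> probability ?H (\<lambda>h. take j (act \<omega> h (act \<omega> u x)) = act \<omega> (rev w) t)"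
  proof (rule probability_mono_on)
    fix h assume h: "h \<in> subproducts ?H" and ones: "\<forall>n. l < n \<longrightarrow> n < j \<longrightarrow> act \<omega> (u @ h @ w) x ! n"
    let ?y = "act \<omega> (u @ h @ w) x"
    have "take k (act \<omega> h (act \<omega> u x)) = take k (act \<omega> u x)"
      by (rule take_act_subproducts[OF h]) (use hs(2) j in fastforce)
    then have "take k ?y = act \<omega> w (take k (act \<omega> u x))"
      by (simp add: act_append take_act)
    moreover have "take j ?y = take k ?y @ replicate (j - k) True"
    proof (rule nth_equalityI)
      show "length (take j ?y) = length (take k ?y @ replicate (j - k) True)" using j by simp
      fix n assume "n < length (take j ?y)"
      then show "take j ?y ! n = (take k ?y @ replicate (j - k) True) ! n"
        using j ones by (auto simp: nth_append)
    qed
    ultimately have "take j ?y = t" by (simp add: t_def)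
    then show "take j (act \<omega> h (act \<omega> u x)) = act \<omega> (rev w) t"
      by (simp add: act_append take_act_eq_iff)
  qed
  also have "\<dots> \<le> (1/2) ^ length hs"
    by (rule probability_flips_le[OF hs(1)]) (use hs(2) j in auto)
  finally show "probability ?H (\<lambda>h. \<forall>n. l < n \<longrightarrow> n < j \<longrightarrow> act \<omega> (u @ h @ w) x ! n) \<le> (1/2) ^ length hs" .
qed

section \<open>Jumps and the risk of disturbing a germ\<close>

text \<open>The expected number of words of \<open>vs\<close> that contribute to the germ at \<open>x\<close> if they are applied after a random subproduct of
  \<open>us\<close>.\<close>

definition risk :: "letter stream \<Rightarrow> vertex \<Rightarrow> gen list list \<Rightarrow> gen list list \<Rightarrow> real" where
  "risk \<omega> x us vs = (\<Sum>i<length vs. probability (us @ take i vs) (\<lambda>u. germ_parity \<omega> (vs ! i) (act \<omega> u x)))"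

lemma risk_Nil [simp]: "risk \<omega> x us [] = 0"
  by (simp add: risk_def)

lemma risk_Cons:
  "risk \<omega> x us (v # vs) = probability us (\<lambda>u. germ_parity \<omega> v (act \<omega> u x)) + risk \<omega> x (us @ [v]) vs"
  unfolding risk_def by (simp add: sum.lessThan_Suc_shift del: sum.lessThan_Suc)

lemma risk_append: "risk \<omega> x us (vs @ ws) = risk \<omega> x us vs + risk \<omega> x (us @ vs) ws"
  by (induction vs arbitrary: us) (auto simp: risk_Cons)

lemma probability_germ_parity_le_risk: "probability vs (\<lambda>w. germ_parity \<omega> w x) \<le> risk \<omega> x [] vs"
  using probability_germ_parity_le[of vs \<omega> x] by (simp add: risk_def)

lemma risk_map_flip:
  "risk \<omega> x us (map (flip \<omega>) [0..<k]) =
   (\<Sum>l<k. probability (us @ map (flip \<omega>) [0..<l]) (\<lambda>u. germ_parity \<omega> (flip \<omega> l) (act \<omega> u x)))"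
  unfolding risk_def by (intro sum.cong) (auto simp: take_map)

text \<open>These are the levels above \<open>3 b q\<close> whose flips have no germs modulo \<open>b\<close>: with 2 at the positions divisible by 3, the
  exceptional levels are those congruent to 1. There are \<open>4 b\<close> such levels in the window of length \<open>6 b\<close>, and \<open>2 ^ (4 b)\<close> beats the
  number \<open>8 ^ b\<close> of jumps between two jumps of the next larger scale.\<close>

definition high_levels :: "nat \<Rightarrow> nat \<Rightarrow> nat list" where
  "high_levels b q = filter (\<lambda>m. m mod 3 \<noteq> 1) [3 * b * q..<3 * b * (q + 2)]"

lemma length_filter_mod3: "length (filter (\<lambda>m. m mod 3 \<noteq> 1) [3 * a..<3 * (a + c)]) = 2 * c"
proof (induction c)
  case (Suc c)
  have "[3 * a..<3 * (a + Suc c)] = [3 * a..<3 * (a + c)] @ [3 * (a + c), 3 * (a + c) + 1, 3 * (a + c) + 2]"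
    by (simp add: upt_rec[of "3 * a"] numeral_eq_Suc upt_Suc_append)
  moreover have "length (filter (\<lambda>m. m mod 3 \<noteq> 1) [3 * y, 3 * y + 1, 3 * y + 2]) = 2" for y :: nat
  proof -
    have "3 * y mod 3 \<noteq> 1" "(3 * y + 1) mod 3 = 1" "(3 * y + 2) mod 3 \<noteq> 1" by presburger+
    then show ?thesis by (simp only: filter.simps if_True if_False simp_thms) simp
  qed
  ultimately show ?case using Suc by (simp only: filter_append length_append) simp
qed simp

lemma length_high_levels: "length (high_levels b q) = 4 * b"
  using length_filter_mod3[of "b * q" "2 * b"] by (simp add: high_levels_def algebra_simps)

text \<open>The high flips come first. They are harmless and usually move the point away from the places where the
  exceptional low flips have their germs.\<close>

definition jump :: "letter stream \<Rightarrow> nat \<Rightarrow> nat \<Rightarrow> gen list list" where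
  "jump \<omega> b q = map (flip \<omega>) (high_levels b q @ [0..<3 * b * q])"

definition jump_step :: "letter stream \<Rightarrow> nat \<Rightarrow> nat \<Rightarrow> gen list list" where
  "jump_step \<omega> b q = [GX KC] # jump \<omega> b q"

lemma sorted_high_levels: "sorted_wrt (<) (high_levels b q)"
  by (simp add: high_levels_def sorted_wrt_filter)

lemma set_high_levels: "l \<in> set (high_levels b q) \<Longrightarrow> 3 * b * q \<le> l \<and> l < 3 * b * (q + 2) \<and> l mod 3 \<noteq> 1"
  by (auto simp: high_levels_def)

lemma probability_jump_le:
  assumes "3 * b * (q + 2) \<le> length x"
  shows "probability (jump \<omega> b q) (\<lambda>w. take (3 * b * (q + 2)) (act \<omega> w x) = t) \<le> (1/2) ^ (3 * b * q + 4 * b)"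
proof -
  have "probability (jump \<omega> b q) (\<lambda>w. take (3 * b * (q + 2)) (act \<omega> w x) = t)
     \<le> (1/2) ^ (length (high_levels b q) + length [0..<3 * b * q])"
    unfolding jump_def
    by (rule probability_two_flips_le[where k = "3 * b * q"])
       (use assms sorted_high_levels set_high_levels in \<open>auto simp: sorted_wrt_upt\<close>)
  then show ?thesis by (simp add: length_high_levels add.commute)
qed

lemma card_ones_le: "card {t. length t = j \<and> (\<forall>n. l < n \<longrightarrow> n < j \<longrightarrow> t ! n)} \<le> 2 ^ (l + 1)"
  and finite_ones: "finite {t :: bool list. length t = j \<and> (\<forall>n. l < n \<longrightarrow> n < j \<longrightarrow> t ! n)}"
proof -
  let ?T = "{t. length t = j \<and> (\<forall>n. l < n \<longrightarrow> n < j \<longrightarrow> t ! n)}"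
  have fl: "finite {t :: bool list. length t = n}" "card {t :: bool list. length t = n} = 2 ^ n" for n
    using finite_lists_length_eq[of "UNIV :: bool set" n] card_lists_length_eq[of "UNIV :: bool set" n] by auto
  show fin: "finite ?T" by (rule finite_subset[OF _ fl(1)[of j]]) auto
  let ?g = "\<lambda>t. take (Suc l) t @ replicate (Suc l - j) True"
  have "inj_on ?g ?T"
  proof (rule inj_onI)
    fix s t assume st: "s \<in> ?T" "t \<in> ?T" "?g s = ?g t"
    then have e: "take (Suc l) s = take (Suc l) t" by auto
    show "s = t"
    proof (rule nth_equalityI)
      fix n assume "n < length s"
      then show "s ! n = t ! n"
        using st e by (cases "n < Suc l") (metis nth_take, auto)
    qed (use st in auto)
  qed
  then have "card ?T = card (?g ` ?T)" by (simp add: card_image)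
  also have "\<dots> \<le> card {t :: bool list. length t = Suc l}"
    by (intro card_mono fl) (auto simp: min_def)
  finally show "card ?T \<le> 2 ^ (l + 1)" by (simp add: fl)
qed

locale periodic_twos =
  fixes \<omega> :: "letter stream"
  assumes two_iff: "\<And>m. \<omega> !! m = L2 \<longleftrightarrow> m mod 3 = 0"
begin

lemma frequent_two: "\<exists>m\<ge>n. \<omega> !! m = L2"
  by (rule exI[of _ "3 * n"]) (simp add: two_iff)

lemma germ_parity_flip_good:
  assumes "m mod 3 \<noteq> 1" "m < length x"
  shows "\<not> germ_parity \<omega> (flip \<omega> m) x"
proof
  assume "germ_parity \<omega> (flip \<omega> m) x"
  from germ_parity_flip[OF assms(2) this] have "m > 0" "(m - 1) mod 3 = 0" by (auto simp: two_iff)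
  with assms(1) show False by presburger
qed

lemma risk_high_levels:
  assumes "3 * b * (q + 2) \<le> length x"
  shows "risk \<omega> x us (map (flip \<omega>) (high_levels b q)) = 0"
  unfolding risk_def
proof (rule sum.neutral, rule ballI)
  fix i assume "i \<in> {..<length (map (flip \<omega>) (high_levels b q))}"
  then have i: "i < length (high_levels b q)" by simp
  have m: "high_levels b q ! i mod 3 \<noteq> 1" "high_levels b q ! i < length x"
    using set_high_levels[OF nth_mem[OF i]] assms by auto
  show "probability (us @ take i (map (flip \<omega>) (high_levels b q)))
     (\<lambda>u. germ_parity \<omega> (map (flip \<omega>) (high_levels b q) ! i) (act \<omega> u x)) = 0"
    by (rule probability_eq_0) (use germ_parity_flip_good m i in auto)
qed

text \<open>Whatever happened before, the high flips of the jump itself keep the risk of its low flips small.\<close>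

lemma risk_jump_fresh:
  assumes "3 * b * (q + 2) \<le> length x"
  shows "risk \<omega> x us (jump \<omega> b q) \<le> real (3 * b * q) * (1/2) ^ (4 * b)"
proof -
  let ?H = "map (flip \<omega>) (high_levels b q)"
  have "risk \<omega> x us (jump \<omega> b q) = risk \<omega> x (us @ ?H) (map (flip \<omega>) [0..<3 * b * q])"
    unfolding jump_def map_append risk_append using risk_high_levels[OF assms] by simp
  also have "\<dots> = (\<Sum>l<3 * b * q. probability (us @ ?H @ map (flip \<omega>) [0..<l])
      (\<lambda>u. germ_parity \<omega> (flip \<omega> l) (act \<omega> u x)))"
    unfolding risk_map_flip by simp
  also have "\<dots> \<le> (\<Sum>l<3 * b * q. (1/2) ^ (4 * b))"
  proof (rule sum_mono)
    fix l assume "l \<in> {..<3 * b * q}"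
    then have l: "l < 3 * b * q" by simp
    have le: "3 * b * q \<le> 3 * b * (q + 2)" by (intro mult_le_mono2) simp
    have "probability (us @ ?H @ map (flip \<omega>) [0..<l]) (\<lambda>u. germ_parity \<omega> (flip \<omega> l) (act \<omega> u x))
      \<le> probability (us @ ?H @ map (flip \<omega>) [0..<l]) (\<lambda>u. \<forall>n. l < n \<longrightarrow> n < 3 * b * (q + 2) \<longrightarrow> act \<omega> u x ! n)"
    proof (rule probability_mono_on)
      fix w assume "germ_parity \<omega> (flip \<omega> l) (act \<omega> w x)"
      with l le assms show "\<forall>n. l < n \<longrightarrow> n < 3 * b * (q + 2) \<longrightarrow> act \<omega> w x ! n"
        using germ_parity_flip[of l "act \<omega> w x" \<omega>] by auto
    qed
    also have "\<dots> \<le> (1/2) ^ length (high_levels b q)"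
      by (rule probability_surround_high_le[OF sorted_high_levels _ l le assms]) (use set_high_levels in auto)
    finally show "probability (us @ ?H @ map (flip \<omega>) [0..<l]) (\<lambda>u. germ_parity \<omega> (flip \<omega> l) (act \<omega> u x)) \<le> (1/2) ^ (4 * b)"
      by (simp add: length_high_levels)
  qed
  finally show ?thesis by simp
qed

lemma probability_after_jump_le:
  assumes "3 * b * (q + 2) \<le> length x" "finite T"
  shows "probability (us @ jump \<omega> b q @ ws) (\<lambda>w. take (3 * b * (q + 2)) (act \<omega> w x) \<in> T)
     \<le> real (card T) * (1/2) ^ (3 * b * q + 4 * b)"
  by (rule probability_surround_le) (use assms probability_jump_le in auto)

text \<open>An earlier jump of at least the same scale has made the position uniform up to a deeper level, which gives a
  much better bound when its scale is larger.\<close>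

lemma risk_jump_after:
  assumes "3 * b * (q' + 2) \<le> length x" "q \<le> q'"
  shows "risk \<omega> x (us @ jump \<omega> b q' @ ws) (jump \<omega> b q) \<le> 2 ^ (3 * b * q + 1) * (1/2) ^ (3 * b * q' + 4 * b)"
proof -
  let ?H = "map (flip \<omega>) (high_levels b q)"
  let ?j = "3 * b * (q' + 2)"
  have "3 * b * (q + 2) \<le> 3 * b * (q' + 2)" using assms(2) by (intro mult_le_mono2) simp
  then have x: "3 * b * (q + 2) \<le> length x" using assms(1) by linarith
  have "risk \<omega> x (us @ jump \<omega> b q' @ ws) (jump \<omega> b q)
     = risk \<omega> x (us @ jump \<omega> b q' @ ws @ ?H) (map (flip \<omega>) [0..<3 * b * q])"
    unfolding jump_def[of \<omega> b q] map_append risk_append using risk_high_levels[OF x] by simp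
  also have "\<dots> = (\<Sum>l<3 * b * q. probability (us @ jump \<omega> b q' @ (ws @ ?H @ map (flip \<omega>) [0..<l]))
      (\<lambda>u. germ_parity \<omega> (flip \<omega> l) (act \<omega> u x)))"
    unfolding risk_map_flip by simp
  also have "\<dots> \<le> (\<Sum>l<3 * b * q. 2 ^ (l + 1) * (1/2) ^ (3 * b * q' + 4 * b))"
  proof (rule sum_mono)
    fix l assume "l \<in> {..<3 * b * q}"
    then have l: "l < 3 * b * q" by simp
    have "3 * b * q \<le> ?j" using assms(2) by (intro mult_le_mono2) simp
    let ?T = "{t. length t = ?j \<and> (\<forall>n. l < n \<longrightarrow> n < ?j \<longrightarrow> t ! n)}"
    have "probability (us @ jump \<omega> b q' @ (ws @ ?H @ map (flip \<omega>) [0..<l])) (\<lambda>u. germ_parity \<omega> (flip \<omega> l) (act \<omega> u x))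
      \<le> probability (us @ jump \<omega> b q' @ (ws @ ?H @ map (flip \<omega>) [0..<l])) (\<lambda>u. take ?j (act \<omega> u x) \<in> ?T)"
    proof (rule probability_mono_on)
      fix w assume "germ_parity \<omega> (flip \<omega> l) (act \<omega> w x)"
      then show "take ?j (act \<omega> w x) \<in> ?T"
        using germ_parity_flip[of l "act \<omega> w x" \<omega>] l \<open>3 * b * q \<le> ?j\<close> assms(1) by auto
    qed
    also have "\<dots> \<le> real (card ?T) * (1/2) ^ (3 * b * q' + 4 * b)"
      by (rule probability_after_jump_le[OF assms(1) finite_ones])
    also have "\<dots> \<le> 2 ^ (l + 1) * (1/2) ^ (3 * b * q' + 4 * b)"
    proof (rule mult_right_mono)
      have "real (card ?T) \<le> real (2 ^ (l + 1))" using card_ones_le by (rule of_nat_mono)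
      then show "real (card ?T) \<le> 2 ^ (l + 1)" by simp
    qed simp
    finally show "probability (us @ jump \<omega> b q' @ (ws @ ?H @ map (flip \<omega>) [0..<l]))
        (\<lambda>u. germ_parity \<omega> (flip \<omega> l) (act \<omega> u x)) \<le> 2 ^ (l + 1) * (1/2) ^ (3 * b * q' + 4 * b)" .
  qed
  also have "\<dots> = (\<Sum>l<3 * b * q. 2 ^ (l + 1)) * (1/2) ^ (3 * b * q' + 4 * b)"
    by (simp only: sum_distrib_right)
  also have "\<dots> \<le> 2 ^ (3 * b * q + 1) * (1/2) ^ (3 * b * q' + 4 * b)"
  proof (rule mult_right_mono)
    have "(\<Sum>l<n. 2 ^ (l + 1)) \<le> (2::real) ^ (n + 1)" for n by (induction n) auto
    then show "(\<Sum>l<3 * b * q. 2 ^ (l + 1)) \<le> (2::real) ^ (3 * b * q + 1)" .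
  qed simp
  finally show ?thesis .
qed

lemma probability_return_le:
  assumes "3 * b * (q' + 2) \<le> K"
  shows "probability (us @ jump \<omega> b q' @ ws) (\<lambda>u. germ_parity \<omega> [GX KC] (act \<omega> u (replicate K True)))
     \<le> (1/2) ^ (3 * b * q' + 4 * b)"
proof -
  let ?j = "3 * b * (q' + 2)" and ?o = "replicate K True"
  have "probability (us @ jump \<omega> b q' @ ws) (\<lambda>u. germ_parity \<omega> [GX KC] (act \<omega> u ?o))
     \<le> probability (us @ jump \<omega> b q' @ ws) (\<lambda>u. take ?j (act \<omega> u ?o) \<in> {replicate ?j True})"
  proof (rule probability_mono_on)
    fix w assume "germ_parity \<omega> [GX KC] (act \<omega> w ?o)"
    then have "False \<notin> set (act \<omega> w ?o)" by simp
    then have "set (act \<omega> w ?o) \<subseteq> {True}" by (auto, metis (full_types))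
    then have "act \<omega> w ?o = replicate K True"
      by (metis (full_types) length_act length_replicate replicate_eqI singletonD subsetD)
    then show "take ?j (act \<omega> w ?o) \<in> {replicate ?j True}" using assms by (simp add: min_absorb1)
  qed
  also have "\<dots> \<le> real (card {replicate ?j True}) * (1/2) ^ (3 * b * q' + 4 * b)"
    by (rule probability_after_jump_le) (use assms in auto)
  finally show ?thesis by simp
qed

end

section \<open>The schedule of jumps\<close>

text \<open>A ruler sequence: a jump of scale at least \<open>q\<close> occurs once in \<open>B ^ (q - 1)\<close> steps.\<close>

definition jump_scale :: "nat \<Rightarrow> nat \<Rightarrow> nat \<Rightarrow> nat" where
  "jump_scale B Q s = Suc (card {p \<in> {1..<Q}. B ^ p dvd s})"

lemma jump_scale_ge:
  assumes "B ^ p dvd s" "p < Q"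
  shows "Suc p \<le> jump_scale B Q s"
proof -
  have "{1..p} \<subseteq> {p \<in> {1..<Q}. B ^ p dvd s}"
    using assms by (auto intro: dvd_trans[OF le_imp_power_dvd])
  then have "card {1..p} \<le> card {p \<in> {1..<Q}. B ^ p dvd s}" by (intro card_mono) auto
  then show ?thesis by (simp add: jump_scale_def)
qed

lemma jump_scale_le: "0 < Q \<Longrightarrow> jump_scale B Q s \<le> Q"
proof -
  assume "0 < Q"
  have "card {p \<in> {1..<Q}. B ^ p dvd s} \<le> card {1..<Q}" by (intro card_mono) auto
  then show ?thesis using \<open>0 < Q\<close> by (simp add: jump_scale_def)
qed

lemma jump_scale_dvd: "B ^ (jump_scale B Q s - 1) dvd s"
proof -
  let ?A = "{p \<in> {1..<Q}. B ^ p dvd s}"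
  show ?thesis
  proof (cases "?A = {}")
    case False
    have "?A \<subseteq> {1..Max ?A}" by auto
    then have "card ?A \<le> card {1..Max ?A}" by (intro card_mono) auto
    then have "card ?A \<le> Max ?A" by simp
    moreover have "Max ?A \<in> ?A" using False by (intro Max_in) auto
    ultimately show ?thesis unfolding jump_scale_def
      by (auto intro: dvd_trans[OF le_imp_power_dvd])
  next
    case True
    then show ?thesis unfolding jump_scale_def by (simp only: card.empty) simp
  qed
qed

lemma jump_scale_pos: "1 \<le> jump_scale B Q s"
  by (simp add: jump_scale_def)

lemma exists_multiple:
  assumes "(0::nat) < m" "m \<le> d" "0 < i"
  obtains s where "i \<le> s" "s < i + d" "m dvd s"
proof -
  define t where "t = ((i + m - 1) div m) * m"
  have "i + m - 1 = t + (i + m - 1) mod m" unfolding t_def by (simp add: div_mult_mod_eq)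
  moreover have "(i + m - 1) mod m < m" using assms by simp
  ultimately have "i \<le> t" "t < i + d" using assms by linarith+
  moreover have "m dvd t" by (simp add: t_def)
  ultimately show ?thesis using that by blast
qed

text \<open>Between step \<open>i\<close> and step \<open>i + d\<close> there is a multiple of the largest power of \<open>B\<close> that is at most \<open>d\<close>.\<close>

lemma exists_large_scale:
  assumes B: "2 \<le> B" and d: "0 < d" "d < B ^ Q" and i: "0 < i"
  obtains s where "i \<le> s" "s < i + d" "d < B ^ jump_scale B Q s"
proof -
  let ?P = "\<lambda>p. d < B ^ p"
  define p where "p = (LEAST p. ?P p)"
  have p: "?P p" unfolding p_def by (rule LeastI) (rule d(2))
  have pQ: "p \<le> Q" unfolding p_def by (rule Least_le) (rule d(2))
  have "p \<noteq> 0" using p d(1) by (cases p) auto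
  then obtain r where r: "p = Suc r" by (cases p) auto
  have "\<not> ?P r" unfolding p_def by (rule not_less_Least) (use r p_def in simp)
  then have le: "B ^ r \<le> d" by simp
  obtain s where s: "i \<le> s" "s < i + d" "B ^ r dvd s"
    using exists_multiple[OF _ le i] B by auto
  have "Suc r \<le> jump_scale B Q s" by (rule jump_scale_ge[OF s(3)]) (use pQ r in simp)
  then have "B ^ p \<le> B ^ jump_scale B Q s" using B r by (intro power_increasing) auto
  with p s show ?thesis using that by force
qed

lemma sum_inverse_le: "(\<Sum>n<2 ^ M. 1 / real (Suc n)) \<le> 1 + real M"
proof (induction M)
  case (Suc M)
  have "(\<Sum>n<2 ^ Suc M. 1 / real (Suc n)) =
     (\<Sum>n<2 ^ M. 1 / real (Suc n)) + (\<Sum>n=2 ^ M..<2 ^ Suc M. 1 / real (Suc n))"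
    by (simp add: lessThan_atLeast0 sum.atLeastLessThan_concat)
  also have "(\<Sum>n=2 ^ M..<2 ^ Suc M. 1 / real (Suc n)) \<le> (\<Sum>n=(2::nat) ^ M..<2 ^ Suc M. 1 / 2 ^ M)"
  proof (rule sum_mono)
    fix n :: nat assume "n \<in> {2 ^ M..<2 ^ Suc M}"
    then have "real (2 ^ M) \<le> real (Suc n)" by (intro of_nat_mono) auto
    then show "1 / real (Suc n) \<le> 1 / 2 ^ M" by (intro divide_left_mono) auto
  qed
  also have "\<dots> = 1" by simp
  finally show ?case using Suc by simp
qed simp

lemma sum_over_scales_le:
  assumes Q: "0 < Q" and f: "\<And>q s. 0 \<le> f q s"
  shows "(\<Sum>s\<in>A. f (jump_scale B Q s) s) \<le> (\<Sum>q\<in>{1..Q}. \<Sum>s\<in>A. of_bool (B ^ (q - 1) dvd s) * f q s :: real)"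
proof -
  have "f (jump_scale B Q s) s \<le> (\<Sum>q\<in>{1..Q}. of_bool (B ^ (q - 1) dvd s) * f q s)" for s
  proof -
    have "f (jump_scale B Q s) s = of_bool (B ^ (jump_scale B Q s - 1) dvd s) * f (jump_scale B Q s) s"
      using jump_scale_dvd by simp
    also have "\<dots> \<le> (\<Sum>q\<in>{1..Q}. of_bool (B ^ (q - 1) dvd s) * f q s)"
      by (rule member_le_sum[where f = "\<lambda>q. of_bool (B ^ (q - 1) dvd s) * f q s"])
        (use jump_scale_le[OF Q] jump_scale_pos f in auto)
    finally show ?thesis .
  qed
  then have "(\<Sum>s\<in>A. f (jump_scale B Q s) s) \<le> (\<Sum>s\<in>A. \<Sum>q\<in>{1..Q}. of_bool (B ^ (q - 1) dvd s) * f q s)"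
    by (rule sum_mono)
  also have "\<dots> = (\<Sum>q\<in>{1..Q}. \<Sum>s\<in>A. of_bool (B ^ (q - 1) dvd s) * f q s)"
    by (rule sum.swap)
  finally show ?thesis .
qed

text \<open>For each scale \<open>q\<close> the multiples of \<open>B ^ (q - 1)\<close> after \<open>i\<close> contribute at most a constant and \<open>B\<close> times a harmonic sum.\<close>

lemma sum_scale_le:
  fixes i N M Q B :: nat
  assumes B: "2 \<le> B" and Q: "0 < Q" and N: "N \<le> 2 ^ M"
  shows "(\<Sum>s\<in>{i<..N}. min 1 (real (B ^ jump_scale B Q s) / real (s - i)))
      \<le> real Q * (1 + real B * (1 + real M))"
proof -
  let ?f = "\<lambda>q s. min 1 (real (B ^ q) / real (s - i))"
  have B0: "0 < B" using B by simp
  have "(\<Sum>s\<in>{i<..N}. ?f (jump_scale B Q s) s) \<le> (\<Sum>q\<in>{1..Q}. \<Sum>s\<in>{i<..N}. of_bool (B ^ (q - 1) dvd s) * ?f q s)"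
    by (rule sum_over_scales_le[OF Q]) simp
  also have "\<dots> \<le> (\<Sum>q\<in>{1..Q}. 1 + real B * (1 + real M))"
  proof (rule sum_mono)
    fix q assume "q \<in> {1..Q}"
    then obtain r where q: "q = Suc r" by (cases q) auto
    define m where "m = B ^ r"
    have m: "0 < m" using B0 by (simp add: m_def)
    let ?A = "{s \<in> {i<..N}. m dvd s}"
    \<comment> \<open>the number of multiples of \<open>m\<close> strictly between \<open>i\<close> and \<open>s\<close>\<close>
    define h where "h s = s div m - i div m - 1" for s
    define g where "g n = (if n = 0 then 1 else real B / real n)" for n :: nat
    have A: "i div m < s div m \<and> m * (h s) \<le> s - i \<and> h s < N \<and> s = m * (s div m)" if s: "s \<in> ?A" for s
    proof -
      obtain t where t: "s = m * t" using s by auto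
      have "i div m < t" using s t m by (metis (no_types, lifting) div_less_iff_less_mult greaterThanAtMost_iff mem_Collect_eq mult.commute)
      moreover have "i < m * (i div m) + m" using m by (metis add.commute dividend_less_times_div mult.commute)
      moreover have "t \<le> s" using t m by (cases m) auto
      moreover have "s \<le> N" using s by simp
      moreover have "m * (t - i div m - 1) + (m * (i div m) + m) = m * t"
      proof -
        have "t = (t - i div m - 1) + (i div m + 1)" using \<open>i div m < t\<close> by simp
        then have "m * t = m * ((t - i div m - 1) + (i div m + 1))" by simp
        then show ?thesis by (simp only: distrib_left mult_1_right)
      qed
      moreover from calculation have "t - i div m - 1 < N" by linarith
      ultimately show ?thesis using t m by (auto simp: h_def)
    qed
    have injh: "inj_on h ?A"
    proof (rule inj_onI)
      fix s s' assume "s \<in> ?A" "s' \<in> ?A" "h s = h s'"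
      then have "s div m = s' div m" using A[of s] A[of s'] unfolding h_def by linarith
      then show "s = s'" using A[OF \<open>s \<in> ?A\<close>] A[OF \<open>s' \<in> ?A\<close>] by metis
    qed
    have "(\<Sum>s\<in>{i<..N}. of_bool (B ^ (q - 1) dvd s) * ?f q s) = (\<Sum>s\<in>?A. ?f q s)"
      unfolding sum.inter_filter[OF finite_greaterThanAtMost] by (intro sum.cong) (auto simp: q m_def)
    also have "\<dots> \<le> (\<Sum>s\<in>?A. g (h s))"
    proof (rule sum_mono)
      fix s assume s: "s \<in> ?A"
      show "?f q s \<le> g (h s)"
      proof (cases "h s = 0")
        case False
        then have hp: "0 < real (h s)" by simp
        have "real m * real (h s) \<le> real (s - i)"
          using A[OF s] by (metis of_nat_mono of_nat_mult)
        then have "real (B ^ q) / real (s - i) \<le> real (B ^ q) / (real m * real (h s))"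
          using hp m s by (intro divide_left_mono) (auto intro!: mult_pos_pos)
        also have "\<dots> = real B / real (h s)"
          using m by (simp add: q m_def)
        finally have "real (B ^ q) / real (s - i) \<le> g (h s)" using False by (simp add: g_def)
        then show ?thesis by (rule min.coboundedI2)
      qed (simp add: g_def)
    qed
    also have "\<dots> = (\<Sum>n\<in>h ` ?A. g n)" unfolding sum.reindex[OF injh] comp_def ..
    also have "\<dots> \<le> (\<Sum>n<Suc (2 ^ M). g n)"
    proof (rule sum_mono2)
      show "h ` ?A \<subseteq> {..<Suc (2 ^ M)}" using A N by fastforce
    qed (auto simp: g_def)
    also have "\<dots> = 1 + (\<Sum>n<2 ^ M. real B * (1 / real (Suc n)))"
      by (simp add: sum.lessThan_Suc_shift g_def del: sum.lessThan_Suc)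
    also have "\<dots> \<le> 1 + real B * (1 + real M)"
      unfolding sum_distrib_left[symmetric] using sum_inverse_le[of M]
      by (intro add_left_mono mult_left_mono) auto
    finally show "(\<Sum>s\<in>{i<..N}. of_bool (B ^ (q - 1) dvd s) * ?f q s) \<le> 1 + real B * (1 + real M)" .
  qed
  also have "\<dots> = real Q * (1 + real B * (1 + real M))" by simp
  finally show ?thesis .
qed

section \<open>The random walk\<close>

text \<open>A step is the letter \<open>c\<close>, tossed like all other factors, followed by a jump.\<close>

definition walk :: "letter stream \<Rightarrow> nat \<Rightarrow> nat list \<Rightarrow> gen list list" where
  "walk \<omega> b qs = concat (map (jump_step \<omega> b) qs)"

lemma walk_simps [simp]:
  "walk \<omega> b [] = []" "walk \<omega> b (q # qs) = [GX KC] # jump \<omega> b q @ walk \<omega> b qs"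
  "walk \<omega> b (ps @ qs) = walk \<omega> b ps @ walk \<omega> b qs"
  by (simp_all add: walk_def jump_step_def)

lemma word_of_neq_single: "word_of w \<noteq> [GX x]"
  by (cases w) auto

lemma single_notin_jump: "[GX KC] \<notin> set (jump \<omega> b q)"
proof -
  have "[GX KC] \<noteq> flip \<omega> l" for l
    using word_of_neq_single by metis
  then show ?thesis by (auto simp: jump_def)
qed

lemma walk_split:
  assumes "walk \<omega> b qs = us @ [GX KC] # ws"
  obtains ps q rs where "qs = ps @ q # rs" "ws = jump \<omega> b q @ walk \<omega> b rs"
  using assms
proof (induction qs arbitrary: us thesis)
  case (Cons q qs)
  show ?case
  proof (cases us)
    case Nil
    then show ?thesis using Cons.prems(2) by (intro Cons.prems(1)[of "[]" q qs]) auto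
  next
    case (Cons u us')
    then have e: "jump \<omega> b q @ walk \<omega> b qs = us' @ [GX KC] # ws" using Cons.prems(2) by simp
    then consider us'' where "us' = jump \<omega> b q @ us''" "walk \<omega> b qs = us'' @ [GX KC] # ws"
      | us'' where "jump \<omega> b q = us' @ us''" "us'' \<noteq> []" "us'' @ walk \<omega> b qs = [GX KC] # ws"
      unfolding append_eq_append_conv2 by force
    then show ?thesis
    proof cases
      case 1
      obtain ps p rs where "qs = ps @ p # rs" "ws = jump \<omega> b p @ walk \<omega> b rs"
        using Cons.IH[OF _ 1(2)] by blast
      then show ?thesis by (intro Cons.prems(1)[of "q # ps" p rs]) auto
    next
      case 2
      then have "[GX KC] \<in> set (jump \<omega> b q)" by (cases us'') auto
      then show ?thesis using single_notin_jump by blast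
    qed
  qed
qed simp

lemma count_walk: "length qs \<le> count_list (walk \<omega> b qs) [GX KC]"
  by (induction qs) (auto simp: count_list_append)

context periodic_twos
begin

text \<open>Take the largest jump between the base point and the step in question. If its scale is at least \<open>q\<close>, the
  position is uniform on a level so deep that both a return and a bad low flip are unlikely; otherwise the fresh bound applies,
  and then the minimum on the right is 1. The assumption on \<open>d\<close>, the number of steps since the
  base point, is what the ruler sequence provides.\<close>

lemma risk_step_le:
  fixes qs :: "nat list"
  assumes qs: "q' \<in> set (q0 # qs)" and B: "real d < 8 ^ (b * q')" and d: "0 < d"
    and Q: "\<And>p. p \<in> set (q # q0 # qs) \<Longrightarrow> p \<le> Q" and K: "3 * b * (Q + 2) \<le> K"
  shows "risk \<omega> (replicate K True) (jump \<omega> b q0 @ walk \<omega> b qs) (jump_step \<omega> b q)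
     \<le> (1/2) ^ (4 * b) * (3 + 3 * real b * real Q) * min 1 (8 ^ (b * q) / real d)"
proof -
  let ?o = "replicate K True" and ?us = "jump \<omega> b q0 @ walk \<omega> b qs"
  let ?h = "(1/2::real) ^ (4 * b)"
  have split: "\<exists>us ws. ?us = us @ jump \<omega> b p @ ws" if "p \<in> set (q0 # qs)" for p
  proof (cases "p = q0")
    case True
    then show ?thesis by (intro exI[of _ "[]"] exI[of _ "walk \<omega> b qs"]) simp
  next
    case False
    then have "p \<in> set qs" using that by simp
    then obtain ps rs where "qs = ps @ p # rs" by (meson split_list)
    then show ?thesis
      by (intro exI[of _ "jump \<omega> b q0 @ walk \<omega> b ps @ [[GX KC]]"] exI[of _ "walk \<omega> b rs"]) simp
  qed
  have Kp: "3 * b * (p + 2) \<le> K" if "p \<le> Q" for p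
    by (rule order_trans[OF mult_le_mono2 K]) (use that in simp)
  have pw: "(1/2::real) ^ (3 * b * p + 4 * b) = ?h / 8 ^ (b * p)" for p
  proof -
    have "(2::real) ^ (3 * b * p) = 8 ^ (b * p)"
      by (simp add: power_mult mult.assoc)
    then have "(1/2::real) ^ (3 * b * p) = 1 / 8 ^ (b * p)" by (simp only: power_one_over)
    then show ?thesis by (simp only: power_add) simp
  qed
  have h0: "0 \<le> ?h" by simp
  have min0: "0 \<le> min 1 ((8::real) ^ (b * q) / real d)" by simp
  have "1 \<le> (8::real) ^ (b * q)" by (simp add: one_le_power)
  have ret: "probability ?us (\<lambda>u. germ_parity \<omega> [GX KC] (act \<omega> u ?o)) \<le> ?h * min 1 (8 ^ (b * q) / real d)"
  proof -
    obtain us ws where u: "?us = us @ jump \<omega> b q' @ ws" using split[OF qs] by blast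
    have "probability ?us (\<lambda>u. germ_parity \<omega> [GX KC] (act \<omega> u ?o)) \<le> ?h / 8 ^ (b * q')"
      unfolding u pw[symmetric] by (rule probability_return_le) (use qs Q Kp in auto)
    also have "\<dots> \<le> ?h / real d" using B d by (intro divide_left_mono) auto
    also have "\<dots> \<le> ?h * (8 ^ (b * q) / real d)"
      using \<open>1 \<le> 8 ^ (b * q)\<close> d by (simp add: divide_right_mono)
    finally have 1: "probability ?us (\<lambda>u. germ_parity \<omega> [GX KC] (act \<omega> u ?o)) \<le> ?h * (8 ^ (b * q) / real d)" .
    have "?h / real d \<le> ?h" using d by (simp add: divide_le_eq_1 field_simps)
    with \<open>probability ?us _ \<le> ?h / 8 ^ (b * q')\<close> \<open>?h / 8 ^ (b * q') \<le> ?h / real d\<close> 1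
    show ?thesis by (simp add: min_def)
  qed
  have jmp: "risk \<omega> ?o (?us @ [[GX KC]]) (jump \<omega> b q) \<le> ?h * (2 + 3 * real b * real Q) * min 1 (8 ^ (b * q) / real d)"
  proof (cases "\<exists>p\<in>set (q0 # qs). q \<le> p")
    case True
    define p where "p = Max (set (q0 # qs))"
    have p: "p \<in> set (q0 # qs)" "\<And>r. r \<in> set (q0 # qs) \<Longrightarrow> r \<le> p" unfolding p_def by (simp_all del: set_simps add: Max_in)
    have qp: "q \<le> p" using True p(2) by fastforce
    have "q' \<le> p" using p(2) qs by blast
    then have "(8::real) ^ (b * q') \<le> 8 ^ (b * p)" by (intro power_increasing) auto
    then have dp: "real d < 8 ^ (b * p)" using B by linarith
    obtain us ws where u: "?us = us @ jump \<omega> b p @ ws" using split[OF p(1)] by blast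
    have "risk \<omega> ?o (us @ jump \<omega> b p @ (ws @ [[GX KC]])) (jump \<omega> b q)
       \<le> 2 ^ (3 * b * q + 1) * (1/2) ^ (3 * b * p + 4 * b)"
      by (rule risk_jump_after[OF _ qp]) (use p(1) Q Kp in auto)
    also have "\<dots> = ?h * 2 * (8 ^ (b * q) / 8 ^ (b * p))"
    proof -
      have "(2::real) ^ (3 * b * q + 1) = 2 * 8 ^ (b * q)"
        by (simp add: power_mult mult.assoc)
      then show ?thesis unfolding pw by simp
    qed
    finally have r: "risk \<omega> ?o (?us @ [[GX KC]]) (jump \<omega> b q) \<le> ?h * 2 * (8 ^ (b * q) / 8 ^ (b * p))"
      by (simp add: u)
    have "8 ^ (b * q) / 8 ^ (b * p) \<le> min 1 ((8::real) ^ (b * q) / real d)"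
    proof -
      have "(8::real) ^ (b * q) \<le> 8 ^ (b * p)" using qp by (intro power_increasing) auto
      moreover have "8 ^ (b * q) / 8 ^ (b * p) \<le> (8::real) ^ (b * q) / real d"
        using dp d by (intro divide_left_mono) auto
      ultimately show ?thesis by simp
    qed
    then have "?h * 2 * (8 ^ (b * q) / 8 ^ (b * p)) \<le> ?h * 2 * min 1 (8 ^ (b * q) / real d)"
      by (intro mult_left_mono) auto
    also have "\<dots> \<le> ?h * (2 + 3 * real b * real Q) * min 1 (8 ^ (b * q) / real d)"
      by (intro mult_right_mono mult_left_mono) (use min0 in auto)
    finally show ?thesis using r by linarith
  next
    case False
    then have "q' < q" using qs by force
    then have "(8::real) ^ (b * q') \<le> 8 ^ (b * q)" by (intro power_increasing) auto
    then have "real d \<le> 8 ^ (b * q)" using B by linarith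
    then have m: "min 1 ((8::real) ^ (b * q) / real d) = 1" using d by (simp add: le_divide_eq)
    have "risk \<omega> ?o (?us @ [[GX KC]]) (jump \<omega> b q) \<le> real (3 * b * q) * ?h"
      by (rule risk_jump_fresh) (use Q Kp in auto)
    also have "\<dots> \<le> (2 + 3 * real b * real Q) * ?h"
    proof (rule mult_right_mono)
      have "real b * real q \<le> real b * real Q" using Q by (intro mult_left_mono) auto
      then show "real (3 * b * q) \<le> 2 + 3 * real b * real Q" by simp
    qed simp
    finally show ?thesis by (simp add: m mult.commute)
  qed
  have "risk \<omega> ?o ?us (jump_step \<omega> b q) \<le>
     ?h * min 1 (8 ^ (b * q) / real d) + ?h * (2 + 3 * real b * real Q) * min 1 (8 ^ (b * q) / real d)"
    unfolding jump_step_def risk_Cons using ret jmp by linarith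
  also have "\<dots> = ?h * (3 + 3 * real b * real Q) * min 1 (8 ^ (b * q) / real d)"
    by (simp add: algebra_simps)
  finally show ?thesis .
qed

lemma risk_walk:
  "risk \<omega> x us (walk \<omega> b (map f [i..<i + n])) =
     (\<Sum>s\<in>{i..<i + n}. risk \<omega> x (us @ walk \<omega> b (map f [i..<s])) (jump_step \<omega> b (f s)))"
proof (induction n)
  case (Suc n)
  have "walk \<omega> b (map f [i..<i + Suc n]) = walk \<omega> b (map f [i..<i + n]) @ jump_step \<omega> b (f (i + n))"
    by (simp add: jump_step_def)
  then show ?case using Suc by (simp add: risk_append)
qed simp

text \<open>With \<open>Q\<close> fixed the bound is \<open>2 ^ (- b)\<close> times a polynomial in \<open>b\<close>: the sum over the steps costs a factor \<open>8 ^ b\<close>,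
  against the \<open>2 ^ (- 4 b)\<close> that come from the \<open>4 b\<close> high flips.\<close>

lemma walk_germ_probability_le:
  assumes b: "0 < b" and Q: "0 < Q" and K: "3 * b * (Q + 2) \<le> K" and i: "0 < i" "i \<le> N" and N: "N = 8 ^ (b * Q)"
  shows "probability (jump \<omega> b (jump_scale (8 ^ b) Q i) @ walk \<omega> b (map (jump_scale (8 ^ b) Q) [Suc i..<Suc N]))
       (\<lambda>w. germ_parity \<omega> w (replicate K True))
     \<le> (1/2) ^ (4 * b) * (3 * real b * real Q
          + (3 + 3 * real b * real Q) * (real Q * (1 + 8 ^ b * (1 + 3 * real b * real Q))))"
proof -
  let ?sc = "jump_scale (8 ^ b) Q" and ?o = "replicate K True"
  let ?h = "(1/2::real) ^ (4 * b)"
  let ?J = "jump \<omega> b (?sc i)"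
  have B2: "2 \<le> (8::nat) ^ b"
  proof -
    have "(8::nat) ^ 1 \<le> 8 ^ b" using b by (intro power_increasing) auto
    then show ?thesis by simp
  qed
  have sc: "?sc s \<le> Q" for s by (rule jump_scale_le[OF Q])
  have Kp: "3 * b * (p + 2) \<le> K" if "p \<le> Q" for p
    by (rule order_trans[OF mult_le_mono2 K]) (use that in simp)
  have "probability (?J @ walk \<omega> b (map ?sc [Suc i..<Suc N])) (\<lambda>w. germ_parity \<omega> w ?o)
      \<le> risk \<omega> ?o [] (?J @ walk \<omega> b (map ?sc [Suc i..<Suc N]))"
    by (rule probability_germ_parity_le_risk)
  also have "\<dots> = risk \<omega> ?o [] ?J + risk \<omega> ?o ?J (walk \<omega> b (map ?sc [Suc i..<Suc i + (N - i)]))"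
    using i by (simp add: risk_append)
  also have "risk \<omega> ?o ?J (walk \<omega> b (map ?sc [Suc i..<Suc i + (N - i)])) =
      (\<Sum>s\<in>{Suc i..<Suc i + (N - i)}. risk \<omega> ?o (?J @ walk \<omega> b (map ?sc [Suc i..<s])) (jump_step \<omega> b (?sc s)))"
    by (rule risk_walk)
  also have "{Suc i..<Suc i + (N - i)} = {i<..N}" using i by auto
  also have "(\<Sum>s\<in>{i<..N}. risk \<omega> ?o (?J @ walk \<omega> b (map ?sc [Suc i..<s])) (jump_step \<omega> b (?sc s)))
     \<le> (\<Sum>s\<in>{i<..N}. ?h * (3 + 3 * real b * real Q) * min 1 (real ((8 ^ b) ^ ?sc s) / real (s - i)))"
  proof (rule sum_mono)
    fix s assume "s \<in> {i<..N}"
    then have s: "i < s" "s \<le> N" by auto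
    have d: "0 < s - i" "s - i < (8 ^ b) ^ Q" using s i N by (auto simp: power_mult[symmetric])
    obtain s' where s': "i \<le> s'" "s' < i + (s - i)" "s - i < (8 ^ b) ^ ?sc s'"
      using exists_large_scale[OF B2 d i(1)] by blast
    have "risk \<omega> ?o (?J @ walk \<omega> b (map ?sc [Suc i..<s])) (jump_step \<omega> b (?sc s))
      \<le> ?h * (3 + 3 * real b * real Q) * min 1 (8 ^ (b * ?sc s) / real (s - i))"
    proof (rule risk_step_le[where q' = "?sc s'", OF _ _ d(1) _ K])
      show "?sc s' \<in> set (?sc i # map ?sc [Suc i..<s])"
        using s' s by (cases "s' = i") auto
      have "real (s - i) < real ((8 ^ b) ^ ?sc s')" using s'(3) by (simp only: of_nat_less_iff)
      then show "real (s - i) < 8 ^ (b * ?sc s')" by (simp add: power_mult)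
    qed (use sc in auto)
    then show "risk \<omega> ?o (?J @ walk \<omega> b (map ?sc [Suc i..<s])) (jump_step \<omega> b (?sc s))
      \<le> ?h * (3 + 3 * real b * real Q) * min 1 (real ((8 ^ b) ^ ?sc s) / real (s - i))"
      by (simp add: power_mult)
  qed
  also have "\<dots> = ?h * (3 + 3 * real b * real Q) * (\<Sum>s\<in>{i<..N}. min 1 (real ((8 ^ b) ^ ?sc s) / real (s - i)))"
    by (simp only: sum_distrib_left)
  also have "\<dots> \<le> ?h * (3 + 3 * real b * real Q) * (real Q * (1 + real (8 ^ b) * (1 + real (3 * b * Q))))"
  proof (intro mult_left_mono sum_scale_le[OF B2 Q])
    have "(2::nat) ^ (3 * b * Q) = 8 ^ (b * Q)" by (simp add: power_mult mult.assoc)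
    then show "N \<le> 2 ^ (3 * b * Q)" using N by simp
  qed auto
  also have "risk \<omega> ?o [] ?J \<le> real (3 * b * ?sc i) * ?h"
    by (rule risk_jump_fresh) (use sc Kp in auto)
  also have "\<dots> \<le> 3 * real b * real Q * ?h"
  proof (rule mult_right_mono)
    have "real b * real (?sc i) \<le> real b * real Q" using sc by (intro mult_left_mono) auto
    then show "real (3 * b * ?sc i) \<le> 3 * real b * real Q" by simp
  qed simp
  finally show ?thesis by (simp add: algebra_simps)
qed

text \<open>Every one of the \<open>8 ^ (b Q)\<close> letters \<open>c\<close> adds a fixed amount of entropy.\<close>

lemma entropy_walk_ge:
  assumes b: "0 < b" and Q: "0 < Q"
    and small: "(1/2) ^ (4 * b) * (3 * real b * real Q
          + (3 + 3 * real b * real Q) * (real Q * (1 + 8 ^ b * (1 + 3 * real b * real Q)))) \<le> 1/4"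
  shows "bit_gain * 8 ^ (b * Q) \<le> entropy (law \<omega> (walk \<omega> b (map (jump_scale (8 ^ b) Q) [1..<Suc (8 ^ (b * Q))])))"
proof -
  define N :: nat where "N = 8 ^ (b * Q)"
  let ?qs = "map (jump_scale (8 ^ b) Q) [1..<Suc N]"
  let ?W = "walk \<omega> b ?qs"
  define K where "K = 2 * sum_list (map length ?W) + 3 * b * (Q + 2)"
  have "bit_gain * count_list ?W [GX KC] \<le> entropy (law \<omega> ?W)"
  proof (rule entropy_law_ge[OF frequent_two, of _ K])
    show "2 * sum_list (map length ?W) \<le> K" by (simp add: K_def)
    fix us ws assume "?W = us @ [GX KC] # ws"
    then obtain ps q rs where qs: "?qs = ps @ q # rs" and ws: "ws = jump \<omega> b q @ walk \<omega> b rs"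
      by (rule walk_split)
    define i where "i = Suc (length ps)"
    have "length ?qs = length ps + Suc (length rs)" using arg_cong[OF qs, of length] by simp
    then have i: "0 < i" "i \<le> N" by (auto simp: i_def simp del: upt_Suc)
    have "q = ?qs ! length ps" unfolding qs by simp
    then have q: "q = jump_scale (8 ^ b) Q i" using i by (simp add: i_def del: upt_Suc)
    have "rs = drop i ?qs" unfolding qs by (simp add: i_def)
    then have rs: "rs = map (jump_scale (8 ^ b) Q) [Suc i..<Suc N]"
      by (simp add: drop_map drop_upt add.commute del: upt_Suc)
    show "probability ws (\<lambda>w. germ_parity \<omega> w (replicate K True)) \<le> 1/4"
      unfolding ws q rs
      by (rule order_trans[OF walk_germ_probability_le[OF b Q _ i N_def] small]) (simp add: K_def)
  qed
  moreover have "N \<le> count_list ?W [GX KC]" using count_walk[of ?qs \<omega> b] by (simp del: upt_Suc)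
  then have "bit_gain * real N \<le> bit_gain * count_list ?W [GX KC]"
    using bit_gain_pos by (intro mult_left_mono) auto
  ultimately show ?thesis by (simp add: N_def)
qed

end

section \<open>Lengths of the flipping words and of the walk\<close>

lemma length_eq_counts:
  "KId \<notin> set w \<Longrightarrow> length w = count_list w KB + count_list w KC + count_list w KD"
proof (induction w)
  case (Cons x w)
  then show ?case by (cases x) auto
qed simp

lemma length_subs_le: "length (subs l w) \<le> 3 * length w"
proof (induction w)
  case (Cons x w)
  then show ?case by (cases l) auto
qed simp

lemma length_lift_le: "length (lift \<omega> m w) \<le> 3 ^ m * length w"
proof (induction m arbitrary: \<omega>)
  case (Suc m)
  have "length (lift \<omega> (Suc m) w) \<le> 3 * length (lift (stl \<omega>) m w)" by (simp add: length_subs_le)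
  also have "\<dots> \<le> 3 * (3 ^ m * length w)" using Suc by (intro mult_left_mono) auto
  finally show ?case by simp
qed simp

lemma length_word_of: "length (word_of w) = 2 * length w"
  by (induction w) auto

lemma lift_block:
  "lift (block_stream t k) (3 + m) w =
    subs L2 (subs (if t k then L0 else L1) (subs L1 (lift (block_stream t (Suc k)) m w)))"
  by (subst block_stream_unfold) (simp add: numeral_3_eq_3)

definition subs_block :: "bool \<Rightarrow> klein list \<Rightarrow> klein list" where
  "subs_block u w = subs L2 (subs (if u then L0 else L1) (subs L1 w))"

lemma subs_block_True:
  assumes "KId \<notin> set w"
  shows "count_list (subs_block True w) KB = 4 * count_list w KB + 3 * count_list w KC + 2 * count_list w KD"
    "count_list (subs_block True w) KD = 4 * count_list w KB + 5 * count_list w KC + 6 * count_list w KD"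
    "count_list (subs_block True w) KC = 4 * count_list w KB + 9 * count_list w KC + 6 * count_list w KD"
  using assms by (simp_all add: subs_block_def count_subs KId_notin_subs)

lemma subs_block_False:
  assumes "KId \<notin> set w"
  shows "count_list (subs_block False w) KB = 4 * count_list w KB + 3 * count_list w KC"
    "count_list (subs_block False w) KC = 4 * count_list w KB + 5 * count_list w KC"
    "count_list (subs_block False w) KD = 4 * count_list w KB + 9 * count_list w KC + 8 * count_list w KD"
  using assms by (simp_all add: subs_block_def count_subs KId_notin_subs)

lemma KId_notin_subs_block: "KId \<notin> set w \<Longrightarrow> KId \<notin> set (subs_block u w)"
  by (simp add: subs_block_def KId_notin_subs)

context eta_root
begin

text \<open>The weights of the upper bound are also a left eigenvector of the substitution of a block 201 on letter counts, so the
  lengths grow by exactly the factor by which the weights contract.\<close>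

definition eta_weight :: "klein list \<Rightarrow> real" where
  "eta_weight w = \<eta>\<^sup>2 * count_list w KB + \<eta> * count_list w KD + count_list w KC"

lemma eta_weight_block:
  assumes "KId \<notin> set w"
  shows "eta_weight (subs_block True w) = 8 / \<eta> ^ 3 * eta_weight w"
proof -
  have e: "\<eta> \<noteq> 0" using eta_bounds by simp
  define x y z where "x = real (count_list w KB)" and "y = real (count_list w KD)" and "z = real (count_list w KC)"
  have c: "\<eta> ^ 3 = 2 - \<eta> - \<eta>\<^sup>2" by (rule eta_cube)
  have "\<eta> ^ 3 * (\<eta>\<^sup>2 * (4 * x + 3 * z + 2 * y) + \<eta> * (4 * x + 5 * z + 6 * y) + (4 * x + 9 * z + 6 * y))
      = 8 * (\<eta>\<^sup>2 * x + \<eta> * y + z)"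
    using c by algebra
  then have "\<eta>\<^sup>2 * (4 * x + 3 * z + 2 * y) + \<eta> * (4 * x + 5 * z + 6 * y) + (4 * x + 9 * z + 6 * y)
      = 8 / \<eta> ^ 3 * (\<eta>\<^sup>2 * x + \<eta> * y + z)"
    using e by (simp add: field_simps)
  then show ?thesis
    using assms by (simp add: eta_weight_def subs_block_True x_def y_def z_def)
qed

lemma eta_weight_length:
  assumes "KId \<notin> set w"
  shows "length w \<le> 2 * eta_weight w" "eta_weight w \<le> length w"
proof -
  have s: "1/2 \<le> \<eta>\<^sup>2"
  proof -
    have "(4/5)\<^sup>2 \<le> \<eta>\<^sup>2" using eta_bounds by (intro power_mono) auto
    then show ?thesis by (simp add: power_divide)
  qed
  have "1/2 * real (count_list w KB) \<le> \<eta>\<^sup>2 * count_list w KB" "1/2 * real (count_list w KD) \<le> \<eta> * count_list w KD"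
    using s eta_bounds by (intro mult_right_mono; simp)+
  then show "length w \<le> 2 * eta_weight w"
    using length_eq_counts[OF assms] by (simp add: eta_weight_def)
  have "\<eta>\<^sup>2 * count_list w KB \<le> 1 * real (count_list w KB)" "\<eta> * count_list w KD \<le> 1 * real (count_list w KD)"
    using eta_sq eta_bounds by (intro mult_right_mono; simp)+
  then show "eta_weight w \<le> length w"
    using length_eq_counts[OF assms] by (simp add: eta_weight_def)
qed

definition ratio :: "bool \<Rightarrow> real" where "ratio u = 8 / rho u"

lemma ratio_bounds: "8 \<le> ratio u" "ratio u \<le> 16"
  using rho_bounds[of u] by (auto simp: ratio_def field_simps)

text \<open>A block 211 has the eigenvalue 8 on the letter counts, but in a Jordan block; this is the factor linear in \<open>n\<close>. Changing to
  and from the weights costs the factor 2. These losses occur once per run of equal blocks.\<close>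

lemma length_block_power:
  assumes "KId \<notin> set w"
  shows "real (length ((subs_block u ^^ n) w)) \<le> 2 * (1 + 2 * n) * ratio u ^ n * length w"
proof (cases u)
  case True
  have n: "KId \<notin> set ((subs_block True ^^ n) w)" for n
    by (induction n) (auto simp: assms KId_notin_subs_block)
  have "eta_weight ((subs_block True ^^ n) w) = ratio True ^ n * eta_weight w"
    by (induction n) (simp_all add: eta_weight_block[OF n] ratio_def rho_def)
  then have "real (length ((subs_block True ^^ n) w)) \<le> 2 * (ratio True ^ n * eta_weight w)"
    using eta_weight_length(1)[OF n[of n]] by simp
  also have "\<dots> \<le> 2 * (ratio True ^ n * length w)"
    using eta_weight_length(2)[OF assms] ratio_bounds[of True] by (intro mult_left_mono) auto
  also have "\<dots> \<le> (1 + 2 * real n) * (2 * (ratio True ^ n * length w))"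
  proof -
    have "0 \<le> 2 * (ratio True ^ n * length w)" using ratio_bounds[of True] by simp
    then have "1 * (2 * (ratio True ^ n * length w)) \<le> (1 + 2 * real n) * (2 * (ratio True ^ n * length w))"
      by (intro mult_right_mono) auto
    then show ?thesis by simp
  qed
  finally show ?thesis using True by (simp add: algebra_simps)
next
  case False
  have n: "KId \<notin> set ((subs_block False ^^ n) w)" for n
    by (induction n) (auto simp: assms KId_notin_subs_block)
  let ?c = "\<lambda>n x. real (count_list ((subs_block False ^^ n) w) x)"
  have bc: "?c n KB + ?c n KC = 8 ^ n * (?c 0 KB + ?c 0 KC)" for n
    by (induction n) (simp_all add: subs_block_False[OF n])
  have d: "?c n KD \<le> 8 ^ n * (?c 0 KD + 2 * real n * (?c 0 KB + ?c 0 KC))" for n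
  proof (induction n)
    case (Suc n)
    have "?c (Suc n) KD \<le> 8 * ?c n KD + 9 * (?c n KB + ?c n KC)"
      by (simp add: subs_block_False[OF n])
    also have "\<dots> \<le> 8 * (8 ^ n * (?c 0 KD + 2 * real n * (?c 0 KB + ?c 0 KC))) + 16 * (8 ^ n * (?c 0 KB + ?c 0 KC))"
      using Suc bc[of n] by (intro add_mono mult_left_mono) auto
    also have "\<dots> = 8 ^ Suc n * (?c 0 KD + 2 * real (Suc n) * (?c 0 KB + ?c 0 KC))"
      by (simp add: algebra_simps)
    finally show ?case .
  qed simp
  have "real (length ((subs_block False ^^ n) w)) = (?c n KB + ?c n KC) + ?c n KD"
    using length_eq_counts[OF n[of n]] by simp
  also have "\<dots> \<le> 8 ^ n * (?c 0 KB + ?c 0 KC) + 8 ^ n * (?c 0 KD + 2 * real n * (?c 0 KB + ?c 0 KC))"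
    using bc[of n] d[of n] by simp
  also have "\<dots> \<le> 8 ^ n * ((1 + 2 * real n) * length w)"
  proof -
    have "(1 + 2 * real n) * length w = (1 + 2 * real n) * (?c 0 KB + ?c 0 KC) + (1 + 2 * real n) * ?c 0 KD"
      using length_eq_counts[OF assms] by (simp add: algebra_simps)
    moreover have "?c 0 KD \<le> (1 + 2 * real n) * ?c 0 KD" by (simp add: algebra_simps)
    ultimately have "(?c 0 KB + ?c 0 KC) + (?c 0 KD + 2 * real n * (?c 0 KB + ?c 0 KC)) \<le> (1 + 2 * real n) * length w"
      by (simp add: algebra_simps)
    then show ?thesis by (simp only: distrib_left[symmetric]) (rule mult_left_mono, auto)
  qed
  also have "\<dots> \<le> 2 * (8 ^ n * ((1 + 2 * real n) * length w))" by simp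
  finally show ?thesis using False by (simp add: ratio_def rho_def algebra_simps)
qed

lemma lift_blocks:
  assumes "\<And>i. k \<le> i \<Longrightarrow> i < k + n \<Longrightarrow> t i = u"
  shows "lift (block_stream t k) (3 * n + m) w = (subs_block u ^^ n) (lift (block_stream t (k + n)) m w)"
  using assms
proof (induction n arbitrary: k)
  case (Suc n)
  have "lift (block_stream t k) (3 * Suc n + m) w = subs_block u (lift (block_stream t (Suc k)) (3 * n + m) w)"
    using lift_block[of t k "3 * n + m" w] Suc.prems[of k] by (simp add: subs_block_def add.assoc)
  also have "lift (block_stream t (Suc k)) (3 * n + m) w = (subs_block u ^^ n) (lift (block_stream t (Suc k + n)) m w)"
    by (rule Suc.IH) (use Suc.prems in auto)
  finally show ?case by simp
qed simp

text \<open>The radius at which the logarithm of the ball size is about \<open>8 ^ k\<close>.\<close>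

definition len_scale :: "(nat \<Rightarrow> bool) \<Rightarrow> nat \<Rightarrow> real" where
  "len_scale t k = (\<Prod>i<k. ratio (t i))"

lemma len_scale_simps [simp]: "len_scale t 0 = 1" "len_scale t (Suc k) = len_scale t k * ratio (t k)"
  by (simp_all add: len_scale_def)

lemma len_scale_grow: "8 ^ n * len_scale t k \<le> len_scale t (k + n)" "len_scale t (k + n) \<le> 16 ^ n * len_scale t k"
  "1 \<le> len_scale t k"
proof -
  show one: "1 \<le> len_scale t k" for k
  proof (induction k)
    case (Suc k)
    then have "1 * 1 \<le> len_scale t k * ratio (t k)" using ratio_bounds[of "t k"] by (intro mult_mono) auto
    then show ?case by simp
  qed simp
  show "8 ^ n * len_scale t k \<le> len_scale t (k + n)"
  proof (induction n)
    case (Suc n)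
    have "8 ^ n * len_scale t k * 8 \<le> len_scale t (k + n) * ratio (t (k + n))"
      using Suc ratio_bounds[of "t (k + n)"] one[of k] order_trans[OF zero_le_one one[of "k + n"]]
      by (intro mult_mono) auto
    then show ?case by simp
  qed simp
  show "len_scale t (k + n) \<le> 16 ^ n * len_scale t k"
  proof (induction n)
    case (Suc n)
    have "len_scale t (k + n) * ratio (t (k + n)) \<le> 16 ^ n * len_scale t k * 16"
      using Suc ratio_bounds[of "t (k + n)"] one[of k] by (intro mult_mono) auto
    then show ?case by simp
  qed simp
qed

lemma len_scale_mono: "j \<le> k \<Longrightarrow> len_scale t j \<le> len_scale t k"
proof -
  assume "j \<le> k"
  then obtain n where k: "k = j + n" using le_Suc_ex by blast
  have "1 * len_scale t j \<le> 8 ^ n * len_scale t j"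
    using len_scale_grow(3)[of t j] by (intro mult_right_mono one_le_power) auto
  then show ?thesis using len_scale_grow(1)[of n t j] k by simp
qed

lemma len_scale_const:
  assumes "\<And>i. k \<le> i \<Longrightarrow> i < k + n \<Longrightarrow> t i = u"
  shows "len_scale t (k + n) = len_scale t k * ratio u ^ n"
  using assms by (induction n) auto

text \<open>The type may change only at squares, so that the first \<open>k\<close> blocks consist of \<open>O (sqrt k)\<close> runs and the losses of all runs
  together are subexponential in \<open>k\<close>.\<close>

definition slow :: "(nat \<Rightarrow> bool) \<Rightarrow> bool" where
  "slow t \<longleftrightarrow> (\<forall>i. t i = t ((floor_sqrt i)\<^sup>2))"

lemma slow_const:
  assumes "slow t" "p\<^sup>2 \<le> i" "i < (Suc p)\<^sup>2"
  shows "t i = t (p\<^sup>2)"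
  using assms(1) floor_sqrt_unique[OF assms(2,3)] unfolding slow_def by metis

text \<open>The run of blocks that begins at \<open>P\<^sup>2\<close> has at most \<open>2 P + 1\<close> blocks and costs at most the factor
  \<open>2 * (1 + 2 * (2 P + 1)) = 8 P + 6\<close>.\<close>

lemma length_lift_slow:
  assumes t: "slow t" and w: "KId \<notin> set w" and K: "K \<le> P\<^sup>2"
  shows "real (length (lift (block_stream t 0) (3 * K + m) w))
     \<le> (8 * real P + 6) ^ P * len_scale t K * length (lift (block_stream t K) m w)"
  using K
proof (induction P arbitrary: K m)
  case 0
  then show ?case by simp
next
  case (Suc P)
  let ?len = "\<lambda>k m. real (length (lift (block_stream t k) m w))"
  show ?case
  proof (cases "K \<le> P\<^sup>2")
    case True
    have "?len 0 (3 * K + m) \<le> (8 * real P + 6) ^ P * len_scale t K * ?len K m"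
      by (rule Suc.IH[OF True])
    also have "\<dots> \<le> (8 * real (Suc P) + 6) ^ Suc P * len_scale t K * ?len K m"
    proof (intro mult_right_mono)
      have "(8 * real P + 6) ^ P \<le> (8 * real (Suc P) + 6) ^ P" by (intro power_mono) auto
      also have "\<dots> \<le> (8 * real (Suc P) + 6) ^ Suc P" by (intro power_increasing) auto
      finally show "(8 * real P + 6) ^ P \<le> (8 * real (Suc P) + 6) ^ Suc P" .
    qed (use len_scale_grow(3)[of t K] in auto)
    finally show ?thesis .
  next
    case False
    define n where "n = K - P\<^sup>2"
    have n: "K = P\<^sup>2 + n" "n \<le> 2 * P + 1" using False Suc.prems by (auto simp: n_def power2_eq_square)
    have const: "t i = t (P\<^sup>2)" if "P\<^sup>2 \<le> i" "i < P\<^sup>2 + n" for i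
      by (rule slow_const[OF t that(1)]) (use that Suc.prems n in auto)
    let ?u = "t (P\<^sup>2)"
    have k: "KId \<notin> set (lift (block_stream t K) m w)" by (rule KId_notin_lift[OF w])
    have "?len 0 (3 * K + m) = ?len 0 (3 * P\<^sup>2 + (3 * n + m))" by (simp add: n algebra_simps)
    also have "\<dots> \<le> (8 * real P + 6) ^ P * len_scale t (P\<^sup>2) * ?len (P\<^sup>2) (3 * n + m)"
      by (rule Suc.IH) simp
    also have "?len (P\<^sup>2) (3 * n + m) = real (length ((subs_block ?u ^^ n) (lift (block_stream t K) m w)))"
      using lift_blocks[OF const] n by simp
    also have "(8 * real P + 6) ^ P * len_scale t (P\<^sup>2) * \<dots> \<le>
        (8 * real P + 6) ^ P * len_scale t (P\<^sup>2) * (2 * (1 + 2 * n) * ratio ?u ^ n * ?len K m)"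
      using length_block_power[OF k] len_scale_grow(3)[of t "P\<^sup>2"] by (intro mult_left_mono) auto
    also have "\<dots> = ((8 * real P + 6) ^ P * (2 * (1 + 2 * n))) * (len_scale t (P\<^sup>2) * ratio ?u ^ n) * ?len K m"
      by (simp add: mult_ac)
    also have "len_scale t (P\<^sup>2) * ratio ?u ^ n = len_scale t K"
      using len_scale_const[OF const] n by simp
    also have "((8 * real P + 6) ^ P * (2 * (1 + 2 * n))) * len_scale t K * ?len K m
       \<le> (8 * real (Suc P) + 6) ^ Suc P * len_scale t K * ?len K m"
    proof (intro mult_right_mono)
      have "(8 * real P + 6) ^ P \<le> (8 * real (Suc P) + 6) ^ P" by (intro power_mono) auto
      moreover have "2 * (1 + 2 * real n) \<le> 8 * real (Suc P) + 6" using n(2) by simp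
      ultimately have "(8 * real P + 6) ^ P * (2 * (1 + 2 * real n)) \<le> (8 * real (Suc P) + 6) ^ P * (8 * real (Suc P) + 6)"
        by (intro mult_mono) auto
      then show "(8 * real P + 6) ^ P * real (2 * (1 + 2 * n)) \<le> (8 * real (Suc P) + 6) ^ Suc P" by (simp add: mult.commute)
    qed (use len_scale_grow(3)[of t K] in auto)
    finally show ?thesis .
  qed
qed

text \<open>The factor 18 is 2 for the letters \<open>a\<close> and 9 for the at most two levels of an incomplete block.\<close>

lemma length_flip_le:
  assumes t: "slow t" and m: "m < 3 * J" and J: "J \<le> P\<^sup>2"
  shows "real (length (flip (block_stream t 0) m)) \<le> 18 * (8 * real P + 6) ^ P * len_scale t J"
proof -
  obtain y where y: "flip_word (block_stream t 0) m = lift (block_stream t 0) m [y]" "y \<noteq> KId"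
    unfolding flip_word_def by (metis klein.distinct(1,3))
  define K where "K = m div 3"
  have K: "m = 3 * K + m mod 3" "K \<le> J" using m by (auto simp: K_def)
  have K': "KId \<notin> set [y]" using y(2) by simp
  have "real (length (flip_word (block_stream t 0) m)) \<le>
     (8 * real P + 6) ^ P * len_scale t K * length (lift (block_stream t K) (m mod 3) [y])"
    using length_lift_slow[OF t K', of K P "m mod 3"] K y J by simp
  also have "\<dots> \<le> (8 * real P + 6) ^ P * len_scale t J * 9"
  proof (rule mult_mono)
    show "(8 * real P + 6) ^ P * len_scale t K \<le> (8 * real P + 6) ^ P * len_scale t J"
      using len_scale_mono[OF K(2)] by (intro mult_left_mono) auto
    have "length (lift (block_stream t K) (m mod 3) [y]) \<le> 3 ^ (m mod 3)"
      using length_lift_le[of "block_stream t K" "m mod 3" "[y]"] by simp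
    also have "\<dots> \<le> (3::nat) ^ 2" by (intro power_increasing) auto
    finally show "real (length (lift (block_stream t K) (m mod 3) [y])) \<le> 9" by simp
  qed (use len_scale_grow(3)[of t J] in auto)
  finally show ?thesis by (simp add: length_word_of mult_ac)
qed

lemma length_jump_le:
  assumes t: "slow t" and J: "b * (q + 2) \<le> P\<^sup>2"
  shows "real (sum_list (map length (jump (block_stream t 0) b q)))
     \<le> real (3 * b * (q + 2)) * (18 * (8 * real P + 6) ^ P * len_scale t (b * (q + 2)))"
proof -
  let ?ls = "high_levels b q @ [0..<3 * b * q]"
  let ?E = "18 * (8 * real P + 6) ^ P * len_scale t (b * (q + 2))"
  have E: "0 \<le> ?E" using len_scale_grow(3)[of t "b * (q + 2)"] by simp
  have le: "3 * b * q \<le> 3 * b * (q + 2)" by (intro mult_le_mono2) simp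
  have l: "real (length (flip (block_stream t 0) l)) \<le> ?E" if "l \<in> set ?ls" for l
  proof (rule length_flip_le[OF t _ J])
    show "l < 3 * (b * (q + 2))" using that set_high_levels[of l b q] le by (auto simp: mult.assoc)
  qed
  have s: "real (sum_list (map length (map (flip (block_stream t 0)) ls))) \<le> real (length ls) * ?E"
    if "\<And>l. l \<in> set ls \<Longrightarrow> real (length (flip (block_stream t 0) l)) \<le> ?E" for ls
    using that
  proof (induction ls)
    case (Cons l ls)
    then have "real (length (flip (block_stream t 0) l)) \<le> ?E"
      "real (sum_list (map length (map (flip (block_stream t 0)) ls))) \<le> real (length ls) * ?E" by auto
    then show ?case by (simp add: algebra_simps)
  qed simp
  have "real (sum_list (map length (jump (block_stream t 0) b q))) \<le> real (length ?ls) * ?E"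
    unfolding jump_def by (rule s) (rule l)
  also have "\<dots> \<le> real (3 * b * (q + 2)) * ?E"
  proof (rule mult_right_mono[OF _ E])
    have "length (high_levels b q) \<le> 6 * b"
      using length_high_levels[of b q] by simp
    then have "length ?ls \<le> 3 * b * (q + 2)" by (simp add: algebra_simps)
    then show "real (length ?ls) \<le> real (3 * b * (q + 2))" by (rule of_nat_mono)
  qed
  finally show ?thesis .
qed

lemma card_multiples:
  assumes "(0::nat) < m"
  shows "card {s \<in> {1..<Suc (m * c)}. m dvd s} = c"
proof -
  have "{s \<in> {1..<Suc (m * c)}. m dvd s} = (\<lambda>k. m * k) ` {1..c}"
    using assms by (auto elim!: dvdE simp: less_Suc_eq_le intro!: imageI)
  moreover have "inj_on (\<lambda>k. m * k) {1..c}" using assms by (auto simp: inj_on_def)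
  ultimately show ?thesis by (simp add: card_image)
qed

text \<open>A jump of scale \<open>q\<close> is made in \<open>8 ^ (b (Q - q + 1))\<close> steps, and the length scale grows by at least \<open>8\<close> per block: all scales
  together cost not much more than the largest one.\<close>

lemma sum_len_scale_le:
  assumes Q: "0 < Q"
  shows "(\<Sum>s\<in>{1..<Suc (8 ^ (b * Q))}. len_scale t (b * (jump_scale (8 ^ b) Q s + 2)))
     \<le> real Q * 8 ^ b * len_scale t (b * (Q + 2))"
proof -
  let ?N = "8 ^ (b * Q) :: nat" and ?L = "\<lambda>q. len_scale t (b * (q + 2))"
  have L0: "0 \<le> ?L q" for q using len_scale_grow(3)[of t "b * (q + 2)"] by simp
  have "(\<Sum>s\<in>{1..<Suc ?N}. ?L (jump_scale (8 ^ b) Q s)) \<le>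
     (\<Sum>q\<in>{1..Q}. \<Sum>s\<in>{1..<Suc ?N}. of_bool ((8 ^ b) ^ (q - 1) dvd s) * ?L q)"
    by (rule sum_over_scales_le[OF Q]) (rule L0)
  also have "\<dots> \<le> (\<Sum>q\<in>{1..Q}. 8 ^ b * len_scale t (b * (Q + 2)))"
  proof (rule sum_mono)
    fix q assume q: "q \<in> {1..Q}"
    define m where "m = ((8::nat) ^ b) ^ (q - 1)"
    define c where "c = (8::nat) ^ (b * (Q - q) + b)"
    have N: "?N = m * c"
    proof -
      have "b * Q = b * (q - 1) + (b * (Q - q) + b)"
      proof -
        have "Q = (q - 1) + ((Q - q) + 1)" using q by auto
        then have "b * Q = b * ((q - 1) + ((Q - q) + 1))" by simp
        then show ?thesis by (simp only: distrib_left mult_1_right)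
      qed
      then show ?thesis by (simp only: m_def c_def power_add power_mult)
    qed
    have "(\<Sum>s\<in>{1..<Suc ?N}. of_bool ((8 ^ b) ^ (q - 1) dvd s) * ?L q)
       = real (card {s \<in> {1..<Suc ?N}. m dvd s}) * ?L q"
    proof -
      have "(\<Sum>s\<in>{1..<Suc ?N}. of_bool (m dvd s) * ?L q) = (\<Sum>s | s \<in> {1..<Suc ?N} \<and> m dvd s. ?L q)"
        unfolding sum.inter_filter[OF finite_atLeastLessThan] by (intro sum.cong) auto
      then show ?thesis by (simp add: m_def)
    qed
    also have "\<dots> = 8 ^ b * (8 ^ (b * (Q - q)) * ?L q)"
      unfolding N by (subst card_multiples) (simp_all add: m_def c_def power_add)
    also have "\<dots> \<le> 8 ^ b * len_scale t (b * (Q + 2))"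
    proof (rule mult_left_mono)
      have "b * (Q + 2) = b * (q + 2) + b * (Q - q)"
      proof -
        have "Q + 2 = (q + 2) + (Q - q)" using q by auto
        then show ?thesis by (simp only: distrib_left)
      qed
      then show "8 ^ (b * (Q - q)) * ?L q \<le> len_scale t (b * (Q + 2))"
        using len_scale_grow(1)[of "b * (Q - q)" t "b * (q + 2)"] by (simp only:)
    qed simp
    finally show "(\<Sum>s\<in>{1..<Suc ?N}. of_bool ((8 ^ b) ^ (q - 1) dvd s) * ?L q)
      \<le> 8 ^ b * len_scale t (b * (Q + 2))" .
  qed
  also have "\<dots> = real Q * 8 ^ b * len_scale t (b * (Q + 2))" by simp
  finally show ?thesis .
qed

lemma length_walk_le:
  assumes t: "slow t" and Q: "0 < Q" and P: "b * (Q + 2) \<le> P\<^sup>2"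
  shows "real (sum_list (map length (walk (block_stream t 0) b (map (jump_scale (8 ^ b) Q) [1..<Suc (8 ^ (b * Q))]))))
     \<le> (1 + real (3 * b * (Q + 2))) * (18 * (8 * real P + 6) ^ P) * (real Q * 8 ^ b * len_scale t (b * (Q + 2)))"
proof -
  let ?\<omega> = "block_stream t 0" and ?sc = "jump_scale (8 ^ b) Q"
  let ?C = "(1 + real (3 * b * (Q + 2))) * (18 * (8 * real P + 6) ^ P)"
  have walk: "real (sum_list (map length (walk ?\<omega> b (map f ss))))
     = (\<Sum>s\<leftarrow>ss. 1 + real (sum_list (map length (jump ?\<omega> b (f s)))))" for f and ss :: "nat list"
    by (induction ss) auto
  have step: "1 + real (sum_list (map length (jump ?\<omega> b (?sc s)))) \<le> ?C * len_scale t (b * (?sc s + 2))" for s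
  proof -
    let ?q = "?sc s"
    have q: "?q \<le> Q" by (rule jump_scale_le[OF Q])
    have "b * (?q + 2) \<le> b * (Q + 2)" using q by (intro mult_le_mono2) simp
    then have J: "b * (?q + 2) \<le> P\<^sup>2" using P by linarith
    let ?E = "18 * (8 * real P + 6) ^ P * len_scale t (b * (?q + 2))"
    have E: "1 \<le> ?E"
    proof -
      have "1 \<le> (8 * real P + 6) ^ P" by (rule one_le_power) simp
      then have "1 \<le> 18 * (8 * real P + 6) ^ P" by linarith
      then have "1 * 1 \<le> (18 * (8 * real P + 6) ^ P) * len_scale t (b * (?q + 2))"
        using len_scale_grow(3)[of t "b * (?q + 2)"] by (intro mult_mono) auto
      then show ?thesis by simp
    qed
    have "1 + real (sum_list (map length (jump ?\<omega> b ?q))) \<le> ?E + real (3 * b * (?q + 2)) * ?E"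
      using length_jump_le[OF t J] E by linarith
    also have "\<dots> = (1 + real (3 * b * (?q + 2))) * ?E" by (simp add: algebra_simps)
    also have "\<dots> \<le> (1 + real (3 * b * (Q + 2))) * ?E"
    proof (rule mult_right_mono)
      have "3 * b * (?q + 2) \<le> 3 * b * (Q + 2)" using q by (intro mult_le_mono2) simp
      then show "1 + real (3 * b * (?q + 2)) \<le> 1 + real (3 * b * (Q + 2))"
        using of_nat_mono by (metis add_left_mono)
    qed (use E in linarith)
    finally show ?thesis by (simp only: mult.assoc)
  qed
  have "real (sum_list (map length (walk ?\<omega> b (map ?sc [1..<Suc (8 ^ (b * Q))]))))
     = (\<Sum>s\<in>{1..<Suc (8 ^ (b * Q))}. 1 + real (sum_list (map length (jump ?\<omega> b (?sc s)))))"
    unfolding walk by (simp add: interv_sum_list_conv_sum_set_nat del: upt_Suc)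
  also have "\<dots> \<le> (\<Sum>s\<in>{1..<Suc (8 ^ (b * Q))}. ?C * len_scale t (b * (?sc s + 2)))"
    by (rule sum_mono) (rule step)
  also have "\<dots> = ?C * (\<Sum>s\<in>{1..<Suc (8 ^ (b * Q))}. len_scale t (b * (?sc s + 2)))"
    by (simp only: sum_distrib_left)
  also have "\<dots> \<le> ?C * (real Q * 8 ^ b * len_scale t (b * (Q + 2)))"
    by (intro mult_left_mono sum_len_scale_le[OF Q]) auto
  finally show ?thesis .
qed

end

section \<open>The lower bound at the length scales\<close>

lemma card_subproducts_le_volume:
  assumes "\<And>w. w \<in> subproducts vs \<Longrightarrow> w \<in> proper_words \<and> length w \<le> n"
  shows "card (act \<omega> ` subproducts vs) \<le> ball_card \<omega> n"
  unfolding volume_growth_eq using assms finite_short_words[of n]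
  by (intro card_mono) auto

lemma KId_notin_flip: "GX KId \<notin> set (flip \<omega> m)"
proof -
  have "GX KId \<notin> set (word_of w)" if "KId \<notin> set w" for w
    using that by (induction w) auto
  moreover have "KId \<notin> set (flip_word \<omega> m)"
    unfolding flip_word_def by (rule KId_notin_lift) auto
  ultimately show ?thesis by blast
qed

lemma walk_proper: "w \<in> subproducts (walk \<omega> b qs) \<Longrightarrow> w \<in> proper_words"
proof -
  assume w: "w \<in> subproducts (walk \<omega> b qs)"
  have "GX KId \<notin> set v" if "v \<in> set (walk \<omega> b qs)" for v
    using that KId_notin_flip by (induction qs) (auto simp: jump_def)
  then show ?thesis using set_subproducts[OF w] by (auto simp: proper_words_def)
qed

lemma exp_entropy_le_volume:
  assumes "sum_list (map length (walk \<omega> b qs)) \<le> n" and "h \<le> entropy (law \<omega> (walk \<omega> b qs))"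
  shows "exp h \<le> ball_card \<omega> n"
proof -
  let ?W = "walk \<omega> b qs"
  let ?c = "card (act \<omega> ` subproducts ?W)"
  have ne: "subproducts vs \<noteq> {}" for vs :: "gen list list" by (induction vs) auto
  then have c: "0 < real ?c" by (simp add: card_gt_0_iff)
  have "exp h \<le> exp (ln (real ?c))"
    using assms(2) entropy_le_ln_card[OF law_distribution, of \<omega> ?W] by simp
  also have "\<dots> = real ?c" using c by simp
  also have "?c \<le> ball_card \<omega> n"
    using walk_proper length_subproducts[of _ ?W] assms(1)
    by (intro card_subproducts_le_volume) (meson order_trans)
  finally show ?thesis by simp
qed

lemma periodic_twos_block_stream: "periodic_twos (block_stream t 0)"
proof
  fix m :: nat
  define k where "k = m div 3"
  have "m = 3 * k \<or> m = 3 * k + 1 \<or> m = 3 * k + 2" unfolding k_def by presburger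
  then show "(block_stream t 0 !! m = L2) = (m mod 3 = 0)"
  proof (elim disjE)
    assume "m = 3 * k"
    then show ?thesis using snth_block_stream(1)[of t k] by simp
  next
    assume m: "m = 3 * k + 1"
    then have "m mod 3 \<noteq> 0" by presburger
    then show ?thesis using snth_block_stream(2)[of t k] m by (simp split: if_splits)
  next
    assume m: "m = 3 * k + 2"
    then have "m mod 3 \<noteq> 0" by presburger
    then show ?thesis using snth_block_stream(3)[of t k] m by simp
  qed
qed

lemma eventually_nat_le:
  fixes f :: "real \<Rightarrow> real"
  assumes "(f \<longlongrightarrow> 0) at_top" "0 < e"
  shows "eventually (\<lambda>b::nat. f (real b) < e) sequentially"
proof -
  have "eventually (\<lambda>x. f x < e) at_top" using order_tendstoD(2)[OF assms] .
  then show ?thesis using filterlim_real_sequentially by (rule eventually_compose_filterlim)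
qed

text \<open>With \<open>(1/2) ^ (4 b) * 8 ^ b = (1/2) ^ b\<close> the left-hand side is at most a polynomial in \<open>b\<close> divided by \<open>2 ^ b\<close>.\<close>

lemma eventually_walk_condition:
  assumes Q: "0 < Q"
  shows "eventually (\<lambda>b. (1/2) ^ (4 * b) * (3 * real b * real Q
          + (3 + 3 * real b * real Q) * (real Q * (1 + 8 ^ b * (1 + 3 * real b * real Q)))) \<le> 1/4) sequentially"
proof -
  define q where "q = real Q"
  have q: "q > 0" using Q by (simp add: q_def)
  have "((\<lambda>b. (3 * b * q + (3 + 3 * b * q) * (q * (2 + 3 * b * q))) / 2 powr b) \<longlongrightarrow> 0) at_top"
    using q by real_asymp
  from eventually_nat_le[OF this, of "1/4"]
  have "eventually (\<lambda>b::nat. (3 * real b * q + (3 + 3 * real b * q) * (q * (2 + 3 * real b * q))) / 2 powr real b < 1/4) sequentially"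
    by simp
  then show ?thesis
  proof (rule eventually_mono)
    fix b :: nat
    assume a: "(3 * real b * q + (3 + 3 * real b * q) * (q * (2 + 3 * real b * q))) / 2 powr real b < 1/4"
    have e: "(1/2::real) ^ (4 * b) * 8 ^ b = (1/2) ^ b"
    proof -
      have "(1/2::real) ^ (4 * b) = (1/16) ^ b" by (simp add: power_mult power_one_over)
      then show ?thesis by (simp add: power_mult_distrib[symmetric])
    qed
    have le: "(1/2::real) ^ (4 * b) \<le> (1/2) ^ b" by (intro power_decreasing) auto
    have "(1/2) ^ (4 * b) * (3 * real b * q + (3 + 3 * real b * q) * (q * (1 + 8 ^ b * (1 + 3 * real b * q))))
       = (1/2) ^ (4 * b) * (3 * real b * q + (3 + 3 * real b * q) * q)
        + ((1/2) ^ (4 * b) * 8 ^ b) * ((3 + 3 * real b * q) * (q * (1 + 3 * real b * q)))"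
      by (simp add: algebra_simps)
    also have "\<dots> \<le> (1/2) ^ b * (3 * real b * q + (3 + 3 * real b * q) * q)
        + (1/2) ^ b * ((3 + 3 * real b * q) * (q * (1 + 3 * real b * q)))"
      unfolding e using le q by (intro add_mono mult_right_mono) auto
    also have "\<dots> = (3 * real b * q + (3 + 3 * real b * q) * (q * (2 + 3 * real b * q))) / 2 powr real b"
      by (simp add: powr_realpow power_one_over algebra_simps add_divide_distrib)
    finally show "(1/2) ^ (4 * b) * (3 * real b * real Q
          + (3 + 3 * real b * real Q) * (real Q * (1 + 8 ^ b * (1 + 3 * real b * real Q)))) \<le> 1/4"
      using less_imp_le[OF a] unfolding q_def by (rule order_trans)
  qed
qed

lemma floor_sqrt_le_sqrt: "real (floor_sqrt n) \<le> sqrt (real n)"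
proof (rule real_le_rsqrt)
  have "real ((floor_sqrt n)\<^sup>2) \<le> real n" using floor_sqrt_power2_le by (rule of_nat_mono)
  then show "(real (floor_sqrt n))\<^sup>2 \<le> real n" by simp
qed

lemma eventually_length_condition:
  assumes Q: "0 < Q"
  shows "eventually (\<lambda>b. (1 + real (3 * b * (Q + 2)))
      * (18 * (8 * real (Suc (floor_sqrt (b * (Q + 2)))) + 6) ^ Suc (floor_sqrt (b * (Q + 2)))) * real Q \<le> 2 ^ (4 * b)) sequentially"
proof -
  define q r where "q = real Q" and "r = real (Q + 2)"
  have q: "q > 0" "r > 0" using Q by (simp_all add: q_def r_def)
  have "((\<lambda>b. (1 + 3 * b * r) * (18 * (8 * (sqrt (b * r) + 1) + 6) powr (sqrt (b * r) + 1)) * q / 2 powr (4 * b)) \<longlongrightarrow> 0) at_top"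
    using q by real_asymp
  from eventually_nat_le[OF this, of 1]
  have "eventually (\<lambda>b::nat. (1 + 3 * real b * r) * (18 * (8 * (sqrt (real b * r) + 1) + 6) powr (sqrt (real b * r) + 1)) * q / 2 powr (4 * real b) < 1) sequentially"
    by simp
  then show ?thesis
  proof (rule eventually_mono)
    fix b :: nat
    assume a: "(1 + 3 * real b * r) * (18 * (8 * (sqrt (real b * r) + 1) + 6) powr (sqrt (real b * r) + 1)) * q / 2 powr (4 * real b) < 1"
    define p where "p = Suc (floor_sqrt (b * (Q + 2)))"
    have p: "real p \<le> sqrt (real b * r) + 1"
    proof -
      have "real (b * (Q + 2)) = real b * r" by (simp only: r_def of_nat_mult)
      then have "real (floor_sqrt (b * (Q + 2))) \<le> sqrt (real b * r)"
        using floor_sqrt_le_sqrt[of "b * (Q + 2)"] by (simp only:)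
      then show ?thesis unfolding p_def of_nat_Suc by linarith
    qed
    have s0: "0 \<le> sqrt (real b * r)" using q by simp
    have "(8 * real p + 6) ^ p = (8 * real p + 6) powr real p" by (simp add: powr_realpow)
    also have "\<dots> \<le> (8 * (sqrt (real b * r) + 1) + 6) powr real p"
      using p by (intro powr_mono2) auto
    also have "\<dots> \<le> (8 * (sqrt (real b * r) + 1) + 6) powr (sqrt (real b * r) + 1)"
      using p s0 by (intro powr_mono) auto
    finally have "(1 + 3 * real b * r) * (18 * (8 * real p + 6) ^ p) * q \<le>
       (1 + 3 * real b * r) * (18 * (8 * (sqrt (real b * r) + 1) + 6) powr (sqrt (real b * r) + 1)) * q"
      using q by (intro mult_right_mono mult_left_mono) auto
    also have "\<dots> \<le> 2 powr (4 * real b)" using a by (simp add: divide_less_eq)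
    also have "\<dots> = 2 ^ (4 * b)" using powr_realpow[of 2 "4 * b"] by simp
    finally have "(1 + 3 * real b * r) * (18 * (8 * real p + 6) ^ p) * q \<le> 2 ^ (4 * b)" .
    moreover have "real (3 * b * (Q + 2)) = 3 * real b * r" by (simp add: r_def algebra_simps)
    ultimately show "(1 + real (3 * b * (Q + 2)))
      * (18 * (8 * real (Suc (floor_sqrt (b * (Q + 2)))) + 6) ^ Suc (floor_sqrt (b * (Q + 2)))) * real Q \<le> 2 ^ (4 * b)"
      unfolding p_def[symmetric] q_def by (simp only:)
  qed
qed

context eta_root
begin

text \<open>The walk has \<open>8 ^ (b Q)\<close> bits. Its length exceeds the length scale of \<open>b Q\<close> blocks by a factor exponential in \<open>b\<close>, with
  a base independent of \<open>Q\<close>; by a large choice of \<open>Q\<close> this becomes an arbitrarily small power of the length.\<close>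

lemma eventually_volume_growth_ge:
  assumes t: "slow t" and Q: "0 < Q"
  shows "eventually (\<lambda>b. \<forall>n::nat. 8 ^ (5 * b) * len_scale t (b * Q) \<le> n \<longrightarrow>
     exp (bit_gain * 8 ^ (b * Q)) \<le> ball_card (block_stream t 0) n) sequentially"
  using eventually_walk_condition[OF Q] eventually_length_condition[OF Q] eventually_gt_at_top[of 0]
proof eventually_elim
  case (elim b)
  interpret periodic_twos "block_stream t 0" by (rule periodic_twos_block_stream)
  let ?W = "walk (block_stream t 0) b (map (jump_scale (8 ^ b) Q) [1..<Suc (8 ^ (b * Q))])"
  let ?P = "Suc (floor_sqrt (b * (Q + 2)))"
  show ?case
  proof (intro allI impI)
    fix n :: nat assume n: "8 ^ (5 * b) * len_scale t (b * Q) \<le> n"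
    have L0: "0 \<le> len_scale t k" for k using len_scale_grow(3)[of t k] by simp
    have "b * (Q + 2) \<le> ?P\<^sup>2" using Suc_floor_sqrt_power2_gt[of "b * (Q + 2)"] by linarith
    then have "real (sum_list (map length ?W)) \<le> (1 + real (3 * b * (Q + 2))) * (18 * (8 * real ?P + 6) ^ ?P)
         * (real Q * 8 ^ b * len_scale t (b * (Q + 2)))"
      by (rule length_walk_le[OF t Q])
    also have "\<dots> = ((1 + real (3 * b * (Q + 2))) * (18 * (8 * real ?P + 6) ^ ?P) * real Q)
         * (8 ^ b * len_scale t (b * (Q + 2)))" by (simp only: mult_ac)
    \<comment> \<open>The largest jumps reach \<open>2 b\<close> blocks beyond \<open>b Q\<close>, which costs at most 16 per block.\<close>
    also have "\<dots> \<le> 2 ^ (4 * b) * (8 ^ b * (16 ^ (2 * b) * len_scale t (b * Q)))"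
    proof (intro mult_mono elim(2))
      have "b * (Q + 2) = b * Q + 2 * b" by simp
      then show "len_scale t (b * (Q + 2)) \<le> 16 ^ (2 * b) * len_scale t (b * Q)"
        using len_scale_grow(2)[of t "b * Q" "2 * b"] by (simp only:)
    qed (use L0 in auto)
    also have "\<dots> = 8 ^ (5 * b) * len_scale t (b * Q)"
    proof -
      have "(2::real) ^ (4 * b) * (8 ^ b * 16 ^ (2 * b)) = 8 ^ (5 * b)"
        by (simp add: power_mult flip: power_mult_distrib)
      then show ?thesis by (simp only: mult.assoc[symmetric])
    qed
    also have "\<dots> \<le> n" by (rule n)
    finally have len: "sum_list (map length ?W) \<le> n" by simp
    show "exp (bit_gain * 8 ^ (b * Q)) \<le> ball_card (block_stream t 0) n"
      by (rule exp_entropy_le_volume[OF len entropy_walk_ge[OF elim(3) Q elim(1)]])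
  qed
qed

end

section \<open>Prescribing the growth\<close>

locale growth_function = eta_root +
  fixes F :: "real \<Rightarrow> real"
  assumes F_pos: "\<And>R. 0 < R \<Longrightarrow> 0 < F R"
    and F_mono: "\<And>R S. 0 < R \<Longrightarrow> R \<le> S \<Longrightarrow> F R \<le> F S"
    and F_double: "\<And>R. 0 < R \<Longrightarrow> F (2 * R) \<le> 2 * F R"
    and F_stretch: "\<And>R. 0 < R \<Longrightarrow> 2 * F R \<le> F (2 * R / \<eta>)"
begin

lemma F_double_power: "0 < R \<Longrightarrow> F (2 ^ k * R) \<le> 2 ^ k * F R"
proof (induction k)
  case (Suc k)
  have "F (2 * (2 ^ k * R)) \<le> 2 * F (2 ^ k * R)" using Suc.prems by (intro F_double) simp
  with Suc show ?case by (simp add: mult.assoc)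
qed simp

lemma F_stretch_power: "0 < R \<Longrightarrow> 2 ^ k * F R \<le> F ((2 / \<eta>) ^ k * R)"
proof (induction k)
  case (Suc k)
  have e: "0 < \<eta>" using eta_bounds by simp
  have "2 * F ((2 / \<eta>) ^ k * R) \<le> F (2 * ((2 / \<eta>) ^ k * R) / \<eta>)"
    using Suc.prems e by (intro F_stretch) simp
  with Suc show ?case by (simp add: mult.assoc)
qed simp

lemma F_eight: "0 < R \<Longrightarrow> F (8 ^ k * R) \<le> 8 ^ k * F R"
proof -
  assume "0 < R"
  moreover have "(2::real) ^ (3 * k) = 8 ^ k" by (simp add: power_mult)
  ultimately show ?thesis using F_double_power[of R "3 * k"] by (simp only:)
qed

lemma F_sixteen: "0 < R \<Longrightarrow> F (16 ^ k * R) \<le> 16 ^ k * F R"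
proof -
  assume "0 < R"
  moreover have "(2::real) ^ (4 * k) = 16 ^ k" by (simp add: power_mult)
  ultimately show ?thesis using F_double_power[of R "4 * k"] by (simp only:)
qed

lemma ratio_pos: "0 < ratio u"
  using ratio_bounds(1)[of u] by linarith

lemma F_ratio_le: "0 < R \<Longrightarrow> F (ratio u ^ k * R) \<le> 16 ^ k * F R"
proof -
  assume R: "0 < R"
  have "ratio u ^ k * R \<le> 16 ^ k * R"
    using R ratio_bounds[of u] ratio_pos[of u] by (intro mult_right_mono power_mono) auto
  then have "F (ratio u ^ k * R) \<le> F (16 ^ k * R)"
    using R ratio_pos[of u] by (intro F_mono) auto
  with F_sixteen[OF R, of k] show ?thesis by linarith
qed

lemma F_ratio_ge: "0 < R \<Longrightarrow> 8 ^ k * F R \<le> F (ratio True ^ k * R)"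
proof -
  assume "0 < R"
  moreover have "(2::real) ^ (3 * k) = 8 ^ k" by (simp add: power_mult)
  moreover have "(2 / \<eta>) ^ (3 * k) = ratio True ^ k"
    by (simp add: power_mult ratio_def rho_def power_divide)
  ultimately show ?thesis using F_stretch_power[of R "3 * k"] by (simp only:)
qed

text \<open>The type of a run of \<open>2 p + 1\<close> blocks, beginning at \<open>p\<^sup>2\<close>, is chosen by feedback: 201 if \<open>F\<close> lags behind the power of 8 at the
  end of the run. The definition recurses on the length scale at \<open>p\<^sup>2\<close> because the choices depend on it.\<close>

fun square_scale :: "nat \<Rightarrow> real" where
  "square_scale 0 = 1"
| "square_scale (Suc p) =
     ratio (F (square_scale p) < 8 ^ (p\<^sup>2 + (2 * p + 1))) ^ (2 * p + 1) * square_scale p"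

definition block_type :: "nat \<Rightarrow> bool" where
  "block_type i = (let p = floor_sqrt i in F (square_scale p) < 8 ^ (p\<^sup>2 + (2 * p + 1)))"

lemma slow_block_type: "slow block_type"
  unfolding slow_def block_type_def by simp

lemma square_scale_eq: "square_scale p = len_scale block_type (p\<^sup>2)"
proof (induction p)
  case (Suc p)
  have "(Suc p)\<^sup>2 = p\<^sup>2 + (2 * p + 1)" by (simp add: power2_eq_square)
  moreover have "len_scale block_type (p\<^sup>2 + (2 * p + 1))
      = len_scale block_type (p\<^sup>2) * ratio (block_type (p\<^sup>2)) ^ (2 * p + 1)"
  proof (rule len_scale_const)
    fix i assume "p\<^sup>2 \<le> i" "i < p\<^sup>2 + (2 * p + 1)"
    then show "block_type i = block_type (p\<^sup>2)"
      by (intro slow_const[OF slow_block_type]) (simp_all add: power2_eq_square)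
  qed
  moreover have "block_type (p\<^sup>2) \<longleftrightarrow> F (square_scale p) < 8 ^ (p\<^sup>2 + (2 * p + 1))"
    by (simp add: block_type_def)
  then have "square_scale (Suc p) = ratio (block_type (p\<^sup>2)) ^ (2 * p + 1) * square_scale p"
    by (simp only: square_scale.simps)
  ultimately show ?case by (simp only: Suc mult.commute)
qed simp

text \<open>Blocks 201 do not decrease \<open>F L / 8 ^ k\<close> and at most double it each time; blocks 211 do not increase it and divide it by at most 8.
  The threshold leaves room for a whole run, so neither bound is ever violated.\<close>

lemma F_len_scale_step:
  assumes c: "c \<le> 1" and M: "1 \<le> M"
    and lo: "c * 8 ^ p\<^sup>2 \<le> F (len_scale block_type (p\<^sup>2))"
    and up: "F (len_scale block_type (p\<^sup>2)) \<le> M * 16 ^ (2 * p + 1) * 8 ^ p\<^sup>2"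
    and n: "n \<le> 2 * p + 1"
  shows "c * 8 ^ (p\<^sup>2 + n) \<le> F (len_scale block_type (p\<^sup>2 + n))
    \<and> F (len_scale block_type (p\<^sup>2 + n)) \<le> M * 16 ^ (2 * p + 1) * 8 ^ (p\<^sup>2 + n)"
proof -
  let ?L = "len_scale block_type (p\<^sup>2)" and ?u = "block_type (p\<^sup>2)"
  have L: "0 < ?L" using len_scale_grow(3)[of block_type "p\<^sup>2"] by simp
  have const: "block_type i = ?u" if "p\<^sup>2 \<le> i" "i < p\<^sup>2 + n" for i
    by (rule slow_const[OF slow_block_type that(1)]) (use that n in \<open>simp add: power2_eq_square\<close>)
  have Ln: "len_scale block_type (p\<^sup>2 + n) = ratio ?u ^ n * ?L"
    using len_scale_const[of "p\<^sup>2" n block_type ?u, OF const] by (simp only: mult.commute)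
  have u: "?u \<longleftrightarrow> F ?L < 8 ^ (p\<^sup>2 + (2 * p + 1))"
    by (simp add: block_type_def square_scale_eq)
  show ?thesis
  proof (cases ?u)
    case True
    have "c * 8 ^ (p\<^sup>2 + n) = 8 ^ n * (c * 8 ^ p\<^sup>2)" by (simp add: power_add)
    also have "\<dots> \<le> 8 ^ n * F ?L" using lo by simp
    also have "\<dots> \<le> F (ratio True ^ n * ?L)" by (rule F_ratio_ge[OF L])
    finally have 1: "c * 8 ^ (p\<^sup>2 + n) \<le> F (ratio True ^ n * ?L)" .
    have "F (ratio True ^ n * ?L) \<le> 16 ^ n * F ?L" by (rule F_ratio_le[OF L])
    also have "\<dots> \<le> 16 ^ n * 8 ^ (p\<^sup>2 + (2 * p + 1))" using True u by simp
    also have "\<dots> = 2 ^ n * 8 ^ (2 * p + 1) * 8 ^ (p\<^sup>2 + n)"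
    proof -
      have "(16::real) ^ n = 2 ^ n * 8 ^ n" by (simp add: power_mult_distrib[symmetric])
      then show ?thesis by (simp add: power_add)
    qed
    also have "\<dots> \<le> 2 ^ (2 * p + 1) * 8 ^ (2 * p + 1) * 8 ^ (p\<^sup>2 + n)"
      using n by (intro mult_right_mono power_increasing) auto
    also have "\<dots> = 1 * 16 ^ (2 * p + 1) * 8 ^ (p\<^sup>2 + n)"
      by (simp only: power_mult_distrib[symmetric]) simp
    also have "\<dots> \<le> M * 16 ^ (2 * p + 1) * 8 ^ (p\<^sup>2 + n)"
      using M by (intro mult_right_mono) auto
    finally show ?thesis using 1 True by (simp add: Ln)
  next
    case False
    then have r: "ratio ?u = 8" by (simp add: ratio_def rho_def)
    have "c * 8 ^ (p\<^sup>2 + n) \<le> 1 * 8 ^ (p\<^sup>2 + (2 * p + 1))"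
      using c n by (intro mult_mono power_increasing) auto
    also have "\<dots> \<le> F ?L" using False u by simp
    also have "\<dots> \<le> F (8 ^ n * ?L)"
      using L one_le_power[of "8::real" n] by (intro F_mono) auto
    finally have 1: "c * 8 ^ (p\<^sup>2 + n) \<le> F (8 ^ n * ?L)" .
    have "F (8 ^ n * ?L) \<le> 8 ^ n * F ?L" by (rule F_eight[OF L])
    also have "\<dots> \<le> 8 ^ n * (M * 16 ^ (2 * p + 1) * 8 ^ p\<^sup>2)" using up by simp
    also have "\<dots> = M * 16 ^ (2 * p + 1) * 8 ^ (p\<^sup>2 + n)" by (simp add: power_add mult_ac)
    finally show ?thesis using 1 by (simp add: Ln r)
  qed
qed

lemma F_len_scale:
  assumes n: "n \<le> 2 * p + 1"
  shows "min 1 (F 1) * 8 ^ (p\<^sup>2 + n) \<le> F (len_scale block_type (p\<^sup>2 + n))"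
    "F (len_scale block_type (p\<^sup>2 + n)) \<le> max 1 (F 1) * 16 ^ (2 * p + 1) * 8 ^ (p\<^sup>2 + n)"
proof -
  let ?c = "min 1 (F 1)" and ?M = "max 1 (F 1)"
  have "?c * 8 ^ p\<^sup>2 \<le> F (len_scale block_type (p\<^sup>2))
    \<and> F (len_scale block_type (p\<^sup>2)) \<le> ?M * 16 ^ (2 * p + 1) * 8 ^ p\<^sup>2" for p
  proof (induction p)
    case 0
    have "F 1 \<le> ?M * 16" using F_pos[of 1] by (simp add: max_def)
    then show ?case by simp
  next
    case (Suc p)
    have sq: "(Suc p)\<^sup>2 = p\<^sup>2 + (2 * p + 1)" by (simp add: power2_eq_square)
    have "?M * 16 ^ (2 * p + 1) * 8 ^ (Suc p)\<^sup>2 \<le> ?M * 16 ^ (2 * Suc p + 1) * 8 ^ (Suc p)\<^sup>2"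
      by (intro mult_right_mono mult_left_mono power_increasing) auto
    moreover have "?c * 8 ^ (Suc p)\<^sup>2 \<le> F (len_scale block_type ((Suc p)\<^sup>2))
      \<and> F (len_scale block_type ((Suc p)\<^sup>2)) \<le> ?M * 16 ^ (2 * p + 1) * 8 ^ (Suc p)\<^sup>2"
      unfolding sq by (rule F_len_scale_step) (use Suc in auto)
    ultimately show ?case by linarith
  qed
  with F_len_scale_step[of ?c ?M p n] n
  show "?c * 8 ^ (p\<^sup>2 + n) \<le> F (len_scale block_type (p\<^sup>2 + n))"
    "F (len_scale block_type (p\<^sup>2 + n)) \<le> ?M * 16 ^ (2 * p + 1) * 8 ^ (p\<^sup>2 + n)" by auto
qed

lemma F_len_scale_bounds:
  "min 1 (F 1) * 8 ^ k \<le> F (len_scale block_type k)"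
  "F (len_scale block_type k) \<le> max 1 (F 1) * 16 ^ (2 * floor_sqrt k + 1) * 8 ^ k"
proof -
  let ?p = "floor_sqrt k"
  have "?p\<^sup>2 \<le> k" "k < (Suc ?p)\<^sup>2" by (simp_all add: floor_sqrt_power2_le Suc_floor_sqrt_power2_gt)
  then have k: "?p\<^sup>2 + (k - ?p\<^sup>2) = k" "k - ?p\<^sup>2 \<le> 2 * ?p + 1" by (auto simp: power2_eq_square)
  show "min 1 (F 1) * 8 ^ k \<le> F (len_scale block_type k)"
    "F (len_scale block_type k) \<le> max 1 (F 1) * 16 ^ (2 * floor_sqrt k + 1) * 8 ^ k"
    using F_len_scale[OF k(2)] unfolding k(1) by auto
qed

abbreviation ball_size :: "nat \<Rightarrow> real" where
  "ball_size n \<equiv> real (ball_card (block_stream block_type 0) n)"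

text \<open>Take the least \<open>k\<close> whose length scale reaches \<open>n\<close>. The constant that remains in front of \<open>F n\<close> is absorbed by stretching the
  argument.\<close>

lemma upper_bound: "\<exists>C>0. \<forall>n\<ge>1. ball_size n \<le> exp (F (C * real n))"
proof -
  obtain \<Theta> where th: "\<Theta> > 0" and v: "\<And>n k. ball_size n \<le> exp (\<Theta> * (\<Prod>i<k. rho (block_type i)) * n + \<Theta> * 8 ^ k)"
    using volume_growth_le by blast
  define c where "c = min 1 (F 1)"
  have c: "0 < c" "c \<le> F 1" using F_pos[of 1] by (auto simp: c_def)
  obtain j :: nat where j: "16 * \<Theta> / c < 2 ^ j" using real_arch_pow[of 2 "16 * \<Theta> / c"] by auto
  have e: "0 < \<eta>" using eta_bounds by simp
  have A: "ball_size n \<le> exp (F ((2 / \<eta>) ^ j * n))" if n: "n \<ge> 1" for n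
  proof -
    let ?L = "len_scale block_type"
    have "real n < 2 ^ n" by (rule of_nat_less_two_power)
    also have "\<dots> \<le> (8::real) ^ n" by (intro power_mono) auto
    also have "\<dots> \<le> ?L n" using len_scale_grow(1)[of n block_type 0] by simp
    finally have ex: "real n \<le> ?L n" by simp
    define k where "k = (LEAST k. real n \<le> ?L k)"
    have k: "real n \<le> ?L k" unfolding k_def by (rule LeastI) (rule ex)
    have Fn: "c * 8 ^ k \<le> 8 * F n"
    proof (cases k)
      case 0
      have "F 1 \<le> F n" using n by (intro F_mono) auto
      with c 0 F_pos[of 1] show ?thesis by simp
    next
      case (Suc k')
      then have "\<not> real n \<le> ?L k'" unfolding k_def by (intro not_less_Least) simp
      then have "F (?L k') \<le> F n" using len_scale_grow(3)[of block_type k'] by (intro F_mono) auto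
      with F_len_scale_bounds(1)[of k'] show ?thesis by (simp add: Suc c_def)
    qed
    have "(\<Prod>i<k. rho (block_type i)) * ?L k = 8 ^ k"
    proof -
      have "rho u \<noteq> 0" for u using rho_bounds[of u] by auto
      then have "(\<Prod>i<k. rho (block_type i) * ratio (block_type i)) = (\<Prod>i<k. 8)"
        by (intro prod.cong) (auto simp: ratio_def)
      then show ?thesis by (simp add: len_scale_def prod.distrib)
    qed
    moreover have "0 \<le> (\<Prod>i<k. rho (block_type i))"
      by (intro prod_nonneg) (use rho_bounds in \<open>force intro: order_trans[of 0 "1/2"] less_imp_le\<close>)
    ultimately have "(\<Prod>i<k. rho (block_type i)) * n \<le> 8 ^ k"
      using mult_left_mono[OF k] by metis
    then have "\<Theta> * ((\<Prod>i<k. rho (block_type i)) * n) \<le> \<Theta> * 8 ^ k" using th by simp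
    then have "\<Theta> * (\<Prod>i<k. rho (block_type i)) * n + \<Theta> * 8 ^ k \<le> 2 * \<Theta> * 8 ^ k" by (simp add: mult.assoc)
    also have "\<dots> = (2 * \<Theta> / c) * (c * 8 ^ k)" using c by simp
    also have "\<dots> \<le> (2 * \<Theta> / c) * (8 * F n)" using Fn th c by (intro mult_left_mono) auto
    also have "\<dots> = 16 * \<Theta> / c * F n" by simp
    also have "\<dots> \<le> 2 ^ j * F n" using j F_pos[of n] n by (intro mult_right_mono) auto
    also have "\<dots> \<le> F ((2 / \<eta>) ^ j * n)" using n by (intro F_stretch_power) simp
    finally show ?thesis using v[of n k] by (meson exp_le_cancel_iff order_trans)
  qed
  have B: "0 < (2 / \<eta>) ^ j" using e by simp
  show ?thesis
    by (rule exI[of _ "(2 / \<eta>) ^ j"], rule conjI[OF B], intro allI impI, rule A)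
qed

lemma eventually_ratio_condition:
  "eventually (\<lambda>b. 8 ^ 5 * 16 ^ Q * (M * 16 ^ (2 * floor_sqrt (b * Q) + 1)) \<le> (8::real) ^ b) sequentially"
  if Q: "0 < Q" and M: "0 \<le> M"
proof -
  define q where "q = real Q"
  have q: "q > 0" using Q by (simp add: q_def)
  define M' where "M' = 8 ^ 5 * 16 ^ Q * M"
  have "((\<lambda>b. M' * 16 powr (2 * sqrt (b * q) + 1) / 8 powr b) \<longlongrightarrow> 0) at_top"
    using q by real_asymp
  from eventually_nat_le[OF this, of 1]
  have "eventually (\<lambda>b::nat. M' * 16 powr (2 * sqrt (real b * q) + 1) / 8 powr real b < 1) sequentially"
    by simp
  then show ?thesis
  proof (rule eventually_mono)
    fix b :: nat
    assume a: "M' * 16 powr (2 * sqrt (real b * q) + 1) / 8 powr real b < 1"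
    have "(16::real) ^ (2 * floor_sqrt (b * Q) + 1) = 16 powr (2 * real (floor_sqrt (b * Q)) + 1)"
      using powr_realpow[of 16 "2 * floor_sqrt (b * Q) + 1"] by (simp add: add.commute)
    also have "\<dots> \<le> 16 powr (2 * sqrt (real b * q) + 1)"
      using floor_sqrt_le_sqrt[of "b * Q"] by (intro powr_mono) (auto simp: q_def)
    finally have "M' * 16 ^ (2 * floor_sqrt (b * Q) + 1) \<le> M' * 16 powr (2 * sqrt (real b * q) + 1)"
      using M by (intro mult_left_mono) (auto simp: M'_def)
    also have "\<dots> \<le> 8 powr real b" using a by (simp add: divide_less_eq)
    finally show "8 ^ 5 * 16 ^ Q * (M * 16 ^ (2 * floor_sqrt (b * Q) + 1)) \<le> (8::real) ^ b"
      by (simp add: powr_realpow M'_def mult_ac)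
  qed
qed

text \<open>With \<open>Q \<ge> 6 / \<epsilon>\<close> and the largest \<open>b\<close> whose walk fits into the ball, \<open>F n\<close> exceeds the number \<open>8 ^ (b Q)\<close> of bits at most by the factor
  \<open>8 ^ (6 b)\<close>, and this is at most \<open>n powr \<epsilon>\<close> because \<open>n \<ge> 8 ^ (b Q)\<close>. Small \<open>n\<close> are handled by the trivial bound 2.\<close>

lemma lower_bound:
  assumes eps: "0 < \<epsilon>"
  shows "\<exists>c>0. \<forall>n\<ge>1. exp (c / real n powr \<epsilon> * F n) \<le> ball_size n"
proof -
  let ?L = "len_scale block_type"
  define Q where "Q = nat \<lceil>6 / \<epsilon>\<rceil>"
  have Qe: "6 \<le> \<epsilon> * Q"
  proof -
    have "6 / \<epsilon> \<le> real Q" unfolding Q_def by linarith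
    then show ?thesis using eps by (simp add: divide_le_eq mult.commute)
  qed
  have Q: "0 < Q" using Qe by (cases Q) auto
  define M where "M = max 1 (F 1)"
  have M: "0 \<le> M" by (simp add: M_def)
  obtain b0 where b0: "\<And>b n. b0 \<le> b \<Longrightarrow> 8 ^ (5 * b) * ?L (b * Q) \<le> real n \<Longrightarrow> exp (bit_gain * 8 ^ (b * Q)) \<le> ball_size n"
     "\<And>b. b0 \<le> b \<Longrightarrow> 8 ^ 5 * 16 ^ Q * (M * 16 ^ (2 * floor_sqrt (b * Q) + 1)) \<le> (8::real) ^ b"
    using eventually_conj[OF eventually_volume_growth_ge[OF slow_block_type Q] eventually_ratio_condition[OF Q M]]
    unfolding eventually_sequentially by blast
  define D where "D b = 8 ^ (5 * b) * ?L (b * Q)" for b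
  define n0 where "n0 = nat \<lceil>D b0\<rceil> + 1"
  have n0: "D b0 \<le> n0" "1 \<le> n0" unfolding n0_def by linarith+
  have large: "F n / real n powr \<epsilon> * bit_gain \<le> ln (ball_size n) \<and> 0 < ball_size n" if n: "n0 \<le> n" for n
  proof -
    have Dmono: "8 ^ b \<le> D b" for b
    proof -
      have "(8::real) ^ b * 1 \<le> 8 ^ (5 * b) * ?L (b * Q)"
        using len_scale_grow(3)[of block_type "b * Q"] by (intro mult_mono power_increasing) auto
      then show ?thesis by (simp add: D_def)
    qed
    have fin: "finite {b. D b \<le> n}"
    proof (rule finite_subset)
      show "{b. D b \<le> n} \<subseteq> {..n}"
      proof
        fix b assume "b \<in> {b. D b \<le> n}"
        then have "D b \<le> n" by simp
        with Dmono[of b] have "(8::real) ^ b \<le> real n" by (rule order_trans)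
        moreover have "real b < 8 ^ b"
          by (rule less_le_trans[OF of_nat_less_two_power power_mono]) simp_all
        ultimately have "real b \<le> real n" by linarith
        then show "b \<in> {..n}" by simp
      qed
    qed simp
    have mem: "b0 \<in> {b. D b \<le> n}" using n0(1) n by simp
    define b where "b = Max {b. D b \<le> n}"
    have b: "D b \<le> n" "b0 \<le> b" using Max_in[OF fin] Max_ge[OF fin mem] mem by (auto simp: b_def)
    have "\<not> D (Suc b) \<le> n" using Max_ge[OF fin, of "Suc b"] by (auto simp: b_def)
    then have nD: "real n < D (Suc b)" by simp
    have v: "exp (bit_gain * 8 ^ (b * Q)) \<le> ball_size n" by (rule b0(1)[OF b(2)]) (use b(1) in \<open>simp add: D_def\<close>)
    have vp: "0 < ball_size n" by (rule less_le_trans[OF exp_gt_zero v])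
    have npos: "1 \<le> n" using n n0 by simp
    have L0: "0 < ?L k" for k using len_scale_grow(3)[of block_type k] by simp
    have "F n \<le> F (8 ^ (5 * b + 5) * (16 ^ Q * ?L (b * Q)))"
    proof (rule F_mono)
      have "Suc b * Q = b * Q + Q" by simp
      then have "?L (Suc b * Q) \<le> 16 ^ Q * ?L (b * Q)"
        using len_scale_grow(2)[of block_type "b * Q" Q] by (simp only:)
      then have "D (Suc b) \<le> 8 ^ (5 * Suc b) * (16 ^ Q * ?L (b * Q))" by (simp only: D_def) simp
      then show "real n \<le> 8 ^ (5 * b + 5) * (16 ^ Q * ?L (b * Q))" using nD by (simp add: add.commute)
    qed (use npos in simp)
    also have "\<dots> \<le> 8 ^ (5 * b + 5) * F (16 ^ Q * ?L (b * Q))" using L0 by (intro F_eight) simp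
    also have "\<dots> \<le> 8 ^ (5 * b + 5) * (16 ^ Q * F (?L (b * Q)))"
      using F_sixteen[OF L0] by (intro mult_left_mono) auto
    also have "\<dots> \<le> 8 ^ (5 * b + 5) * (16 ^ Q * (M * 16 ^ (2 * floor_sqrt (b * Q) + 1) * 8 ^ (b * Q)))"
      using F_len_scale_bounds(2)[of "b * Q"] by (intro mult_left_mono) (auto simp: M_def)
    also have "\<dots> = 8 ^ (5 * b) * (8 ^ 5 * 16 ^ Q * (M * 16 ^ (2 * floor_sqrt (b * Q) + 1))) * 8 ^ (b * Q)"
      by (simp only: power_add mult_ac)
    also have "\<dots> \<le> 8 ^ (5 * b) * 8 ^ b * 8 ^ (b * Q)"
      using b0(2)[OF b(2)] by (intro mult_right_mono mult_left_mono) auto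
    also have "(8::real) ^ (5 * b) * 8 ^ b = 8 ^ (6 * b)" by (simp flip: power_add)
    finally have Fn: "F n \<le> 8 ^ (6 * b) * 8 ^ (b * Q)" .
    have "(8::real) ^ (6 * b) \<le> real n powr \<epsilon>"
    proof -
      have "8 ^ (b * Q) * 1 \<le> ?L (b * Q)" using len_scale_grow(1)[of "b * Q" block_type 0] by simp
      also have "\<dots> \<le> D b" using L0[of "b * Q"] one_le_power[of "8::real" "5 * b"] by (simp add: D_def)
      finally have "(8::real) ^ (b * Q) \<le> D b" by simp
      then have nb: "(8::real) ^ (b * Q) \<le> real n" using b(1) by (rule order_trans)
      have "(8::real) ^ (6 * b) = 8 powr (6 * real b)" using powr_realpow[of 8 "6 * b"] by simp
      also have "\<dots> \<le> 8 powr (\<epsilon> * Q * real b)" using Qe by (intro powr_mono mult_right_mono) auto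
      also have "\<dots> = (8 powr (real (b * Q))) powr \<epsilon>" by (simp add: powr_powr mult_ac)
      also have "\<dots> = (8 ^ (b * Q)) powr \<epsilon>" by (subst powr_realpow) auto
      also have "\<dots> \<le> real n powr \<epsilon>" using nb eps by (intro powr_mono2) auto
      finally show ?thesis .
    qed
    then have "8 ^ (6 * b) * 8 ^ (b * Q) \<le> real n powr \<epsilon> * 8 ^ (b * Q)" by simp
    then have "F n \<le> real n powr \<epsilon> * 8 ^ (b * Q)" by (rule order_trans[OF Fn])
    moreover have "0 < real n powr \<epsilon>" using npos by simp
    ultimately have "F n / real n powr \<epsilon> \<le> 8 ^ (b * Q)" by (simp only: pos_divide_le_eq mult.commute)
    then have "F n / real n powr \<epsilon> * bit_gain \<le> 8 ^ (b * Q) * bit_gain"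
      using bit_gain_pos by (intro mult_right_mono) auto
    also have "\<dots> = ln (exp (bit_gain * 8 ^ (b * Q)))" by simp
    also have "\<dots> \<le> ln (ball_size n)" by (rule iffD2[OF ln_le_cancel_iff[OF exp_gt_zero vp] v])
    finally show ?thesis using vp by (rule conjI)
  qed
  define c where "c = min bit_gain (ln 2 / F n0)"
  have Fn0: "0 < F n0" using n0(2) by (intro F_pos) simp
  have c: "0 < c" using bit_gain_pos Fn0 by (simp add: c_def)
  have "exp (c / real n powr \<epsilon> * F n) \<le> ball_size n" if n: "1 \<le> n" for n
  proof -
    have Fn: "0 < F n" using n by (intro F_pos) simp
    have pw: "1 \<le> real n powr \<epsilon>" using n eps by (simp add: ge_one_powr_ge_zero)
    show ?thesis
    proof (cases "n0 \<le> n")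
      case True
      have "c / real n powr \<epsilon> * F n = F n / real n powr \<epsilon> * c" by simp
      also have "\<dots> \<le> F n / real n powr \<epsilon> * bit_gain"
        using Fn pw by (intro mult_left_mono) (auto simp: c_def)
      also have "\<dots> \<le> ln (ball_size n)" using large[OF True] by simp
      finally show ?thesis using large[OF True] by (simp add: ln_ge_iff)
    next
      case False
      have "c / real n powr \<epsilon> \<le> c" using c pw by (simp add: divide_le_eq)
      then have "c / real n powr \<epsilon> * F n \<le> c * F n0"
        using Fn c False n by (intro mult_mono F_mono) auto
      also have "\<dots> \<le> ln 2 / F n0 * F n0" using Fn0 by (intro mult_right_mono) (auto simp: c_def)
      also have "\<dots> = ln 2" using Fn0 by simp
      finally have "exp (c / real n powr \<epsilon> * F n) \<le> exp (ln 2)" by (simp only: exp_le_cancel_iff)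
      also have "\<dots> = real 2" by simp
      also have "real 2 \<le> ball_size n"
      proof (rule of_nat_mono)
        let ?\<omega> = "block_stream block_type 0"
        have "act ?\<omega> [] [True] \<noteq> act ?\<omega> [GA] [True]" by simp
        then have ne: "act ?\<omega> [] \<noteq> act ?\<omega> [GA]" by metis
        have "card (act ?\<omega> ` {[], [GA]}) \<le> ball_card ?\<omega> n"
          unfolding volume_growth_eq using finite_short_words n
          by (intro card_mono image_mono) (auto simp: proper_words_def)
        then show "2 \<le> ball_card ?\<omega> n" using ne by simp
      qed
      finally show ?thesis .
    qed
  qed
  with c show ?thesis by blast
qed

end

text \<open>If \<open>f R \<le> 1\<close> for some \<open>R\<close>, the doubling inequality and monotonicity force \<open>f\<close> to be constant; so \<open>ln f\<close> is positive.\<close>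

lemma prescribed_growth:
  fixes f :: "real \<Rightarrow> real" and \<eta>\<^sub>0 :: real
  assumes eta0: "\<eta>\<^sub>0 ^ 3 + \<eta>\<^sub>0 ^ 2 + \<eta>\<^sub>0 - 2 = 0"
    and f_pos: "\<And>R. R > 0 \<Longrightarrow> f R > 0"
    and f_mono: "mono_on {0<..} f"
    and f_nonconst: "\<not> f constant_on {0<..}"
    and f_lower: "\<And>R. R > 0 \<Longrightarrow> f (2 * R) \<le> (f R)\<^sup>2"
    and f_upper: "\<And>R. R > 0 \<Longrightarrow> (f R)\<^sup>2 \<le> f (2 * R / \<eta>\<^sub>0)"
  shows "growth_function \<eta>\<^sub>0 (\<lambda>R. ln (f R))"
proof -
  interpret eta_root \<eta>\<^sub>0 by unfold_locales (rule eta0)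
  have e: "0 < \<eta>\<^sub>0" using eta_bounds by simp
  have mono: "f R \<le> f S" if "0 < R" "R \<le> S" for R S
    using f_mono that by (auto simp: mono_on_def)
  have ge1: "1 \<le> f R" if R: "0 < R" for R
  proof -
    have "f R \<le> f R * f R"
      using mono[of R "2 * R"] f_lower[OF R] R by (simp add: power2_eq_square)
    then show ?thesis using f_pos[OF R] by simp
  qed
  have ne1: "f R \<noteq> 1" if R: "0 < R" for R
  proof
    assume one: "f R = 1"
    have pow: "f (2 ^ k * R) \<le> 1" for k
    proof (induction k)
      case (Suc k)
      have "f (2 * (2 ^ k * R)) \<le> (f (2 ^ k * R))\<^sup>2" using R by (intro f_lower) simp
      also have "\<dots> \<le> 1" using Suc f_pos[of "2 ^ k * R"] R by (simp add: power_le_one)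
      finally show ?case by (simp add: mult.assoc)
    qed (simp add: one)
    have "f S = 1" if S: "0 < S" for S
    proof -
      obtain k where "S / R < 2 ^ k" using real_arch_pow[of 2 "S / R"] by auto
      then have "S \<le> 2 ^ k * R" using R by (simp add: divide_less_eq)
      then have "f S \<le> 1" using mono[OF S, of "2 ^ k * R"] pow[of k] by simp
      with ge1[OF S] show ?thesis by simp
    qed
    then have "f constant_on {0<..}" by (auto simp: constant_on_def)
    with f_nonconst show False by blast
  qed
  have gt1: "1 < f R" if "0 < R" for R using ge1[OF that] ne1[OF that] by simp
  show ?thesis
  proof unfold_locales
    fix R :: real assume R: "0 < R"
    show "0 < ln (f R)" using gt1[OF R] by simp
    have sq: "ln ((f R)\<^sup>2) = 2 * ln (f R)" using f_pos[OF R] by (simp add: ln_realpow)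
    show "ln (f (2 * R)) \<le> 2 * ln (f R)"
      unfolding sq[symmetric] using f_lower[OF R] f_pos[of "2 * R"] f_pos[OF R] R by (subst ln_le_cancel_iff) auto
    show "2 * ln (f R) \<le> ln (f (2 * R / \<eta>\<^sub>0))"
      unfolding sq[symmetric] using f_upper[OF R] f_pos[of "2 * R / \<eta>\<^sub>0"] f_pos[OF R] R e
      by (subst ln_le_cancel_iff) auto
    fix S assume "R \<le> S"
    then show "ln (f R) \<le> ln (f S)"
      using mono[OF R] f_pos[OF R] by (subst ln_le_cancel_iff) (use f_pos R in auto)
  qed
qed

theorem theorem8p5:
  fixes f :: "real \<Rightarrow> real" and \<eta>\<^sub>0 :: real
  assumes eta0: "\<eta>\<^sub>0 ^ 3 + \<eta>\<^sub>0 ^ 2 + \<eta>\<^sub>0 - 2 = 0"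
    and f_pos: "\<And>R. R > 0 \<Longrightarrow> f R > 0"
    and f_mono: "mono_on {0<..} f"
    and f_nonconst: "\<not> f constant_on {0<..}"
    and f_lower: "\<And>R. R > 0 \<Longrightarrow> f (2 * R) \<le> (f R)\<^sup>2"
    and f_upper: "\<And>R. R > 0 \<Longrightarrow> (f R)\<^sup>2 \<le> f (2 * R / \<eta>\<^sub>0)"
  shows "\<exists>\<omega> \<in> flat ` streams {[L2, L0, L1], [L2, L1, L1]}. \<exists>C>0. \<forall>\<epsilon>>0. \<exists>c>0. \<forall>n::nat. n \<ge> 1 \<longrightarrow>
           exp (c / real n powr \<epsilon> * ln (f (real n)))
             \<le> real (volume_growth (grigorchuk_group \<omega>) (grig_gens \<omega>) n) \<and>
           real (volume_growth (grigorchuk_group \<omega>) (grig_gens \<omega>) n) \<le> f (C * real n)"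
proof -
  interpret growth_function \<eta>\<^sub>0 "\<lambda>R. ln (f R)"
    by (rule prescribed_growth) (fact assms)+
  obtain C where C: "C > 0" "\<And>n. n \<ge> 1 \<Longrightarrow> ball_size n \<le> exp (ln (f (C * real n)))"
    using upper_bound by blast
  have up: "ball_size n \<le> f (C * real n)" if "n \<ge> 1" for n
  proof -
    have "0 < f (C * real n)" using C(1) that by (intro f_pos) simp
    with C(2)[OF that] show ?thesis by simp
  qed
  show ?thesis
  proof (rule bexI[OF _ block_stream_mem[of block_type 0]], rule exI[of _ C], rule conjI[OF C(1)], rule allI, rule impI)
    fix \<epsilon> :: real assume "0 < \<epsilon>"
    then obtain c where "c > 0" "\<And>n. n \<ge> 1 \<Longrightarrow> exp (c / real n powr \<epsilon> * ln (f (real n))) \<le> ball_size n"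
      using lower_bound by blast
    with up show "\<exists>c>0. \<forall>n::nat. n \<ge> 1 \<longrightarrow>
           exp (c / real n powr \<epsilon> * ln (f (real n))) \<le> ball_size n \<and> ball_size n \<le> f (C * real n)"
      by blast
  qed
qed

end
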